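(* Let $\mathcal{W} \subset \mathbb{P}^{2}_{\mathbb{C}}$ be the Wiman arrangement of $45$ lines, and let $\ell \in \mathcal{W}$ be any line. Then the arrangement $\mathcal{W}' := \mathcal{W} \setminus \{\ell\}$ is plus-one generated with exponents $(19,25,28)$.
   Context: Let $S=\mathbb{C}[x,y,z]$ with its standard grading. An arrangement of $d$ lines in $\mathbb{P}^2_{\mathbb{C}}$ is a set of $d$ pairwise distinct lines; it is regarded as the reduced plane curve $f=0$ of degree $d$, where $f\in S$ is the product of linear forms defining the lines. For a reduced plane curve $C:f=0$ of degree $d$, let $J_f=\langle \partial_x f,\partial_y f,\partial_z f\rangle$ be the Jacobian ideal and $M(f)=S/J_f$ the Milnor algebra. $C$ is an $m$-syzygy curve with exponents $(d_1,\ldots,d_m)$ if $M(f)$ has a minimal graded free resolution $$0 \rightarrow \bigoplus_{i=1}^{m-2}S(-e_{i}) \rightarrow \bigoplus_{i=1}^{m}S(1-d - d_{i}) \rightarrow S^{3}(1-d)\rightarrow S \rightarrow M(f) \rightarrow 0$$ with $e_1\le\cdots\le e_{m-2}$ and $1\le d_1\le\cdots\le d_m$. $C$ is plus-one generated with exponents $(d_1,d_2,d_3)$ if it is a $3$-syzygy curve with these exponents and $d_1+d_2=d$. The Wiman arrangement is the reflection arrangement of the complex reflection group $G_{27}$ (Shephard–Todd) acting on $\mathbb{C}^3$: let the alternating group $A_6$ be embedded in $\mathrm{PGL}_3(\mathbb{C})$ (the embedding, due to Valentiner and Wiman, is unique up to automorphism and conjugacy); each of its $45$ involutions fixes pointwise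 exactly one line of $\mathbb{P}^2_{\mathbb{C}}$, and $\mathcal{W}$ is the set of these $45$ lines. *)

theory Defs
  imports
    "HOL-Algebra.Sym_Groups"
    "HOL-Algebra.Multiplicative_Group"
    "HOL-Library.Poly_Mapping"
    "HOL-Library.Numeral_Type"
    "HOL-Computational_Algebra.Squarefree"
    "Jordan_Normal_Form.Matrix_Kernel"
begin

section \<open>The graded polynomial ring in three variables\<close>

text \<open>A monomial is an exponent vector indexed by the three-element type \<open>3\<close> with elements
  \<open>0, 1, 2\<close>; polynomials are finitely supported coefficient functions on monomials, multiplied
  by convolution.\<close>

type_synonym monomial = "3 \<Rightarrow>\<^sub>0 nat"
type_synonym polyC3 = "monomial \<Rightarrow>\<^sub>0 complex"

definition mdeg :: "monomial \<Rightarrow> nat" where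
  "mdeg m = (\<Sum>i\<in>UNIV. Poly_Mapping.lookup m i)"

text \<open>Degrees are integers so that they can be differences of twists; in a negative degree only
  the zero polynomial is homogeneous.\<close>

definition homogeneous :: "int \<Rightarrow> polyC3 \<Rightarrow> bool" where
  "homogeneous k p \<longleftrightarrow> (\<forall>m\<in>Poly_Mapping.keys p. int (mdeg m) = k)"

text \<open>If the exponent of variable \<open>i\<close> in \<open>m\<close> is \<open>0\<close>, the truncated subtraction is harmless
  because the coefficient vanishes.\<close>

definition pdiff :: "3 \<Rightarrow> polyC3 \<Rightarrow> polyC3" where
  "pdiff i p = (\<Sum>m\<in>Poly_Mapping.keys p.
     Poly_Mapping.single (m - Poly_Mapping.single i 1)
       (of_nat (Poly_Mapping.lookup m i) * Poly_Mapping.lookup p m))"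

definition jacobian_ideal :: "polyC3 \<Rightarrow> polyC3 set" where
  "jacobian_ideal f = {\<Sum>i\<in>UNIV. g i * pdiff i f | g :: 3 \<Rightarrow> polyC3. True}"

definition reduced_plane_curve :: "nat \<Rightarrow> polyC3 \<Rightarrow> bool" where
  "reduced_plane_curve d f \<longleftrightarrow> 0 < d \<and> homogeneous (int d) f \<and> squarefree f"


section \<open>Minimal graded free resolutions of cyclic modules\<close>

text \<open>A list \<open>as\<close> of integers stands for the graded free module \<open>\<Oplus>\<^sub>i S(-as!i)\<close>. A matrix acting
  on column vectors is a degree-preserving map \<open>\<Oplus>\<^sub>j S(-bs!j) \<rightarrow> \<Oplus>\<^sub>i S(-as!i)\<close> iff its entry
  at \<open>(i,j)\<close> is homogeneous of degree \<open>bs!j - as!i\<close>.\<close>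

definition graded_map :: "int list \<Rightarrow> int list \<Rightarrow> polyC3 mat \<Rightarrow> bool" where
  "graded_map as bs A \<longleftrightarrow> A \<in> carrier_mat (length as) (length bs) \<and>
     (\<forall>i<length as. \<forall>j<length bs. homogeneous (bs ! j - as ! i) (A $$ (i, j)))"

definition mat_image :: "polyC3 mat \<Rightarrow> polyC3 vec set" where
  "mat_image A = {A *\<^sub>v v | v. v \<in> carrier_vec (dim_col A)}"

text \<open>All entries lie in the irrelevant ideal \<open>(x,y,z)\<close>, i.e. the map vanishes modulo \<open>(x,y,z)\<close>.\<close>

definition minimal_map :: "polyC3 mat \<Rightarrow> bool" where
  "minimal_map A \<longleftrightarrow>
     (\<forall>i<dim_row A. \<forall>j<dim_col A. Poly_Mapping.lookup (A $$ (i, j)) 0 = 0)"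

text \<open>With \<open>F\<^sub>k\<close> the graded free module given by \<open>b ! k\<close> and \<open>A ! k : F\<^bsub>k+1\<^esub> \<rightarrow> F\<^sub>k\<close>, the
  following says that \<open>0 \<rightarrow> F\<^sub>n \<rightarrow> \<dots> \<rightarrow> F\<^sub>1 \<rightarrow> F\<^sub>0 = S \<rightarrow> S/I \<rightarrow> 0\<close> is a minimal graded free
  resolution. The last map is the quotient map, whose kernel is \<open>I\<close>; exactness at \<open>F\<^sub>0\<close> thus
  reads \<open>im (A ! 0) = I\<close>.\<close>

definition minimal_graded_free_resolution ::
    "polyC3 set \<Rightarrow> int list list \<Rightarrow> polyC3 mat list \<Rightarrow> bool" where
  "minimal_graded_free_resolution I b A \<longleftrightarrow>
     A \<noteq> [] \<and> length b = Suc (length A) \<and> b ! 0 = [0] \<and>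
     (\<forall>k<length A. graded_map (b ! k) (b ! Suc k) (A ! k) \<and> minimal_map (A ! k)) \<and>
     mat_image (A ! 0) = {vec 1 (\<lambda>_. p) | p. p \<in> I} \<and>
     (\<forall>k. Suc k < length A \<longrightarrow> mat_kernel (A ! k) = mat_image (A ! Suc k)) \<and>
     mat_kernel (last A) = {0\<^sub>v (dim_col (last A))}"


section \<open>Syzygy curves and plus-one generated curves\<close>

text \<open>Here \<open>m\<close> is \<open>length ds\<close>.\<close>

definition syzygy_curve :: "nat \<Rightarrow> polyC3 \<Rightarrow> nat list \<Rightarrow> bool" where
  "syzygy_curve d f ds \<longleftrightarrow>
     reduced_plane_curve d f \<and> sorted ds \<and> (\<forall>k\<in>set ds. 1 \<le> k) \<and>
     (\<exists>es A. sorted es \<and> length es + 2 = length ds \<and>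
        minimal_graded_free_resolution (jacobian_ideal f)
          [[0], replicate 3 (int d - 1), map (\<lambda>k. int d - 1 + int k) ds, es] A)"

definition plus_one_generated :: "nat \<Rightarrow> polyC3 \<Rightarrow> nat \<times> nat \<times> nat \<Rightarrow> bool" where
  "plus_one_generated d f = (\<lambda>(d1, d2, d3). syzygy_curve d f [d1, d2, d3] \<and> d1 + d2 = d)"


section \<open>Line arrangements in the complex projective plane\<close>

text \<open>Points of the projective plane are the one-dimensional subspaces of \<open>\<complex>\<^sup>3\<close>.\<close>

definition proj_point :: "complex vec \<Rightarrow> complex vec set" where
  "proj_point v = {c \<cdot>\<^sub>v v | c. True}"

definition proj_plane :: "complex vec set set" where
  "proj_plane = proj_point ` (carrier_vec 3 - {0\<^sub>v 3})"

text \<open>The line with equation \<open>a\<^sub>0 x + a\<^sub>1 y + a\<^sub>2 z = 0\<close> (the product \<open>\<bullet>\<close> is bilinear).\<close>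

definition proj_line :: "complex vec \<Rightarrow> complex vec set set" where
  "proj_line a = {p \<in> proj_plane. \<forall>v\<in>p. a \<bullet> v = 0}"

definition proj_lines :: "complex vec set set set" where
  "proj_lines = proj_line ` (carrier_vec 3 - {0\<^sub>v 3})"

definition linear_form :: "complex vec \<Rightarrow> polyC3" where
  "linear_form a =
     (\<Sum>i<3. Poly_Mapping.single (Poly_Mapping.single (of_nat i) 1) (a $ i))"

definition line_arrangement :: "complex vec set set set \<Rightarrow> bool" where
  "line_arrangement L \<longleftrightarrow> finite L \<and> L \<subseteq> proj_lines"

definition defining_polynomial :: "complex vec set set set \<Rightarrow> polyC3 \<Rightarrow> bool" where
  "defining_polynomial L f \<longleftrightarrow>
     (\<exists>a. (\<forall>l\<in>L. a l \<in> carrier_vec 3 - {0\<^sub>v 3} \<and> proj_line (a l) = l) \<and>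
          f = (\<Prod>l\<in>L. linear_form (a l)))"

lemma ex_defining_polynomial:
  assumes "line_arrangement L"
  shows "\<exists>f. defining_polynomial L f"
proof -
  have "\<forall>l\<in>L. \<exists>a. a \<in> carrier_vec 3 - {0\<^sub>v 3} \<and> proj_line a = l"
    using assms by (auto simp: line_arrangement_def proj_lines_def)
  then obtain a where "\<forall>l\<in>L. a l \<in> carrier_vec 3 - {0\<^sub>v 3} \<and> proj_line (a l) = l"
    by metis
  then show ?thesis
    unfolding defining_polynomial_def by blast
qed

text \<open>The linear forms are determined only up to nonzero scalars; the condition is imposed on every
  choice, and choices exist by the preceding lemma.\<close>

definition plus_one_generated_arrangement ::
    "complex vec set set set \<Rightarrow> nat \<times> nat \<times> nat \<Rightarrow> bool" where
  "plus_one_generated_arrangement L ds \<longleftrightarrow> line_arrangement L \<and>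
     (\<forall>f. defining_polynomial L f \<longrightarrow> plus_one_generated (card L) f ds)"


section \<open>The Wiman arrangement\<close>

definition GL3 :: "complex mat monoid" where
  "GL3 = units_of (ring_mat TYPE(complex) 3 ())"

definition scalars3 :: "complex mat set" where
  "scalars3 = {c \<cdot>\<^sub>m 1\<^sub>m 3 | c. c \<noteq> 0}"

definition PGL3 :: "complex mat set monoid" where
  "PGL3 = GL3 Mod scalars3"

text \<open>An element of \<open>PGL3\<close> is a coset \<open>K\<close> of matrices, all of which map a given point \<open>p\<close> to the
  same point.\<close>

definition pgl_act :: "complex mat set \<Rightarrow> complex vec set \<Rightarrow> complex vec set" where
  "pgl_act K p = (\<Union>M\<in>K. (\<lambda>v. M *\<^sub>v v) ` p)"

definition fixes_pointwise :: "complex mat set \<Rightarrow> complex vec set set \<Rightarrow> bool" where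
  "fixes_pointwise K l \<longleftrightarrow> (\<forall>p\<in>l. pgl_act K p = p)"

text \<open>Since the embedding of \<open>A\<^sub>6\<close> in \<open>PGL\<^sub>3(\<complex>)\<close> is unique only up to automorphism and conjugacy,
  a Wiman arrangement is one obtained from any such embedding.\<close>

definition wiman_arrangement :: "complex vec set set set \<Rightarrow> bool" where
  "wiman_arrangement W \<longleftrightarrow>
     (\<exists>\<phi> \<in> mon (alt_group 6) PGL3.
        W = {l \<in> proj_lines. \<exists>\<sigma> \<in> carrier (alt_group 6).
               group.ord (alt_group 6) \<sigma> = 2 \<and> fixes_pointwise (\<phi> \<sigma>) l})"

end

(* Coordinates. The projective representation is pinned down by traces: every involution of A6 has a
   unique lift of order two and determinant one, and the product of two such lifts has trace 0 if it
   has order three and a golden ratio as trace if it has order five. After diagonalizing a Klein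
   four-group, these conditions determine one further involution outside the monomial matrices, and
   conjugation yields the axes of all 45 involutions. They depend only on a golden ratio t and a
   primitive cube root of unity w.

   Freeness. All 45 reflections preserve Wiman's sextic F and its Hessian determinant G. The vector
   fields adj(Hess F) grad G and adj(Hess G) grad F, of degrees 19 and 25, are therefore tangent to all
   mirrors. Together with the Euler field they have a determinant of degree 45, which is nonzero
   because it is nonzero at (1, 2, 3); so it is a multiple of the product of the 45 linear forms and
   the arrangement is free by Saito's criterion.

   Deletion. Let the deleted line be x = 0; it carries 16 points of the arrangement. The restrictions of
   the two fields to it are proportional modulo the Euler field, and after division by the equation of
   these points the relation between them produces a vector field of degree 44 - 16 = 28 that is tangent
   to the other 44 lines only. It completes the generators, with a single relation in degree 29. *)

theory Submission
  imports Defs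
begin


section \<open>Polynomial algebra: substitution, derivations, grading, linear forms\<close>

section \<open>Evaluation of polynomials\<close>

text \<open>Each field is equivariant under every reflection, so the linear form of the mirror takes
  on it a value which the reflection negates; on the mirror the reflection is the identity, so this
  value vanishes there. The deletion rests on a divisibility due to Terao: the x-component of every
  field tangent to the 44 lines restricts on x = 0 to a multiple of a fixed polynomial of degree 44
  - 16. The new field has exactly this degree, so a multiple of it corrects any such field to one
  tangent to x = 0 as well, where the free basis takes over.

  The obstacle on the group side is that only a projective representation is given. Lifts of
  determinant one are ambiguous by cube roots of unity; square one removes this for involutions, and
  a product of two of them is inverted by conjugation with a factor, which removes it again. This
  makes traces meaningful.\<close>

abbreviation cst :: "complex \<Rightarrow> polyC3" where
  "cst c \<equiv> Poly_Mapping.single 0 c"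

definition var :: "3 \<Rightarrow> polyC3" where
  "var i = Poly_Mapping.single (Poly_Mapping.single i 1) 1"

lemma UNIV_3: "(UNIV :: 3 set) = {0, 1, 2}"
proof -
  have "i \<in> {0, 1, 2}" for i :: 3
  proof (cases i)
    case (of_int z)
    then have "z = 0 \<or> z = 1 \<or> z = 2" by auto
    with of_int show ?thesis by auto
  qed
  then show ?thesis by auto
qed

lemma sum_UNIV_3: "sum f (UNIV :: 3 set) = f 0 + f 1 + f 2"
  unfolding UNIV_3 by (subst sum.insert; simp add: add.assoc)+

lemma prod_UNIV_3: "prod f (UNIV :: 3 set) = f 0 * f 1 * f 2"
  unfolding UNIV_3 by (subst prod.insert; simp add: mult.assoc)+

lemma all_3: "(\<forall>i :: 3. P i) \<longleftrightarrow> P 0 \<and> P 1 \<and> P 2"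
  using UNIV_3 by (metis (full_types) UNIV_I insertE singletonD)

lemma fun_eq_3: "f = g \<longleftrightarrow> f 0 = g 0 \<and> f 1 = g 1 \<and> f (2::3) = g 2"
  by (simp add: fun_eq_iff all_3)

lemma poly_sum_monomials:
  "p = (\<Sum>m\<in>Poly_Mapping.keys p. Poly_Mapping.single m (Poly_Mapping.lookup p m))"
  by (rule poly_mapping_eqI)
    (auto simp: lookup_sum lookup_single when_def in_keys_iff)

lemma poly_induct_single [case_names single add]:
  fixes p :: "'a \<Rightarrow>\<^sub>0 'b::comm_monoid_add"
  assumes "\<And>m c. P (Poly_Mapping.single m c)" and "\<And>p q. P p \<Longrightarrow> P q \<Longrightarrow> P (p + q)"
  shows "P p"
proof -
  have "P (\<Sum>m\<in>A. Poly_Mapping.single m (Poly_Mapping.lookup p m))" if "finite A" for A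
    using that
  proof induction
    case empty
    show ?case using assms(1)[of undefined 0] by simp
  qed (simp add: assms)
  from this[of "Poly_Mapping.keys p"] show ?thesis
    by (simp flip: poly_sum_monomials)
qed

definition mon :: "(3 \<Rightarrow> 'a::comm_ring_1) \<Rightarrow> monomial \<Rightarrow> 'a" where
  "mon v m = (\<Prod>i\<in>UNIV. v i ^ Poly_Mapping.lookup m i)"

lemma mon_add: "mon v (m + n) = mon v m * mon v n"
  by (simp add: mon_def lookup_add power_add prod.distrib)

lemma mon_0 [simp]: "mon v 0 = 1"
  by (simp add: mon_def)

lemma mon_single: "mon v (Poly_Mapping.single i k) = v i ^ k"
proof -
  have "mon v (Poly_Mapping.single i k) = (\<Prod>j\<in>UNIV. if j = i then v i ^ k else 1)"
    unfolding mon_def by (rule prod.cong) (auto simp: lookup_single when_def)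
  then show ?thesis by simp
qed

text \<open>Coefficients pass through a map \<open>h\<close> and variables go to \<open>v\<close>,
  so one set of homomorphism rules serves both substitution of polynomials (\<open>subst\<close>)
  and numerical evaluation (\<open>ev\<close>).\<close>

definition ins :: "(complex \<Rightarrow> 'a) \<Rightarrow> (3 \<Rightarrow> 'a::comm_ring_1) \<Rightarrow> polyC3 \<Rightarrow> 'a" where
  "ins h v p = (\<Sum>m\<in>Poly_Mapping.keys p. h (Poly_Mapping.lookup p m) * mon v m)"

locale coeff_hom =
  fixes h :: "complex \<Rightarrow> 'a::comm_ring_1"
  assumes h0: "h 0 = 0" and h1: "h 1 = 1"
    and h_add: "h (a + b) = h a + h b" and h_mult: "h (a * b) = h a * h b"
begin

lemma ins_superset:
  assumes "finite A" "Poly_Mapping.keys p \<subseteq> A"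
  shows "ins h v p = (\<Sum>m\<in>A. h (Poly_Mapping.lookup p m) * mon v m)"
  unfolding ins_def using assms
  by (intro sum.mono_neutral_left) (auto simp: in_keys_iff h0)

lemma ins_single: "ins h v (Poly_Mapping.single m c) = h c * mon v m"
  using ins_superset[of "{m}" "Poly_Mapping.single m c"] by simp

lemma ins_add: "ins h v (p + q) = ins h v p + ins h v q"
proof -
  let ?A = "Poly_Mapping.keys p \<union> Poly_Mapping.keys q"
  have "Poly_Mapping.keys (p + q) \<subseteq> ?A" by (rule keys_add)
  then show ?thesis
    by (simp add: ins_superset[of ?A] lookup_add h_add distrib_right sum.distrib)
qed

lemma ins_mult: "ins h v (p * q) = ins h v p * ins h v q"
proof (induction p rule: poly_induct_single)
  case (single m c)
  show ?case
    by (induction q rule: poly_induct_single)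
      (simp_all add: ins_single ins_add mult_single mon_add h_mult algebra_simps)
qed (simp add: ins_add algebra_simps)

lemma ins_0: "ins h v 0 = 0"
  by (simp add: ins_def)

lemma ins_cst: "ins h v (cst c) = h c"
  by (simp add: ins_single)

lemma ins_var: "ins h v (var i) = v i"
  unfolding var_def by (subst ins_single) (simp add: mon_single h1)

lemma ins_1: "ins h v 1 = 1"
  using ins_cst[of v 1] by (simp add: h1)

lemma ins_uminus: "ins h v (- p) = - ins h v p"
  using ins_add[of v p "- p"] by (simp add: ins_0 eq_neg_iff_add_eq_0 add.commute)

lemma ins_diff: "ins h v (p - q) = ins h v p - ins h v q"
  using ins_add[of v p "- q"] by (simp add: ins_uminus)

lemma ins_power: "ins h v (p ^ n) = ins h v p ^ n"
  by (induction n) (simp_all add: ins_1 ins_mult)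

lemma ins_sum: "ins h v (sum f A) = (\<Sum>x\<in>A. ins h v (f x))"
  by (induction A rule: infinite_finite_induct) (simp_all add: ins_0 ins_add)

lemma ins_prod: "ins h v (prod f A) = (\<Prod>x\<in>A. ins h v (f x))"
  by (induction A rule: infinite_finite_induct) (simp_all add: ins_1 ins_mult)

lemma ins_numeral: "ins h v (numeral n) = numeral n"
  by (induction n) (simp_all only: numeral.simps ins_1 ins_add)

lemmas ins_simps = ins_0 ins_1 ins_numeral ins_add ins_diff ins_uminus ins_mult ins_power
  ins_sum ins_prod ins_cst ins_var

end

lemma cst_add: "cst (a + b) = cst a + cst b"
  by (rule single_add)

lemma cst_mult: "cst (a * b) = cst a * cst b"
  by (simp add: mult_single)

lemma cst_uminus: "cst (- a) = - cst a"
  by (rule single_uminus)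

lemma cst_diff: "cst (a - b) = cst a - cst b"
  by (rule single_diff)

lemma cst_sum: "cst (sum f A) = (\<Sum>x\<in>A. cst (f x))"
  by (induction A rule: infinite_finite_induct) (simp_all add: cst_add)

lemma cst_eq_0_iff [simp]: "cst a = 0 \<longleftrightarrow> a = 0"
  by (metis inj_single single_zero injD)

definition subst :: "(3 \<Rightarrow> polyC3) \<Rightarrow> polyC3 \<Rightarrow> polyC3" where
  "subst = ins cst"

definition ev :: "(3 \<Rightarrow> complex) \<Rightarrow> polyC3 \<Rightarrow> complex" where
  "ev = ins (\<lambda>c. c)"

interpretation subst: coeff_hom cst
  rewrites "ins cst = subst"
  by unfold_locales (simp_all add: cst_add cst_mult subst_def)

interpretation ev: coeff_hom "\<lambda>c. c"
  rewrites "ins (\<lambda>c. c) = ev"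
  by unfold_locales (simp_all add: ev_def)

lemmas subst_simps = subst.ins_simps
lemmas ev_simps = ev.ins_simps

lemma mon_var: "mon var m = Poly_Mapping.single m 1"
proof -
  have pow: "var i ^ k = Poly_Mapping.single (Poly_Mapping.single i k) 1" for i k
    by (induction k) (simp_all add: var_def mult_single flip: single_add)
  have "m = Poly_Mapping.single 0 (Poly_Mapping.lookup m 0) + Poly_Mapping.single 1 (Poly_Mapping.lookup m 1)
      + Poly_Mapping.single 2 (Poly_Mapping.lookup m 2)"
    by (rule poly_mapping_eqI)
      (use UNIV_3 in \<open>auto simp: lookup_add lookup_single when_def\<close>)
  then have "Poly_Mapping.single m 1 = mon var m"
    by (simp only: mon_def pow prod_UNIV_3 mult_single mult_1)
  then show ?thesis by simp
qed

lemma single_eq_mon: "Poly_Mapping.single m c = cst c * mon var m"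
  by (simp add: mon_var mult_single)

text \<open>Identities between ring homomorphisms or derivations need only be checked on constants
  and variables.\<close>

lemma poly_induct [case_names cst var add mult]:
  assumes cst: "\<And>c. P (cst c)" and var: "\<And>i. P (var i)"
    and add: "\<And>p q. P p \<Longrightarrow> P q \<Longrightarrow> P (p + q)" and mult: "\<And>p q. P p \<Longrightarrow> P q \<Longrightarrow> P (p * q)"
  shows "P p"
proof (induction p rule: poly_induct_single)
  case (single m c)
  have "P (var i ^ k)" for i k
    using cst[of 1] by (induction k) (simp_all add: var mult)
  then have "P (cst c * (var 0 ^ i * var 1 ^ j * var 2 ^ k))" for i j k
    by (simp only: mult cst)
  then show ?case
    by (subst single_eq_mon) (simp only: mon_def prod_UNIV_3)
qed (rule add)

lemma subst_var_id: "subst var p = p"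
  by (induction p rule: poly_induct) (simp_all only: subst_simps)

lemma subst_subst: "subst v (subst u p) = subst (\<lambda>i. subst v (u i)) p"
  by (induction p rule: poly_induct) (simp_all only: subst_simps)

text \<open>Multivariate form of the divisibility of p(x) - p(y) by x - y; with
  \<open>v = var\<close> and \<open>u\<close> a projection onto a plane it turns vanishing on the
  plane into divisibility.\<close>

lemma dvd_subst_diff:
  assumes "\<And>i. d dvd v i - u i"
  shows "d dvd subst v p - subst u p"
proof (induction p rule: poly_induct)
  case (add p q)
  then have "d dvd (subst v p - subst u p) + (subst v q - subst u q)" by (rule dvd_add)
  then show ?case by (simp add: subst_simps algebra_simps)
next
  case (mult p q)
  then have "d dvd (subst v p - subst u p) * subst v q + subst u p * (subst v q - subst u q)"
    by (intro dvd_add dvd_mult dvd_mult2)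
  then show ?case by (simp add: subst_simps algebra_simps)
qed (simp_all add: subst_simps assms)

section \<open>Partial derivatives and vector fields\<close>

lemma pdiff_superset:
  assumes "finite A" "Poly_Mapping.keys p \<subseteq> A"
  shows "pdiff i p = (\<Sum>m\<in>A. Poly_Mapping.single (m - Poly_Mapping.single i 1)
       (of_nat (Poly_Mapping.lookup m i) * Poly_Mapping.lookup p m))"
  unfolding pdiff_def using assms
  by (intro sum.mono_neutral_left) (auto simp: in_keys_iff)

lemma pdiff_single: "pdiff i (Poly_Mapping.single m c) =
    Poly_Mapping.single (m - Poly_Mapping.single i 1) (of_nat (Poly_Mapping.lookup m i) * c)"
  using pdiff_superset[of "{m}" "Poly_Mapping.single m c"] by simp

lemma pdiff_add: "pdiff i (p + q) = pdiff i p + pdiff i q"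
proof -
  let ?A = "Poly_Mapping.keys p \<union> Poly_Mapping.keys q"
  have "Poly_Mapping.keys (p + q) \<subseteq> ?A" by (rule keys_add)
  then show ?thesis
    by (simp add: pdiff_superset[of ?A] lookup_add distrib_left single_add sum.distrib)
qed

text \<open>Subtraction of exponents is truncated. In the product rule a zero exponent is made
  harmless by the vanishing coefficient, a positive one by this shift.\<close>

lemma monomial_shift:
  fixes m n :: monomial
  assumes "Poly_Mapping.lookup m i \<noteq> 0"
  shows "m - Poly_Mapping.single i 1 + n = m + n - Poly_Mapping.single i 1"
  using assms by (intro poly_mapping_eqI) (auto simp: lookup_add lookup_minus lookup_single when_def)

lemma pdiff_mult: "pdiff i (p * q) = pdiff i p * q + p * pdiff i q"
proof (induction p rule: poly_induct_single)
  case (single m c)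
  show ?case
  proof (induction q rule: poly_induct_single)
    case (single n d)
    show ?case
      using monomial_shift[of m i n] monomial_shift[of n i m]
      by (cases "Poly_Mapping.lookup m i = 0"; cases "Poly_Mapping.lookup n i = 0")
        (simp_all add: pdiff_single mult_single lookup_add algebra_simps flip: single_add)
  qed (simp add: pdiff_add algebra_simps)
qed (simp add: pdiff_add algebra_simps)

lemma pdiff_cst [simp]: "pdiff i (cst c) = 0"
  by (simp add: pdiff_single)

lemma pdiff_0 [simp]: "pdiff i 0 = 0"
  using pdiff_cst[of i 0] by simp

lemma pdiff_1 [simp]: "pdiff i 1 = 0"
  using pdiff_cst[of i 1] by simp

lemma pdiff_numeral [simp]: "pdiff i (numeral n) = 0"
  using pdiff_cst[of i "numeral n"] by simp

lemma pdiff_var: "pdiff i (var j) = (if i = j then 1 else 0)"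
  by (auto simp: var_def pdiff_single lookup_single)

lemma pdiff_uminus: "pdiff i (- p) = - pdiff i p"
  using pdiff_add[of i p "- p"] by (simp add: eq_neg_iff_add_eq_0 add.commute)

lemma pdiff_diff: "pdiff i (p - q) = pdiff i p - pdiff i q"
  using pdiff_add[of i p "- q"] by (simp add: pdiff_uminus)

lemma pdiff_sum: "pdiff i (sum f A) = (\<Sum>x\<in>A. pdiff i (f x))"
  by (induction A rule: infinite_finite_induct) (simp_all add: pdiff_add)

lemma pdiff_power: "pdiff i (p ^ n) = of_nat n * p ^ (n - 1) * pdiff i p"
proof (induction n)
  case (Suc n)
  then show ?case by (cases n) (simp_all add: pdiff_mult algebra_simps)
qed simp

lemmas pdiff_simps = pdiff_add pdiff_diff pdiff_uminus pdiff_mult pdiff_power pdiff_var pdiff_sum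

lemma pdiff_commute: "pdiff i (pdiff j p) = pdiff j (pdiff i p)"
  by (induction p rule: poly_induct) (simp_all add: pdiff_simps algebra_simps)

lemma pdiff_subst: "pdiff j (subst v p) = (\<Sum>i\<in>UNIV. subst v (pdiff i p) * pdiff j (v i))"
proof (induction p rule: poly_induct)
  case (var i)
  have "subst v (pdiff k (var i)) * pdiff j (v k) = (if k = i then pdiff j (v k) else 0)" for k
    by (simp add: pdiff_var subst_simps)
  then show ?case by (simp add: subst_simps)
qed (simp_all add: subst_simps pdiff_simps sum_UNIV_3 algebra_simps)

text \<open>A triple of polynomials is treated as the vector field with these components;
  \<open>var\<close> is then the Euler field.\<close>

definition der :: "(3 \<Rightarrow> polyC3) \<Rightarrow> polyC3 \<Rightarrow> polyC3" where
  "der \<theta> p = (\<Sum>i\<in>UNIV. \<theta> i * pdiff i p)"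

lemma der_add: "der \<theta> (p + q) = der \<theta> p + der \<theta> q"
  by (simp add: der_def pdiff_add algebra_simps sum.distrib)

lemma der_mult: "der \<theta> (p * q) = der \<theta> p * q + p * der \<theta> q"
  by (simp add: der_def pdiff_mult sum_UNIV_3 algebra_simps)

lemma der_cst [simp]: "der \<theta> (cst c) = 0"
  by (simp add: der_def)

lemma der_cst_mult: "der \<theta> (cst c * p) = cst c * der \<theta> p"
  by (simp add: der_mult)

lemma der_1 [simp]: "der \<theta> 1 = 0"
  by (simp add: der_def)

lemma der_var [simp]: "der \<theta> (var i) = \<theta> i"
  by (simp add: der_def pdiff_var if_distrib cong: if_cong)

section \<open>Homogeneous polynomials\<close>

lemma mdeg_add: "mdeg (m + n) = mdeg m + mdeg n"
  by (simp add: mdeg_def lookup_add sum.distrib)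

lemma mdeg_0 [simp]: "mdeg 0 = 0"
  by (simp add: mdeg_def)

lemma mdeg_single [simp]: "mdeg (Poly_Mapping.single i k) = k"
  by (simp add: mdeg_def lookup_single when_def)

lemma homogeneous_0 [simp]: "homogeneous k 0"
  by (simp add: homogeneous_def)

lemma homogeneous_single: "int (mdeg m) = k \<Longrightarrow> homogeneous k (Poly_Mapping.single m c)"
  by (simp add: homogeneous_def)

lemma homogeneous_cst [simp]: "homogeneous 0 (cst c)"
  by (simp add: homogeneous_single)

lemma homogeneous_1 [simp]: "homogeneous 0 1"
  using homogeneous_cst[of 1] by simp

lemma homogeneous_var [simp]: "homogeneous 1 (var i)"
  by (simp add: var_def homogeneous_single)

lemma homogeneous_add: "homogeneous k p \<Longrightarrow> homogeneous k q \<Longrightarrow> homogeneous k (p + q)"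
  using keys_add[of p q] by (auto simp: homogeneous_def)

lemma homogeneous_uminus: "homogeneous k p \<Longrightarrow> homogeneous k (- p)"
  by (auto simp: homogeneous_def in_keys_iff)

lemma homogeneous_diff: "homogeneous k p \<Longrightarrow> homogeneous k q \<Longrightarrow> homogeneous k (p - q)"
  using homogeneous_add[of k p "- q"] homogeneous_uminus[of k q] by simp

lemma homogeneous_sum: "(\<And>x. x \<in> A \<Longrightarrow> homogeneous k (f x)) \<Longrightarrow> homogeneous k (sum f A)"
  by (induction A rule: infinite_finite_induct) (auto intro: homogeneous_add)

lemma homogeneous_mult:
  assumes "homogeneous k p" "homogeneous n q"
  shows "homogeneous (k + n) (p * q)"
  unfolding homogeneous_def
proof
  fix m assume "m \<in> Poly_Mapping.keys (p * q)"
  then obtain a b where "m = a + b" "a \<in> Poly_Mapping.keys p" "b \<in> Poly_Mapping.keys q"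
    using keys_mult[of p q] by auto
  then show "int (mdeg m) = k + n"
    using assms by (simp add: homogeneous_def mdeg_add)
qed

lemma homogeneous_cst_mult: "homogeneous k p \<Longrightarrow> homogeneous k (cst c * p)"
  using homogeneous_mult[OF homogeneous_cst] by simp

lemma homogeneous_prod:
  "(\<And>x. x \<in> A \<Longrightarrow> homogeneous (k x) (f x)) \<Longrightarrow> homogeneous (sum k A) (prod f A)"
  by (induction A rule: infinite_finite_induct) (auto intro: homogeneous_mult)

lemma homogeneous_power: "homogeneous k p \<Longrightarrow> homogeneous (int n * k) (p ^ n)"
  using homogeneous_prod[of "{..<n}" "\<lambda>_. k" "\<lambda>_. p"] by simp

lemma homogeneous_pdiff:
  assumes "homogeneous k p"
  shows "homogeneous (k - 1) (pdiff i p)"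
  unfolding pdiff_def
proof (rule homogeneous_sum)
  fix m assume "m \<in> Poly_Mapping.keys p"
  then have m: "int (mdeg m) = k" using assms by (simp add: homogeneous_def)
  show "homogeneous (k - 1) (Poly_Mapping.single (m - Poly_Mapping.single i 1)
     (of_nat (Poly_Mapping.lookup m i) * Poly_Mapping.lookup p m))"
  proof (cases "Poly_Mapping.lookup m i = 0")
    case False
    then have "m = (m - Poly_Mapping.single i 1) + Poly_Mapping.single i 1"
      by (intro poly_mapping_eqI) (auto simp: lookup_add lookup_minus lookup_single when_def)
    then have "mdeg m = mdeg (m - Poly_Mapping.single i 1) + 1"
      by (metis mdeg_add mdeg_single)
    with m show ?thesis by (intro homogeneous_single) simp
  qed simp
qed

lemma homogeneous_der:
  assumes "\<And>i. homogeneous k (\<theta> i)" "homogeneous n p"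
  shows "homogeneous (k + n - 1) (der \<theta> p)"
proof -
  have "homogeneous (k + (n - 1)) (der \<theta> p)"
    unfolding der_def by (intro homogeneous_sum homogeneous_mult homogeneous_pdiff assms)
  then show ?thesis by (simp add: algebra_simps)
qed

lemma homogeneous_lookup_0: "homogeneous k p \<Longrightarrow> k \<noteq> 0 \<Longrightarrow> Poly_Mapping.lookup p 0 = 0"
  by (force simp: homogeneous_def in_keys_iff)

lemma homogeneous_unique:
  assumes "homogeneous k p" "homogeneous n p" "p \<noteq> 0"
  shows "k = n"
  using assms by (metis homogeneous_def keys_eq_empty all_not_in_conv)

lemma euler:
  assumes "homogeneous (int k) p"
  shows "der var p = of_nat k * p"
proof -
  \<comment> \<open>The monomials are eigenvectors of \<open>var i * pdiff i\<close>, with the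
    exponent as eigenvalue; summing over i gives the degree.\<close>
  have *: "var i * pdiff i (Poly_Mapping.single m c)
      = of_nat (Poly_Mapping.lookup m i) * Poly_Mapping.single m c" for i m c
  proof (cases "Poly_Mapping.lookup m i = 0")
    case False
    then have "Poly_Mapping.single i 1 + (m - Poly_Mapping.single i 1) = m"
      by (intro poly_mapping_eqI) (auto simp: lookup_add lookup_minus lookup_single when_def)
    then show ?thesis
      by (simp add: var_def pdiff_single mult_single flip: single_of_nat)
  qed (simp add: pdiff_single)
  have "der var (Poly_Mapping.single m c) = of_nat (mdeg m) * Poly_Mapping.single m c" for m c
    by (simp add: der_def * mdeg_def sum_distrib_right)
  moreover have "der var (sum f A) = (\<Sum>x\<in>A. der var (f x))" for f :: "monomial \<Rightarrow> polyC3" and A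
    by (induction A rule: infinite_finite_induct) (simp_all add: der_add, simp_all add: der_def)
  ultimately have "der var p = (\<Sum>m\<in>Poly_Mapping.keys p.
      of_nat (mdeg m) * Poly_Mapping.single m (Poly_Mapping.lookup p m))"
    by (subst poly_sum_monomials[of p]) simp
  also have "\<dots> = (\<Sum>m\<in>Poly_Mapping.keys p.
      of_nat k * Poly_Mapping.single m (Poly_Mapping.lookup p m))"
    using assms by (intro sum.cong) (auto simp: homogeneous_def)
  also have "\<dots> = of_nat k * p"
    by (subst (3) poly_sum_monomials[of p]) (simp add: sum_distrib_left)
  finally show ?thesis .
qed

definition hcomp :: "int \<Rightarrow> polyC3 \<Rightarrow> polyC3" where
  "hcomp k p = (\<Sum>m \<in> {m \<in> Poly_Mapping.keys p. int (mdeg m) = k}.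
     Poly_Mapping.single m (Poly_Mapping.lookup p m))"

lemma lookup_hcomp:
  "Poly_Mapping.lookup (hcomp k p) m = (if int (mdeg m) = k then Poly_Mapping.lookup p m else 0)"
  by (auto simp: hcomp_def lookup_sum lookup_single when_def in_keys_iff)

lemma hcomp_add: "hcomp k (p + q) = hcomp k p + hcomp k q"
  by (rule poly_mapping_eqI) (simp add: lookup_hcomp lookup_add)

lemma homogeneous_hcomp: "homogeneous k (hcomp k p)"
  by (auto simp: homogeneous_def in_keys_iff lookup_hcomp split: if_splits)

lemma hcomp_homogeneous: "homogeneous k p \<Longrightarrow> hcomp k p = p"
  by (rule poly_mapping_eqI) (auto simp: homogeneous_def in_keys_iff lookup_hcomp)

lemma hcomp_mult_right:
  assumes "homogeneous n q"
  shows "hcomp (k + n) (p * q) = hcomp k p * q"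
proof (induction p rule: poly_induct_single)
  case (single m c)
  have h: "homogeneous (int (mdeg m) + n) (Poly_Mapping.single m c * q)"
    by (intro homogeneous_mult homogeneous_single assms refl)
  show ?case
  proof (cases "int (mdeg m) = k")
    case True
    then have "hcomp k (Poly_Mapping.single m c) = Poly_Mapping.single m c"
      by (intro hcomp_homogeneous homogeneous_single)
    then show ?thesis using h True by (simp add: hcomp_homogeneous)
  next
    case False
    then have "hcomp k (Poly_Mapping.single m c) = 0"
      by (intro poly_mapping_eqI) (auto simp: lookup_hcomp lookup_single when_def)
    moreover have "hcomp (k + n) (Poly_Mapping.single m c * q) = 0"
      using h False
      by (intro poly_mapping_eqI) (force simp: lookup_hcomp homogeneous_def in_keys_iff)
    ultimately show ?thesis by simp
  qed
qed (simp add: hcomp_add algebra_simps)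

text \<open>Any quotient may be replaced by its component of degree \<open>k - n\<close>, because
  multiplication by a homogeneous polynomial shifts components.\<close>

lemma homogeneous_dvdE:
  assumes "q dvd p" "homogeneous n q" "homogeneous k p"
  obtains s where "p = s * q" "homogeneous (k - n) s"
proof -
  from assms(1) obtain s where "p = s * q" by (metis dvd_def mult.commute)
  then have "hcomp (k - n + n) p = hcomp (k - n) s * q"
    using hcomp_mult_right[OF assms(2), of "k - n" s] by simp
  then have "p = hcomp (k - n) s * q" using assms(3) by (simp add: hcomp_homogeneous)
  then show thesis using that homogeneous_hcomp by blast
qed

lemma homogeneous_neg: "homogeneous k p \<Longrightarrow> k < 0 \<Longrightarrow> p = 0"
  by (force simp: homogeneous_def simp flip: keys_eq_empty)

lemma homogeneous_0_cst:
  assumes "homogeneous 0 p"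
  obtains c where "p = cst c"
proof -
  have "m = 0" if "m \<in> Poly_Mapping.keys p" for m
  proof -
    have "mdeg m = 0" using assms that by (simp add: homogeneous_def)
    then show ?thesis by (intro poly_mapping_eqI) (simp add: mdeg_def)
  qed
  then have "p = cst (Poly_Mapping.lookup p 0)"
    by (intro poly_mapping_eqI) (force simp: lookup_single when_def in_keys_iff)
  then show thesis using that by blast
qed

section \<open>Divisibility by linear forms\<close>

definition lf :: "(3 \<Rightarrow> complex) \<Rightarrow> polyC3" where
  "lf a = (\<Sum>i\<in>UNIV. cst (a i) * var i)"

lemma homogeneous_lf [simp]: "homogeneous 1 (lf a)"
  unfolding lf_def by (intro homogeneous_sum homogeneous_cst_mult homogeneous_var)

lemma der_lf: "der \<theta> (lf a) = (\<Sum>i\<in>UNIV. cst (a i) * \<theta> i)"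
  by (simp add: lf_def sum_UNIV_3 der_add der_cst_mult)

lemma subst_lf: "subst v (lf a) = (\<Sum>i\<in>UNIV. cst (a i) * v i)"
  by (simp add: lf_def subst_simps)

lemma pdiff_lf: "pdiff i (lf a) = cst (a i)"
proof -
  have "pdiff i (lf a) = (\<Sum>j\<in>UNIV. if i = j then cst (a j) else 0)"
    unfolding lf_def pdiff_sum by (rule sum.cong) (simp_all add: pdiff_mult pdiff_var)
  then show ?thesis by simp
qed

lemma lf_inject: "lf a = lf b \<longleftrightarrow> a = b"
proof
  assume "lf a = lf b"
  then have "cst (a i) = cst (b i)" for i using pdiff_lf by metis
  then show "a = b" by (auto dest: injD[OF inj_single])
qed simp

lemma lf_0 [simp]: "lf (\<lambda>_. 0) = 0"
  by (simp add: lf_def)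

lemma lf_eq_0_iff: "lf a = 0 \<longleftrightarrow> a = (\<lambda>_. 0)"
  using lf_inject[of a "\<lambda>_. 0"] by simp

lemma lf_scale: "lf (\<lambda>i. c * a i) = cst c * lf a"
  by (simp add: lf_def cst_mult sum_distrib_left mult.assoc)

text \<open>Substituting \<open>proj a n\<close> projects onto the plane \<open>lf a = 0\<close>
  along the vector \<open>n\<close>, provided that \<open>a\<close> takes the value 1 on
  \<open>n\<close>.\<close>

definition proj :: "(3 \<Rightarrow> complex) \<Rightarrow> (3 \<Rightarrow> complex) \<Rightarrow> 3 \<Rightarrow> polyC3" where
  "proj a n i = var i - cst (n i) * lf a"

lemma subst_proj_lf:
  assumes "(\<Sum>i\<in>UNIV. a i * n i) = 1"
  shows "subst (proj a n) (lf a) = 0"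
proof -
  have "subst (proj a n) (lf a) = lf a - cst (\<Sum>i\<in>UNIV. a i * n i) * lf a"
    unfolding subst_lf proj_def
    by (simp add: lf_def cst_sum cst_mult cst_add sum_UNIV_3 algebra_simps)
  then show ?thesis by (simp add: assms)
qed

text \<open>The projection is congruent to the identity modulo \<open>lf a\<close> and kills
  \<open>lf a\<close>, so divisibility by a linear form becomes vanishing under a ring
  homomorphism.\<close>

lemma lf_dvd_iff:
  assumes "(\<Sum>i\<in>UNIV. a i * n i) = 1"
  shows "lf a dvd p \<longleftrightarrow> subst (proj a n) p = 0"
proof
  assume "lf a dvd p"
  then show "subst (proj a n) p = 0"
    by (auto simp: dvd_def subst_simps subst_proj_lf[OF assms])
next
  assume "subst (proj a n) p = 0"
  moreover have "lf a dvd subst var p - subst (proj a n) p"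
    by (rule dvd_subst_diff) (simp add: proj_def)
  ultimately show "lf a dvd p" by (simp add: subst_var_id)
qed

lemma ex_dual:
  fixes a :: "3 \<Rightarrow> complex"
  assumes "a \<noteq> (\<lambda>_. 0)"
  obtains n where "(\<Sum>i\<in>UNIV. a i * n i) = 1"
proof -
  obtain k where k: "a k \<noteq> 0" using assms by auto
  have "(\<Sum>i\<in>UNIV. a i * (if i = k then 1 / a k else 0)) = (\<Sum>i\<in>UNIV. if i = k then 1 else 0)"
    using k by (intro sum.cong) auto
  then show thesis using that by simp
qed

lemma homogeneous_subst:
  assumes "homogeneous k p" "\<And>i. homogeneous 1 (v i)"
  shows "homogeneous k (subst v p)"
proof -
  have "homogeneous k (cst (Poly_Mapping.lookup p m) * mon v m)" if "m \<in> Poly_Mapping.keys p" for m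
  proof -
    have "homogeneous (\<Sum>i\<in>UNIV. int (Poly_Mapping.lookup m i) * 1) (mon v m)"
      unfolding mon_def by (intro homogeneous_prod homogeneous_power assms)
    then show ?thesis
      using that assms(1) by (intro homogeneous_cst_mult) (simp add: homogeneous_def mdeg_def)
  qed
  then show ?thesis
    unfolding subst_def ins_def by (rule homogeneous_sum)
qed

lemma homogeneous_not_unit: "homogeneous 1 p \<Longrightarrow> \<not> p dvd 1"
proof
  assume p: "homogeneous 1 p" "p dvd 1"
  then obtain s where "1 = s * p" "homogeneous (0 - 1) s"
    by (rule_tac homogeneous_dvdE[OF p(2) p(1) homogeneous_1])
  then show False using homogeneous_neg by force
qed

text \<open>The multiples of \<open>lf a\<close> are the kernel of a ring homomorphism into a
  domain.\<close>

lemma prime_elem_lf: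
  assumes "a \<noteq> (\<lambda>_. 0)"
  shows "prime_elem (lf a)"
proof -
  obtain n where n: "(\<Sum>i\<in>UNIV. a i * n i) = 1" using assms by (rule ex_dual)
  show ?thesis
    using assms homogeneous_not_unit[OF homogeneous_lf, of a]
    by (auto simp: prime_elem_def lf_eq_0_iff lf_dvd_iff[OF n] subst_simps)
qed

lemma lf_dvd_lfD:
  assumes "lf a dvd lf b"
  obtains c where "b = (\<lambda>i. c * a i)"
proof -
  obtain s where s: "lf b = s * lf a" "homogeneous (1 - 1) s"
    using homogeneous_dvdE[OF assms homogeneous_lf homogeneous_lf] by blast
  then obtain c where "s = cst c" using homogeneous_0_cst by auto
  then show thesis using s that by (simp add: lf_inject flip: lf_scale)
qed

lemma dvd_cst_mult_iff:
  assumes "c \<noteq> 0"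
  shows "p dvd cst c * q \<longleftrightarrow> p dvd q"
proof
  assume "p dvd cst c * q"
  then have "p dvd cst (1 / c) * (cst c * q)" by (rule dvd_mult)
  also have "cst (1 / c) * (cst c * q) = q" using assms by (simp flip: mult.assoc cst_mult)
  finally show "p dvd q" .
qed simp

lemma prime_elem_dvd_prodE:
  assumes "prime_elem (q :: 'a::idom)" "q dvd prod f A" "finite A"
  obtains x where "x \<in> A" "q dvd f x"
proof -
  have "\<exists>x\<in>A. q dvd f x" using assms(3,2)
    by (induction A rule: finite_induct)
      (use assms(1) in \<open>auto simp: prime_elem_def\<close>)
  then show thesis using that by blast
qed

lemma prime_elem_power_dvd_cancel:
  fixes q :: "'a::idom"
  assumes "prime_elem q" "\<not> q dvd y" "q ^ e dvd y * z"
  shows "q ^ e dvd z"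
  using assms(3)
proof (induction e arbitrary: z)
  case (Suc e)
  then have "q dvd y * z" by (meson dvd_power dvd_trans zero_less_Suc dvd_mult_left power_Suc)
  then obtain u where u: "z = q * u"
    using assms prime_elem_dvd_mult_iff by (metis dvd_def)
  have "q * q ^ e dvd q * (y * u)" using Suc.prems u by (simp add: ac_simps)
  then have "q ^ e dvd y * u" using prime_elem_not_zeroI[OF assms(1)] dvd_mult_cancel_left by blast
  then have "q ^ e dvd u" by (rule Suc.IH)
  then show ?case unfolding u by (simp add: mult_dvd_mono)
qed simp

text \<open>Primes that do not divide each other are split off one after another, in any integral
  domain; the powers serve Terao's polynomial.\<close>

lemma prod_prime_powers_dvd:
  fixes p :: "'i \<Rightarrow> 'a::idom"
  assumes "finite I" "\<And>i. i \<in> I \<Longrightarrow> prime_elem (p i)"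
    and "\<And>i j. i \<in> I \<Longrightarrow> j \<in> I \<Longrightarrow> i \<noteq> j \<Longrightarrow> \<not> p i dvd p j"
    and "\<And>i. i \<in> I \<Longrightarrow> p i ^ e i dvd x"
  shows "(\<Prod>i\<in>I. p i ^ e i) dvd x"
  using assms
proof (induction I rule: finite_induct)
  case (insert i I)
  then obtain y where y: "x = (\<Prod>i\<in>I. p i ^ e i) * y" by (auto elim!: dvdE)
  have "\<not> p i dvd (\<Prod>i\<in>I. p i ^ e i)"
  proof
    assume "p i dvd (\<Prod>i\<in>I. p i ^ e i)"
    then obtain j where "j \<in> I" "p i dvd p j ^ e j"
      using insert.hyps(1) insert.prems(1)[of i] by (blast elim: prime_elem_dvd_prodE)
    then show False
      using insert.hyps(2) insert.prems(1)[of i] insert.prems(2)[of i j] prime_elem_dvd_power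
      by (metis insertCI)
  qed
  then have "p i ^ e i dvd y"
    using insert.prems y by (metis insertI1 prime_elem_power_dvd_cancel)
  then show ?case
    using insert.hyps y by (simp add: mult.commute mult_dvd_mono)
qed simp

lemma prod_primes_dvd:
  fixes p :: "'i \<Rightarrow> 'a::idom"
  assumes "finite I" "\<And>i. i \<in> I \<Longrightarrow> prime_elem (p i)"
    and "\<And>i j. i \<in> I \<Longrightarrow> j \<in> I \<Longrightarrow> i \<noteq> j \<Longrightarrow> \<not> p i dvd p j"
    and "\<And>i. i \<in> I \<Longrightarrow> p i dvd x"
  shows "(\<Prod>i\<in>I. p i) dvd x"
  using prod_prime_powers_dvd[of I p "\<lambda>_. 1" x] assms by simp

lemma squarefree_prod_primes:
  fixes p :: "'i \<Rightarrow> 'a::idom"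
  assumes "finite I" "\<And>i. i \<in> I \<Longrightarrow> prime_elem (p i)"
    and "\<And>i j. i \<in> I \<Longrightarrow> j \<in> I \<Longrightarrow> i \<noteq> j \<Longrightarrow> \<not> p i dvd p j"
  shows "squarefree (\<Prod>i\<in>I. p i)"
  using assms
proof (induction I rule: finite_induct)
  case (insert i I)
  have prime: "prime_elem (p i)" using insert.prems by blast
  have sf: "squarefree (\<Prod>i\<in>I. p i)" using insert by blast
  have ndvd: "\<not> p i dvd (\<Prod>i\<in>I. p i)"
    using insert.hyps insert.prems(2) by (metis insertCI prime prime_elem_dvd_prodE)
  show ?case
  proof (rule squarefreeI)
    fix y assume "y ^ 2 dvd prod p (insert i I)"
    then have y: "y ^ 2 dvd p i * (\<Prod>i\<in>I. p i)" using insert.hyps by simp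
    have "\<not> p i dvd y"
    proof
      assume "p i dvd y"
      then have "p i * p i dvd p i * (\<Prod>i\<in>I. p i)"
        using y by (metis dvd_trans mult_dvd_mono power2_eq_square)
      then show False using ndvd prime_elem_not_zeroI[OF prime] dvd_mult_cancel_left by blast
    qed
    obtain z where z: "p i * (\<Prod>i\<in>I. p i) = y ^ 2 * z" using y by (elim dvdE)
    then have "p i dvd z"
      using \<open>\<not> p i dvd y\<close> prime
      by (metis dvd_triv_left prime_elem_dvd_mult_iff prime_elem_dvd_power)
    then obtain u where "z = p i * u" by (elim dvdE)
    then have "p i * (\<Prod>i\<in>I. p i) = p i * (y ^ 2 * u)" using z by (simp add: ac_simps)
    then have "(\<Prod>i\<in>I. p i) = y ^ 2 * u" using prime_elem_not_zeroI[OF prime] by simp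
    then show "y dvd 1" using sf by (auto dest!: squarefreeD)
  qed
qed (auto intro!: squarefreeI simp: power2_eq_square dest: dvd_mult_left)

section \<open>Determinants of vector fields\<close>

definition det3 :: "(3 \<Rightarrow> 'a) \<Rightarrow> (3 \<Rightarrow> 'a) \<Rightarrow> (3 \<Rightarrow> 'a) \<Rightarrow> 'a::comm_ring_1" where
  "det3 u v w = u 0 * (v 1 * w 2 - v 2 * w 1) - u 1 * (v 0 * w 2 - v 2 * w 0)
     + u 2 * (v 0 * w 1 - v 1 * w 0)"

lemma homogeneous_det3:
  assumes "\<And>i. homogeneous a (u i)" "\<And>i. homogeneous b (v i)" "\<And>i. homogeneous c (w i)"
  shows "homogeneous (a + b + c) (det3 u v w)"
proof -
  have "homogeneous (a + (b + c)) (det3 u v w)"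
    unfolding det3_def by (intro homogeneous_add homogeneous_diff homogeneous_mult assms)
  then show ?thesis by (simp add: add.assoc)
qed

text \<open>The determinant times a coordinate of the covector expands, by Cramer's rule, into a
  combination of the three pairings, which vanish.\<close>

lemma det3_annihilated:
  fixes a :: "3 \<Rightarrow> 'a::comm_ring_1"
  assumes "a 0 * u 0 + a 1 * u 1 + a 2 * u 2 = 0" "a 0 * v 0 + a 1 * v 1 + a 2 * v 2 = 0"
    "a 0 * w 0 + a 1 * w 1 + a 2 * w 2 = 0"
  shows "a k * det3 u v w = 0"
proof -
  let ?s = "\<lambda>x. a 0 * x 0 + a 1 * x 1 + a 2 * x 2"
  have "a 0 * det3 u v w = ?s u * (v 1 * w 2 - v 2 * w 1) - ?s v * (u 1 * w 2 - u 2 * w 1)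
      + ?s w * (u 1 * v 2 - u 2 * v 1)"
    by (simp add: det3_def algebra_simps)
  moreover have "a 1 * det3 u v w = ?s v * (u 0 * w 2 - u 2 * w 0) - ?s u * (v 0 * w 2 - v 2 * w 0)
      - ?s w * (u 0 * v 2 - u 2 * v 0)"
    by (simp add: det3_def algebra_simps)
  moreover have "a 2 * det3 u v w = ?s u * (v 0 * w 1 - v 1 * w 0) - ?s v * (u 0 * w 1 - u 1 * w 0)
      + ?s w * (u 0 * v 1 - u 1 * v 0)"
    by (simp add: det3_def algebra_simps)
  ultimately have "a 0 * det3 u v w = 0" "a 1 * det3 u v w = 0" "a 2 * det3 u v w = 0"
    using assms by simp_all
  then have "\<forall>k. a k * det3 u v w = 0" unfolding all_3 by blast
  then show ?thesis by blast
qed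

lemma cramer3: "det3 u v w * x i
    = det3 x v w * u i + det3 u x w * v i + det3 u v x * w (i :: 3)"
proof -
  have "\<forall>i. det3 u v w * x i = det3 x v w * u i + det3 u x w * v i + det3 u v x * w i"
    unfolding all_3 det3_def by (simp add: algebra_simps)
  then show ?thesis by blast
qed

lemma det3_independent:
  assumes "det3 u v w \<noteq> (0 :: 'a::idom)" "\<And>i. a * u i + b * v i + c * w i = 0"
  shows "a = 0 \<and> b = 0 \<and> c = 0"
proof -
  let ?x = "\<lambda>i. a * u i + b * v i + c * w i"
  have "a * det3 u v w = det3 ?x v w" "b * det3 u v w = det3 u ?x w" "c * det3 u v w = det3 u v ?x"
    by (simp_all add: det3_def algebra_simps)
  moreover have "?x = (\<lambda>_. 0)" using assms(2) by auto
  ultimately have "a * det3 u v w = 0" "b * det3 u v w = 0" "c * det3 u v w = 0"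
    by (simp_all only: det3_def mult_zero_left mult_zero_right diff_0_right add_0)
  then show ?thesis using assms(1) by simp
qed

text \<open>On the plane \<open>lf a = 0\<close> all three fields take values in the kernel of
  \<open>a\<close>, hence are linearly dependent there.\<close>

lemma lf_dvd_det3:
  assumes "a \<noteq> (\<lambda>_. 0)"
    and "lf a dvd der u (lf a)" "lf a dvd der v (lf a)" "lf a dvd der w (lf a)"
  shows "lf a dvd det3 u v w"
proof -
  obtain n where n: "(\<Sum>i\<in>UNIV. a i * n i) = 1" using assms(1) by (rule ex_dual)
  obtain k where k: "a k \<noteq> 0" using assms(1) by auto
  define s where "s = subst (proj a n)"
  have s0: "cst (a 0) * s (x 0) + cst (a 1) * s (x 1) + cst (a 2) * s (x 2) = 0"
    if "lf a dvd der x (lf a)" for x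
    using that lf_dvd_iff[OF n] by (simp add: s_def der_lf sum_UNIV_3 subst_simps)
  have "cst (a k) * det3 (\<lambda>i. s (u i)) (\<lambda>i. s (v i)) (\<lambda>i. s (w i)) = 0"
    by (rule det3_annihilated) (use s0 assms in auto)
  then have "s (det3 u v w) = 0" using k by (simp add: det3_def s_def subst_simps)
  then show ?thesis using lf_dvd_iff[OF n] by (simp add: s_def)
qed

lemma der_var_lf: "der var (lf a) = lf a"
  unfolding der_lf by (simp add: lf_def)

lemma der_prod_dvd:
  assumes "finite I" "\<And>i. i \<in> I \<Longrightarrow> p i dvd der \<theta> (p i)"
  shows "(\<Prod>i\<in>I. p i) dvd der \<theta> (\<Prod>i\<in>I. p i)"
  using assms
proof (induction I rule: finite_induct)
  case (insert i I)
  then show ?case by (simp add: der_mult dvd_add mult_dvd_mono)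
qed simp

lemma der_lincomb:
  "der (\<lambda>i. a * u i + b * v i) p = a * der u p + b * der v p"
  by (simp add: der_def sum_UNIV_3 algebra_simps)

section \<open>Logarithmic vector fields: Saito's criterion and deletion of a line\<close>

section \<open>Deletion of a line from a free arrangement\<close>

text \<open>The data of a minimal free resolution of the Milnor algebra with three syzygies: the rows of
  \<open>\<rho>\<close> generate the syzygies of the gradient and their own relations are the multiples of \<open>g\<close>.\<close>

definition three_syzygies :: "polyC3 \<Rightarrow> (3 \<Rightarrow> nat) \<Rightarrow> bool" where
  "three_syzygies f ds \<longleftrightarrow> (\<exists>\<rho> g e.
     (\<forall>k i. homogeneous (int (ds k)) (\<rho> k i)) \<and>
     (\<forall>k. homogeneous (e - int (ds k)) (g k) \<and> int (ds k) < e) \<and> (\<exists>k. g k \<noteq> 0) \<and>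
     (\<forall>k. der (\<rho> k) f = 0) \<and>
     (\<forall>\<theta>. der \<theta> f = 0 \<longrightarrow> (\<exists>h. \<forall>i. \<theta> i = (\<Sum>k\<in>UNIV. h k * \<rho> k i))) \<and>
     (\<forall>i. (\<Sum>k\<in>UNIV. g k * \<rho> k i) = 0) \<and>
     (\<forall>h. (\<forall>i. (\<Sum>k\<in>UNIV. h k * \<rho> k i) = 0) \<longrightarrow> (\<exists>s. \<forall>k. h k = s * g k)))"

definition vec3 :: "'a \<Rightarrow> 'a \<Rightarrow> 'a \<Rightarrow> 3 \<Rightarrow> 'a" where
  "vec3 a b c i = (if i = 0 then a else if i = 1 then b else c)"

lemma vec3_simps [simp]: "vec3 a b c 0 = a" "vec3 a b c 1 = b" "vec3 a b c 2 = c"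
  by (simp_all add: vec3_def)

lemma vec3_eta: "vec3 (v 0) (v 1) (v 2) = v"
  by (simp add: fun_eq_3)

lemma vec3_eq_iff: "vec3 a b c = vec3 a' b' c' \<longleftrightarrow> a = a' \<and> b = b' \<and> c = c'"
  by (simp add: fun_eq_3)

abbreviation "X0 \<equiv> var 0"
abbreviation "X1 \<equiv> var 1"
abbreviation "X2 \<equiv> var 2"

lemma lf_vec3: "lf (vec3 a b c) = cst a * X0 + cst b * X1 + cst c * X2"
  by (simp add: lf_def sum_UNIV_3)

lemma var_eq_lf: "X0 = lf (vec3 1 0 0)" "X1 = lf (vec3 0 1 0)" "X2 = lf (vec3 0 0 1)"
  by (simp_all add: lf_vec3)

lemma der_lf_vec3: "der \<theta> (lf (vec3 a b c)) = cst a * \<theta> 0 + cst b * \<theta> 1 + cst c * \<theta> 2"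
  by (simp add: der_lf sum_UNIV_3)

lemma vec3_nonzero: "vec3 a b c = (\<lambda>_. 0) \<longleftrightarrow> a = 0 \<and> b = 0 \<and> c = 0"
  by (simp add: fun_eq_3)

text \<open>Restriction to the line x = 0, kept inside the same ring: its fixed points are the
  polynomials in y and z.\<close>

definition res0 :: "polyC3 \<Rightarrow> polyC3" where
  "res0 = subst (vec3 0 X1 X2)"

lemma res0_simps [simp]: "res0 X0 = 0" "res0 X1 = X1" "res0 X2 = X2"
  by (simp_all add: res0_def subst_simps)

lemma res0_hom: "res0 0 = 0" "res0 1 = 1" "res0 (cst c) = cst c" "res0 (p + q) = res0 p + res0 q"
  "res0 (p - q) = res0 p - res0 q" "res0 (- p) = - res0 p" "res0 (p * q) = res0 p * res0 q"
  "res0 (p ^ n) = res0 p ^ n" "res0 (prod f A) = (\<Prod>x\<in>A. res0 (f x))"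
  by (simp_all add: res0_def subst_simps)

lemma X0_dvd_iff: "X0 dvd p \<longleftrightarrow> res0 p = 0"
proof -
  have "proj (vec3 1 0 0) (vec3 1 0 0) = vec3 0 X1 X2"
    by (simp add: fun_eq_3 proj_def lf_vec3)
  then show ?thesis
    using lf_dvd_iff[of "vec3 1 0 0" "vec3 1 0 0"]
    by (simp add: res0_def sum_UNIV_3 flip: var_eq_lf)
qed

lemma res0_idem [simp]: "res0 (res0 p) = res0 p"
proof -
  have "(\<lambda>i. subst (vec3 0 X1 X2) (vec3 0 X1 X2 i)) = vec3 0 X1 X2"
    by (simp add: fun_eq_3 subst_simps)
  then show ?thesis by (simp add: res0_def subst_subst)
qed

lemma homogeneous_res0: "homogeneous k p \<Longrightarrow> homogeneous k (res0 p)"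
  unfolding res0_def by (rule homogeneous_subst) (auto simp: vec3_def)

lemma var_neq_0 [simp]: "var i \<noteq> 0"
  by (metis pdiff_var pdiff_0 zero_neq_one)

text \<open>Coprimality of y and z turns the vanishing of the wedge with the Euler field into an
  actual multiple \<open>k\<close> of that field; the rest vanishes on x = 0 and can be divided by
  x.\<close>

lemma restriction_proportional:
  assumes "X0 dvd v 0" "res0 (X1 * v 2 - X2 * v 1) = 0" "\<And>i. homogeneous d (v i)"
  obtains k \<psi> where "\<And>i. v i = k * var i + X0 * \<psi> i" "homogeneous (d - 1) k"
    "\<And>i. homogeneous (d - 1) (\<psi> i)"
proof -
  have eq: "X1 * res0 (v 2) = X2 * res0 (v 1)"
    using assms(2) by (simp add: res0_hom)
  have "prime_elem X1" unfolding var_eq_lf by (rule prime_elem_lf) (simp add: vec3_nonzero)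
  moreover have "\<not> X1 dvd X2"
  proof
    assume "X1 dvd X2"
    then have "lf (vec3 0 1 0) dvd lf (vec3 0 0 1)" by (simp only: var_eq_lf)
    then obtain c where "vec3 0 0 1 = (\<lambda>i. c * vec3 0 1 0 i :: complex)" by (rule lf_dvd_lfD)
    then have "vec3 0 0 1 2 = c * vec3 0 1 0 2" by metis
    then show False by simp
  qed
  ultimately have "X1 dvd res0 (v 1)"
    by (metis eq dvd_triv_left prime_elem_dvd_mult_iff)
  then obtain k where k: "res0 (v 1) = k * X1" "homogeneous (d - 1) k"
    using homogeneous_dvdE[OF _ homogeneous_var homogeneous_res0[OF assms(3)]] by blast
  have k2: "res0 (v 2) = k * X2" 
  proof -
    have "X1 * res0 (v 2) = X1 * (k * X2)" using eq k by (simp add: ac_simps)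
    then show ?thesis by simp
  qed
  \<comment> \<open>The quotient is free of x, so subtracting \<open>k\<close> times the Euler field
    makes every component vanish on x = 0.\<close>
  have "res0 k * X1 = k * X1" using k(1) res0_idem[of "v 1"] by (simp add: res0_hom)
  then have rk: "res0 k = k" by simp
  have "\<forall>i. X0 dvd v i - k * var i"
    unfolding all_3 using assms(1) k k2 rk by (simp add: X0_dvd_iff res0_hom)
  moreover have hom: "homogeneous d (v i - k * var i)" for i
    using homogeneous_mult[OF k(2) homogeneous_var[of i]] assms(3) by (simp add: homogeneous_diff)
  ultimately have "\<exists>\<psi>. v i - k * var i = \<psi> * X0 \<and> homogeneous (d - 1) \<psi>" for i
    using homogeneous_dvdE[OF _ homogeneous_var hom] by metis
  then obtain \<psi> where "\<And>i. v i - k * var i = \<psi> i * X0" "\<And>i. homogeneous (d - 1) (\<psi> i)"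
    by metis
  then show thesis using k(2) by (intro that[of k \<psi>]) (auto simp: algebra_simps)
qed

text \<open>The line to be deleted is \<open>x = 0\<close>. The other lines are \<open>e x + b\<^sub>p y + c\<^sub>p z = 0\<close> with \<open>e \<in> E p\<close>;
  the lines with the same \<open>p\<close> are those through the same point of the deleted line.\<close>

locale line_family =
  fixes P :: "'p set" and b c :: "'p \<Rightarrow> complex" and E :: "'p \<Rightarrow> complex set"
  assumes fin_P: "finite P" and fin_E: "\<And>p. p \<in> P \<Longrightarrow> finite (E p)"
    and E_ne: "\<And>p. p \<in> P \<Longrightarrow> E p \<noteq> {}"
    and bc: "\<And>p. p \<in> P \<Longrightarrow> b p \<noteq> 0 \<or> c p \<noteq> 0"
    and points: "\<And>p q. p \<in> P \<Longrightarrow> q \<in> P \<Longrightarrow> p \<noteq> q \<Longrightarrow> b p * c q \<noteq> b q * c p"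
begin

definition m :: nat where "m = card P"
definition L :: "('p \<times> complex) set" where "L = Sigma P E"
definition n :: nat where "n = card L"
definition form :: "'p \<times> complex \<Rightarrow> polyC3" where
  "form = (\<lambda>(p, e). lf (vec3 e (b p) (c p)))"
definition \<beta> :: "'p \<Rightarrow> polyC3" where "\<beta> p = lf (vec3 0 (b p) (c p))"
definition f :: polyC3 where "f = (\<Prod>l\<in>L. form l)"
text \<open>These are the logarithmic derivations of the arrangement left after the deletion;
  tangency to x = 0 is the separate condition \<open>X0 dvd \<theta> 0\<close>.\<close>

definition tangent :: "(3 \<Rightarrow> polyC3) \<Rightarrow> bool" where
  "tangent \<theta> \<longleftrightarrow> (\<forall>l\<in>L. form l dvd der \<theta> (form l))"

lemma fin_L: "finite L"
  unfolding L_def using fin_P fin_E by blast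

lemma form_prime: "l \<in> L \<Longrightarrow> prime_elem (form l)"
  using bc by (auto simp: form_def L_def vec3_nonzero intro!: prime_elem_lf)

lemma \<beta>_prime: "p \<in> P \<Longrightarrow> prime_elem (\<beta> p)"
  using bc by (auto simp: \<beta>_def vec3_nonzero intro!: prime_elem_lf)

lemma X0_prime: "prime_elem X0"
  unfolding var_eq_lf by (rule prime_elem_lf) (simp add: vec3_nonzero)

lemma \<beta>_ndvd: "p \<in> P \<Longrightarrow> q \<in> P \<Longrightarrow> p \<noteq> q \<Longrightarrow> \<not> \<beta> p dvd \<beta> q"
proof
  assume *: "p \<in> P" "q \<in> P" "p \<noteq> q" "\<beta> p dvd \<beta> q"
  then obtain k where "vec3 0 (b q) (c q) = (\<lambda>i. k * vec3 0 (b p) (c p) i)"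
    unfolding \<beta>_def by (metis lf_dvd_lfD)
  then have "b q = k * b p" "c q = k * c p" by (metis vec3_simps)+
  then show False using points[OF *(1-3)] by simp
qed

lemma form_ndvd: "l \<in> L \<Longrightarrow> l' \<in> L \<Longrightarrow> l \<noteq> l' \<Longrightarrow> \<not> form l dvd form l'"
proof
  assume *: "l \<in> L" "l' \<in> L" "l \<noteq> l'" "form l dvd form l'"
  obtain p e q e' where l: "l = (p, e)" "l' = (q, e')" by fastforce
  then have P: "p \<in> P" "q \<in> P" using * by (auto simp: L_def)
  obtain k where "vec3 e' (b q) (c q) = (\<lambda>i. k * vec3 e (b p) (c p) i)"
    using *(4) unfolding l form_def by (auto elim: lf_dvd_lfD)
  then have k: "e' = k * e" "b q = k * b p" "c q = k * c p" by (metis vec3_simps)+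
  then have "p = q" using points[of p q] P by auto
  then have "k = 1" using k bc P by auto
  then show False using *(3) l k \<open>p = q\<close> by simp
qed

lemma form_ndvd_X0: "l \<in> L \<Longrightarrow> \<not> form l dvd X0"
proof
  assume *: "l \<in> L" "form l dvd X0"
  obtain p e where l: "l = (p, e)" by fastforce
  then have P: "p \<in> P" using * by (auto simp: L_def)
  obtain k where "vec3 1 0 0 = (\<lambda>i. k * vec3 e (b p) (c p) i)"
    using *(2) unfolding l form_def var_eq_lf by (auto elim: lf_dvd_lfD)
  then have k: "1 = k * e" "0 = k * b p" "0 = k * c p" by (metis vec3_simps)+
  then show False using bc[OF P] by auto
qed

lemma X0_ndvd_form: "l \<in> L \<Longrightarrow> \<not> X0 dvd form l"
proof
  assume *: "l \<in> L" "X0 dvd form l"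
  obtain p e where l: "l = (p, e)" by fastforce
  then have P: "p \<in> P" using * by (auto simp: L_def)
  obtain k where "vec3 e (b p) (c p) = (\<lambda>i. k * vec3 1 0 0 i)"
    using *(2) unfolding l form_def var_eq_lf by (auto elim: lf_dvd_lfD)
  then have k: "b p = k * 0" "c p = k * 0" by (metis vec3_simps)+
  then show False using bc[OF P] by auto
qed

lemma X0_ndvd_f: "\<not> X0 dvd f"
  unfolding f_def using X0_prime fin_L X0_ndvd_form by (metis prime_elem_dvd_prodE)

lemma f_neq_0: "f \<noteq> 0"
  using X0_ndvd_f by auto

lemma f_dvdI: "(\<And>l. l \<in> L \<Longrightarrow> form l dvd p) \<Longrightarrow> f dvd p"
  unfolding f_def by (intro prod_primes_dvd fin_L form_prime form_ndvd)

lemma X0_f_dvdI: "X0 dvd p \<Longrightarrow> f dvd p \<Longrightarrow> X0 * f dvd p"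
proof -
  assume "X0 dvd p" "f dvd p"
  then obtain s where "p = f * s" "X0 dvd f * s" by (auto elim: dvdE)
  then have "X0 dvd s" using X0_prime X0_ndvd_f prime_elem_dvd_mult_iff by blast
  then show ?thesis using \<open>p = f * s\<close> by (simp add: mult.commute mult_dvd_mono)
qed

lemma form_nonzero: "l \<in> L \<Longrightarrow> \<exists>a. form l = lf a \<and> a \<noteq> (\<lambda>_. 0)"
proof -
  assume "l \<in> L"
  then obtain p e where "l = (p, e)" "p \<in> P" by (auto simp: L_def)
  then show ?thesis using bc[of p]
    by (intro exI[of _ "vec3 e (b p) (c p)"]) (simp add: form_def vec3_nonzero)
qed

lemma f_dvd_det3: "tangent u \<Longrightarrow> tangent v \<Longrightarrow> tangent w \<Longrightarrow> f dvd det3 u v w"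
  by (rule f_dvdI) (metis form_nonzero lf_dvd_det3 tangent_def)

lemma tangent_var: "tangent var"
  using form_nonzero by (auto simp: tangent_def) (metis der_var_lf dvd_refl)

lemma tangent_lincomb:
  "tangent u \<Longrightarrow> tangent v \<Longrightarrow> tangent (\<lambda>i. s * u i + t * v i)"
  by (auto simp: tangent_def der_lincomb)

lemma res0_form: "res0 (form (p, e)) = \<beta> p"
  by (simp add: form_def \<beta>_def lf_vec3 res0_hom)

lemma res0_\<beta> [simp]: "res0 (\<beta> p) = \<beta> p"
  by (simp add: \<beta>_def lf_vec3 res0_hom)

text \<open>The equation, on x = 0, of the points in which the other lines meet it.\<close>

definition q :: polyC3 where "q = (\<Prod>p\<in>P. \<beta> p)"

lemma res0_q [simp]: "res0 q = q"
  by (simp add: q_def res0_hom)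

lemma q_neq_0: "q \<noteq> 0"
  using fin_P \<beta>_prime by (auto simp: q_def dest: prime_elem_not_zeroI)

lemma homogeneous_q: "homogeneous (int m) q"
  using homogeneous_prod[of P "\<lambda>_. 1" \<beta>] by (simp add: q_def \<beta>_def m_def)

lemma homogeneous_f: "homogeneous (int n) f"
  using homogeneous_prod[of L "\<lambda>_. 1" form] by (auto simp: f_def form_def n_def)

text \<open>Where x = 0 meets another line, a field tangent to both is parallel to the position
  vector, so its wedge with the Euler field vanishes there.\<close>

lemma q_dvd_restriction:
  assumes "tangent \<theta>" "X0 dvd \<theta> 0"
  shows "q dvd res0 (X1 * \<theta> 2 - X2 * \<theta> 1)"
  unfolding q_def
proof (intro prod_primes_dvd fin_P \<beta>_prime \<beta>_ndvd)
  fix p assume p: "p \<in> P"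
  then obtain e where e: "e \<in> E p" using E_ne by blast
  let ?B = "res0 (\<theta> 1)" and ?C = "res0 (\<theta> 2)"
  have "form (p, e) dvd der \<theta> (form (p, e))"
    using assms(1) p e by (auto simp: tangent_def L_def)
  then obtain s where "der \<theta> (form (p, e)) = form (p, e) * s" by (elim dvdE)
  then have "cst e * \<theta> 0 + cst (b p) * \<theta> 1 + cst (c p) * \<theta> 2 = form (p, e) * s"
    by (simp add: form_def der_lf_vec3)
  then have "res0 (cst e * \<theta> 0 + cst (b p) * \<theta> 1 + cst (c p) * \<theta> 2) = res0 (form (p, e) * s)"
    by simp
  then have 1: "cst (b p) * ?B + cst (c p) * ?C = \<beta> p * res0 s"
    using assms(2) by (simp add: res0_hom res0_form X0_dvd_iff)
  let ?D = "X1 * ?C - X2 * ?B"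
  \<comment> \<open>Multiplied by either coefficient of the form, the wedge becomes a combination of
    the form and of its derivative; one of the two coefficients is nonzero.\<close>
  have "cst (b p) * ?D = \<beta> p * ?C - X2 * (cst (b p) * ?B + cst (c p) * ?C)"
    "cst (c p) * ?D = X1 * (cst (b p) * ?B + cst (c p) * ?C) - \<beta> p * ?B"
    by (simp_all add: \<beta>_def lf_vec3 algebra_simps)
  then have "\<beta> p dvd cst (b p) * ?D" "\<beta> p dvd cst (c p) * ?D"
    by (simp_all add: 1)
  then have "\<beta> p dvd ?D" using bc[OF p] dvd_cst_mult_iff by blast
  then show "\<beta> p dvd res0 (X1 * \<theta> 2 - X2 * \<theta> 1)" by (simp add: res0_hom)
qed

lemma restriction_quotient:
  assumes "tangent \<theta>" "X0 dvd \<theta> 0" "\<And>i. homogeneous (int d) (\<theta> i)"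
  obtains p where "res0 (X1 * \<theta> 2 - X2 * \<theta> 1) = p * q" "res0 p = p"
    "homogeneous (int d + 1 - int m) p"
proof -
  have "homogeneous (1 + int d) (X1 * \<theta> 2 - X2 * \<theta> 1)"
    by (intro homogeneous_diff homogeneous_mult homogeneous_var assms)
  from homogeneous_dvdE[OF q_dvd_restriction[OF assms(1,2)] homogeneous_q homogeneous_res0[OF this]]
  obtain p where p: "res0 (X1 * \<theta> 2 - X2 * \<theta> 1) = p * q" "homogeneous (1 + int d - int m) p"
    by blast
  then have "res0 p * q = p * q" by (metis res0_q res0_hom(7) res0_idem)
  then have "res0 p = p" using q_neq_0 by simp
  moreover have "homogeneous (int d + 1 - int m) p" using p(2) by (simp add: algebra_simps)
  ultimately show thesis using p(1) that by blast
qed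

text \<open>Terao's polynomial: the product of the restrictions of all lines but one through each point.\<close>

definition bb :: polyC3 where "bb = (\<Prod>p\<in>P. \<beta> p ^ (card (E p) - 1))"

lemma card_L: "n = (\<Sum>p\<in>P. card (E p))"
  using fin_P fin_E by (simp add: n_def L_def)

lemma m_le_n: "m \<le> n"
proof -
  have "1 \<le> card (E p)" if "p \<in> P" for p
    using that E_ne fin_E by (simp add: Suc_leI card_gt_0_iff)
  then show ?thesis unfolding card_L m_def using sum_mono[of P "\<lambda>_. 1" "\<lambda>p. card (E p)"] by simp
qed

lemma homogeneous_bb: "homogeneous (int n - int m) bb"
proof -
  have "homogeneous (\<Sum>p\<in>P. int (card (E p) - 1) * 1) bb"
    unfolding bb_def by (intro homogeneous_prod homogeneous_power) (simp add: \<beta>_def)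
  moreover have "int (card (E p) - 1) = int (card (E p)) - 1" if "p \<in> P" for p
    using that E_ne fin_E by (simp add: Suc_leI card_gt_0_iff of_nat_diff)
  ultimately show ?thesis by (simp add: card_L m_def sum_subtractf)
qed

lemma bb_neq_0: "bb \<noteq> 0"
  using fin_P \<beta>_prime by (auto simp: bb_def dest: prime_elem_not_zeroI)

lemma res0_bb [simp]: "res0 bb = bb"
  by (simp add: bb_def res0_hom)

text \<open>Two lines through the same point of x = 0 have forms that differ by a multiple of x.
  Comparing each with a fixed one \<open>e0\<close> shows that \<open>\<psi> 0\<close> minus a
  multiple of x is divisible by the forms of all lines through the point except \<open>e0\<close>;
  these forms have the same restriction.\<close>

lemma bb_dvd:
  assumes "tangent \<psi>"
  shows "bb dvd res0 (\<psi> 0)"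
  unfolding bb_def
proof (intro prod_prime_powers_dvd fin_P \<beta>_prime \<beta>_ndvd)
  fix p assume p: "p \<in> P"
  then obtain e0 where e0: "e0 \<in> E p" using E_ne by blast
  have tan: "form (p, e) dvd cst e * \<psi> 0 + cst (b p) * \<psi> 1 + cst (c p) * \<psi> 2" if "e \<in> E p" for e
    using assms p that by (force simp: tangent_def L_def form_def der_lf_vec3)
  then obtain B where B: "cst e0 * \<psi> 0 + cst (b p) * \<psi> 1 + cst (c p) * \<psi> 2 = form (p, e0) * B"
    using e0 by (meson dvdE)
  have "(\<Prod>e\<in>E p - {e0}. form (p, e)) dvd \<psi> 0 - X0 * B"
  proof (rule prod_primes_dvd)
    fix e assume e: "e \<in> E p - {e0}"
    have "cst e * \<psi> 0 + cst (b p) * \<psi> 1 + cst (c p) * \<psi> 2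
        = form (p, e) * B + cst (e - e0) * (\<psi> 0 - X0 * B)"
      using B by (simp add: form_def lf_vec3 cst_diff algebra_simps)
    then have "form (p, e) dvd cst (e - e0) * (\<psi> 0 - X0 * B)"
      using tan[of e] e by (metis DiffE dvd_add_right_iff dvd_triv_left)
    then show "form (p, e) dvd \<psi> 0 - X0 * B" using e by (simp add: dvd_cst_mult_iff)
  qed (use p fin_E form_prime form_ndvd in \<open>auto simp: L_def\<close>)
  then obtain s where "\<psi> 0 - X0 * B = (\<Prod>e\<in>E p - {e0}. form (p, e)) * s" by (elim dvdE)
  then have "res0 (\<psi> 0 - X0 * B) = res0 ((\<Prod>e\<in>E p - {e0}. form (p, e)) * s)" by simp
  then have "res0 (\<psi> 0) = \<beta> p ^ (card (E p) - 1) * res0 s"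
    using e0 p fin_E by (simp add: res0_hom res0_form)
  then show "\<beta> p ^ (card (E p) - 1) dvd res0 (\<psi> 0)" by simp
qed

lemma X0_f_dvd_det3:
  assumes "tangent u" "tangent v" "tangent w" "X0 dvd u 0" "X0 dvd v 0" "X0 dvd w 0"
  shows "X0 * f dvd det3 u v w"
proof (rule X0_f_dvdI)
  show "X0 dvd det3 u v w" using assms by (auto simp: det3_def)
qed (use assms f_dvd_det3 in blast)

text \<open>When the degrees add up to that of x f, the cofactor is a constant; this half of Saito's
  criterion leaves only nonvanishing to be tested.\<close>

lemma det3_eq_multiple:
  assumes "tangent u" "tangent v" "tangent w" "X0 dvd u 0" "X0 dvd v 0" "X0 dvd w 0"
    and "\<And>i. homogeneous d1 (u i)" "\<And>i. homogeneous d2 (v i)" "\<And>i. homogeneous d3 (w i)"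
    and "d1 + d2 + d3 = 1 + int n"
  obtains \<kappa> where "det3 u v w = cst \<kappa> * X0 * f"
proof -
  have "homogeneous (1 + int n) (X0 * f)"
    by (intro homogeneous_mult homogeneous_var homogeneous_f)
  moreover have "homogeneous (1 + int n) (det3 u v w)"
    using homogeneous_det3[of d1 u d2 v d3 w] assms by simp
  ultimately obtain s where "det3 u v w = s * (X0 * f)" "homogeneous (1 + int n - (1 + int n)) s"
    using homogeneous_dvdE[OF X0_f_dvd_det3[OF assms(1-6)]] by blast
  then show thesis using homogeneous_0_cst[of s] that by (auto simp: mult.assoc)
qed

end

text \<open>The identity \<open>det_f\<close> with nonzero \<open>\<kappa>\<close> says that
  \<open>var\<close>, \<open>\<theta>1\<close>, \<open>\<theta>2\<close> are a basis of the fields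
  tangent to all lines including x = 0. The bounds \<open>card P \<le> d1\<close> and
  \<open>card P \<le> d2\<close> give the entries of the later relation positive degree, that is,
  minimality of the resolution.\<close>

locale free_deletion = line_family P b c E
  for P :: "'p set" and b c :: "'p \<Rightarrow> complex" and E :: "'p \<Rightarrow> complex set" +
  fixes d1 d2 :: nat and \<theta>1 \<theta>2 :: "3 \<Rightarrow> polyC3" and \<kappa> :: complex
  assumes hom1: "\<And>i. homogeneous (int d1) (\<theta>1 i)" and hom2: "\<And>i. homogeneous (int d2) (\<theta>2 i)"
    and tangent1: "tangent \<theta>1" and tangent2: "tangent \<theta>2"
    and tan1_0: "X0 dvd \<theta>1 0" and tan2_0: "X0 dvd \<theta>2 0"
    and \<kappa>: "\<kappa> \<noteq> 0"
    and det_f: "det3 var \<theta>1 \<theta>2 = cst \<kappa> * X0 * f"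
    and degs: "0 < card P" "card P \<le> d1" "card P \<le> d2"
begin

lemma det_neq_0: "det3 var \<theta>1 \<theta>2 \<noteq> 0"
  using \<kappa> f_neq_0 by (simp add: det_f)

text \<open>Cramer's rule: each numerator is again divisible by x f, which is the denominator up to
  a constant.\<close>

lemma saito:
  assumes "tangent \<psi>" "X0 dvd \<psi> 0"
  obtains r0 r1 r2 where "\<And>i. \<psi> i = r0 * var i + r1 * \<theta>1 i + r2 * \<theta>2 i"
proof -
  have F: "\<exists>s. det3 u v w = X0 * f * s"
    if "tangent u" "tangent v" "tangent w" "X0 dvd u 0" "X0 dvd v 0" "X0 dvd w 0" for u v w
    using X0_f_dvd_det3 that by (meson dvdE)
  obtain s0 where s0: "det3 \<psi> \<theta>1 \<theta>2 = X0 * f * s0"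
    using F assms tangent1 tangent2 tan1_0 tan2_0 by blast
  obtain s1 where s1: "det3 var \<psi> \<theta>2 = X0 * f * s1"
    using F assms tangent_var tangent2 dvd_refl tan2_0 by blast
  obtain s2 where s2: "det3 var \<theta>1 \<psi> = X0 * f * s2"
    using F assms tangent_var tangent1 dvd_refl tan1_0 by blast
  let ?k = "cst (1 / \<kappa>)"
  have k: "?k * cst \<kappa> = 1" using \<kappa> by (simp flip: cst_mult)
  have "\<psi> i = ?k * s0 * var i + ?k * s1 * \<theta>1 i + ?k * s2 * \<theta>2 i" for i
  proof -
    have "X0 * f * (cst \<kappa> * \<psi> i) = X0 * f * (s0 * var i + s1 * \<theta>1 i + s2 * \<theta>2 i)"
      using cramer3[of var \<theta>1 \<theta>2 \<psi> i] by (simp add: det_f s0 s1 s2 algebra_simps)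
    then have "cst \<kappa> * \<psi> i = s0 * var i + s1 * \<theta>1 i + s2 * \<theta>2 i"
      using f_neq_0 by simp
    then have "(?k * cst \<kappa>) * \<psi> i = ?k * (s0 * var i + s1 * \<theta>1 i + s2 * \<theta>2 i)"
      by (simp only: mult.assoc)
    then show ?thesis unfolding k by (simp only: distrib_left mult.assoc mult_1)
  qed
  then show thesis using that by blast
qed

lemma independent:
  assumes "\<And>i. s0 * var i + s1 * \<theta>1 i + s2 * \<theta>2 i = 0"
  shows "s0 = 0 \<and> s1 = 0 \<and> s2 = 0"
  using det3_independent[OF det_neq_0 assms] .

text \<open>Two fields parallel to the Euler field on x = 0 would make the determinant divisible by
  x squared.\<close>

lemma not_both_proportional:
  assumes "res0 (X1 * \<theta>1 2 - X2 * \<theta>1 1) = 0" "res0 (X1 * \<theta>2 2 - X2 * \<theta>2 1) = 0"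
  shows False
proof -
  obtain u \<psi> where 1: "\<And>i. \<theta>1 i = u * var i + X0 * \<psi> i"
    by (rule restriction_proportional[OF tan1_0 assms(1) hom1]) (rule that)
  obtain u' \<psi>' where 2: "\<And>i. \<theta>2 i = u' * var i + X0 * \<psi>' i"
    by (rule restriction_proportional[OF tan2_0 assms(2) hom2]) (rule that)
  have "det3 var \<theta>1 \<theta>2 = X0 * (X0 * det3 var \<psi> \<psi>')"
    unfolding det3_def 1 2 by (simp add: algebra_simps)
  then have "X0 * (cst \<kappa> * f) = X0 * (X0 * det3 var \<psi> \<psi>')"
    by (simp add: det_f ac_simps)
  then have "X0 dvd cst \<kappa> * f" by simp
  then show False using X0_ndvd_f \<kappa> by (simp add: dvd_cst_mult_iff)
qed

lemma n_degrees: "int n = int d1 + int d2"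
proof -
  have "homogeneous (1 + int d1 + int d2) (det3 var \<theta>1 \<theta>2)"
    by (intro homogeneous_det3 homogeneous_var hom1 hom2)
  moreover have "homogeneous (0 + 1 + int n) (det3 var \<theta>1 \<theta>2)"
    unfolding det_f by (intro homogeneous_mult homogeneous_cst homogeneous_var homogeneous_f)
  ultimately have "1 + int d1 + int d2 = 0 + 1 + int n"
    using homogeneous_unique det_neq_0 by blast
  then show ?thesis by simp
qed

text \<open>\<open>p1\<close> and \<open>p2\<close> are the wedges of the two restricted fields with
  the Euler field, divided by \<open>q\<close>. The combination with crossed coefficients has zero
  wedge, hence is a multiple \<open>k\<close> of the Euler field modulo x, and dividing the
  difference by x gives \<open>\<phi>\<close>.\<close>

lemma ex_third_generator:
  obtains \<phi> p1 p2 k where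
    "\<And>i. X0 * \<phi> i = p2 * \<theta>1 i - p1 * \<theta>2 i - k * var i"
    "res0 p1 = p1" "res0 p2 = p2" "p1 \<noteq> 0 \<or> p2 \<noteq> 0"
    "homogeneous (int d1 + 1 - int m) p1" "homogeneous (int d2 + 1 - int m) p2"
    "tangent \<phi>" "\<And>i. homogeneous (int n - int m) (\<phi> i)" "\<not> X0 dvd \<phi> 0"
proof -
  obtain p1 where p1: "res0 (X1 * \<theta>1 2 - X2 * \<theta>1 1) = p1 * q" "res0 p1 = p1"
    "homogeneous (int d1 + 1 - int m) p1"
    using restriction_quotient[OF tangent1 tan1_0 hom1] by blast
  obtain p2 where p2: "res0 (X1 * \<theta>2 2 - X2 * \<theta>2 1) = p2 * q" "res0 p2 = p2"
    "homogeneous (int d2 + 1 - int m) p2"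
    using restriction_quotient[OF tangent2 tan2_0 hom2] by blast
  define v where "v i = p2 * \<theta>1 i - p1 * \<theta>2 i" for i
  have "X1 * v 2 - X2 * v 1 = p2 * (X1 * \<theta>1 2 - X2 * \<theta>1 1) - p1 * (X1 * \<theta>2 2 - X2 * \<theta>2 1)"
    by (simp add: v_def algebra_simps)
  then have "res0 (X1 * v 2 - X2 * v 1) = res0 p2 * (p1 * q) - res0 p1 * (p2 * q)"
    using p1(1) p2(1) by (simp only: res0_hom)
  then have v0: "res0 (X1 * v 2 - X2 * v 1) = 0"
    by (simp add: p1(2) p2(2))
  have X0v: "X0 dvd v 0" using tan1_0 tan2_0 by (simp add: v_def dvd_diff)
  have "homogeneous (int d2 + 1 - int m + int d1) (v i)" for i
  proof -
    have "homogeneous (int d2 + 1 - int m + int d1) (p2 * \<theta>1 i)"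
      by (intro homogeneous_mult p2 hom1)
    moreover have "homogeneous (int d1 + 1 - int m + int d2) (p1 * \<theta>2 i)"
      by (intro homogeneous_mult p1 hom2)
    then have "homogeneous (int d2 + 1 - int m + int d1) (p1 * \<theta>2 i)"
      by (simp add: algebra_simps)
    ultimately show ?thesis unfolding v_def by (rule homogeneous_diff)
  qed
  from restriction_proportional[OF X0v v0 this]
  obtain k \<phi> where k: "\<And>i. v i = k * var i + X0 * \<phi> i"
    and h\<phi>: "\<And>i. homogeneous (int d2 + 1 - int m + int d1 - 1) (\<phi> i)" by metis
  have rel: "X0 * \<phi> i = p2 * \<theta>1 i - p1 * \<theta>2 i - k * var i" for i
    using k[of i] by (simp add: v_def algebra_simps)
  have h\<phi>': "homogeneous (int n - int m) (\<phi> i)" for i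
    using h\<phi>[of i] by (simp add: n_degrees algebra_simps)
  \<comment> \<open>The field x times \<open>\<phi>\<close> is tangent, and no form of another line
    divides x.\<close>
  have tan: "tangent \<phi>"
    unfolding tangent_def
  proof
    fix l assume l: "l \<in> L"
    have "X0 * der \<phi> (form l) = (\<Sum>i\<in>UNIV. (X0 * \<phi> i) * pdiff i (form l))"
      by (simp add: der_def sum_distrib_left mult.assoc)
    also have "\<dots> = p2 * der \<theta>1 (form l) - p1 * der \<theta>2 (form l) - k * der var (form l)"
      by (simp add: rel der_def sum_UNIV_3 algebra_simps)
    finally have "form l dvd X0 * der \<phi> (form l)"
      using tangent1 tangent2 tangent_var l by (simp add: tangent_def)
    then show "form l dvd der \<phi> (form l)"
      using form_prime[OF l] form_ndvd_X0[OF l] by (simp add: prime_elem_dvd_mult_iff)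
  qed
  have p: "p1 \<noteq> 0 \<or> p2 \<noteq> 0"
    using not_both_proportional p1(1) p2(1) by auto
  \<comment> \<open>Otherwise \<open>\<phi>\<close> would be a combination of the basis; by
    comparison of coefficients x would divide \<open>p1\<close> and \<open>p2\<close>, which are
    free of x and not both zero.\<close>
  have "\<not> X0 dvd \<phi> 0"
  proof
    assume "X0 dvd \<phi> 0"
    then obtain r0 r1 r2 where r: "\<And>i. \<phi> i = r0 * var i + r1 * \<theta>1 i + r2 * \<theta>2 i"
      using saito tan by metis
    have "(X0 * r0 + k) * var i + (X0 * r1 - p2) * \<theta>1 i + (X0 * r2 + p1) * \<theta>2 i = 0" for i
      using rel[of i] by (simp add: r algebra_simps)
    then have "X0 * r1 - p2 = 0" "X0 * r2 + p1 = 0" using independent by blast+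
    then have "X0 dvd p2" "X0 dvd p1"
      by (metis dvd_triv_left eq_iff_diff_eq_0) (metis \<open>X0 * r2 + p1 = 0\<close> add_eq_0_iff dvd_minus_iff dvd_triv_left)
    then have "p1 = 0" "p2 = 0" using p1(2) p2(2) by (simp_all add: X0_dvd_iff)
    then show False using p by simp
  qed
  then show thesis using that rel p1 p2 p tan h\<phi>' by blast
qed

text \<open>Each form occurs once in f, so modulo this form only the term in which it is
  differentiated survives.\<close>

lemma der_f_tangent: "der \<psi> f = 0 \<Longrightarrow> tangent \<psi>"
  unfolding tangent_def
proof
  fix l assume f: "der \<psi> f = 0" and l: "l \<in> L"
  define g where "g = (\<Prod>l\<in>L - {l}. form l)"
  have "f = form l * g" unfolding f_def g_def using l fin_L by (simp add: prod.remove)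
  then have "der \<psi> (form l) * g = form l * (- der \<psi> g)"
    using f by (simp add: der_mult eq_neg_iff_add_eq_0)
  then have "form l dvd der \<psi> (form l) * g" by simp
  moreover have "\<not> form l dvd g"
  proof
    assume "form l dvd g"
    then obtain l' where "l' \<in> L - {l}" "form l dvd form l'"
      unfolding g_def using form_prime[OF l] fin_L by (metis finite_Diff prime_elem_dvd_prodE)
    then show False using form_ndvd[OF l, of l'] by auto
  qed
  ultimately show "form l dvd der \<psi> (form l)"
    using form_prime[OF l] prime_elem_dvd_mult_iff by blast
qed

text \<open>The Euler field multiplies f by its degree, so a multiple of it cancels the factor by
  which a tangent field multiplies f. The coefficient \<open>1\<close> brings the sum into the shape
  of \<open>der_lincomb\<close>.\<close>

lemma annihilator:
  assumes "tangent \<theta>" "\<And>i. homogeneous d (\<theta> i)" "n \<noteq> 0"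
  obtains h where "der (\<lambda>i. 1 * \<theta> i + h * var i) f = 0" "\<And>i. homogeneous d (1 * \<theta> i + h * var i)"
proof -
  have "f dvd der \<theta> f"
    unfolding f_def using assms(1) by (intro der_prod_dvd fin_L) (auto simp: tangent_def)
  then obtain s where s: "der \<theta> f = s * f" "homogeneous (d + int n - 1 - int n) s"
    using homogeneous_dvdE[OF _ homogeneous_f homogeneous_der[where \<theta> = \<theta>, OF assms(2) homogeneous_f]] by blast
  define h where "h = cst (- 1 / of_nat n) * s"
  have E: "der var f = cst (of_nat n) * f" using euler[OF homogeneous_f] by simp
  have "h * der var f = - s * f"
  proof -
    have "h * der var f = (cst (- 1 / of_nat n) * cst (of_nat n)) * s * f"
      by (simp only: h_def E ac_simps)
    also have "cst (- 1 / of_nat n) * cst (of_nat n) = cst (- 1)"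
      unfolding cst_mult[symmetric] using assms(3) by simp
    finally show ?thesis by (simp add: cst_uminus)
  qed
  then have "der (\<lambda>i. 1 * \<theta> i + h * var i) f = 0"
    by (simp only: der_lincomb s) simp
  moreover have "homogeneous d (1 * \<theta> i + h * var i)" for i
  proof -
    have "homogeneous (d - 1) h" unfolding h_def using s(2) by (intro homogeneous_cst_mult) simp
    from homogeneous_mult[OF this homogeneous_var[of i]] show ?thesis
      using assms(2) by (simp add: homogeneous_add)
  qed
  ultimately show thesis using that by blast
qed

theorem deletion: "three_syzygies f (vec3 d1 d2 (n - m))"
proof -
  obtain \<phi> p1 p2 k where rel: "\<And>i. X0 * \<phi> i = p2 * \<theta>1 i - p1 * \<theta>2 i - k * var i"
    and p: "res0 p1 = p1" "res0 p2 = p2" "p1 \<noteq> 0 \<or> p2 \<noteq> 0"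
    and hp: "homogeneous (int d1 + 1 - int m) p1" "homogeneous (int d2 + 1 - int m) p2"
    and tan\<phi>: "tangent \<phi>" and hom\<phi>: "\<And>i. homogeneous (int n - int m) (\<phi> i)"
    and \<phi>0: "\<not> X0 dvd \<phi> 0"
    by (rule ex_third_generator) blast
  \<comment> \<open>\<open>\<phi> 0\<close> has the degree of Terao's polynomial, so the quotient is
    a constant; it is nonzero because \<open>\<phi>\<close> is not tangent to x = 0.\<close>
  obtain c0 where c0: "res0 (\<phi> 0) = cst c0 * bb"
  proof -
    obtain s where s: "res0 (\<phi> 0) = s * bb" "homogeneous (int n - int m - (int n - int m)) s"
      using homogeneous_dvdE[OF bb_dvd[OF tan\<phi>] homogeneous_bb homogeneous_res0[OF hom\<phi>]] by blast
    then show thesis using that homogeneous_0_cst[of s] by auto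
  qed
  have c0_ne: "c0 \<noteq> 0" using \<phi>0 c0 by (auto simp: X0_dvd_iff)
  \<comment> \<open>A suitable multiple of \<open>\<phi>\<close> cancels the restriction of the
    first component; the difference is tangent to x = 0 and \<open>saito\<close> applies.\<close>
  have gen: "\<exists>r0 r1 r2 r3. \<forall>i. \<psi> i = r0 * var i + r1 * \<theta>1 i + r2 * \<theta>2 i + r3 * \<phi> i"
    if tan\<psi>: "tangent \<psi>" for \<psi>
  proof -
    obtain s where s: "res0 (\<psi> 0) = s * bb"
      using bb_dvd[OF tan\<psi>] by (metis dvd_def mult.commute)
    then have "res0 s * bb = s * bb" by (metis res0_bb res0_hom(7) res0_idem)
    then have rs: "res0 s = s" using bb_neq_0 by simp
    define r3 where "r3 = cst (1 / c0) * s"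
    have "res0 (\<psi> 0 - r3 * \<phi> 0) = s * bb - (cst (1 / c0) * cst c0) * s * bb"
      by (simp add: r3_def res0_hom s rs c0 ac_simps)
    also have "\<dots> = 0" using c0_ne by (simp flip: cst_mult)
    finally have "X0 dvd 1 * \<psi> 0 + (- r3) * \<phi> 0" by (simp add: X0_dvd_iff)
    from saito[OF tangent_lincomb[OF tan\<psi> tan\<phi>] this]
    obtain r0 r1 r2 where "\<And>i. 1 * \<psi> i + (- r3) * \<phi> i = r0 * var i + r1 * \<theta>1 i + r2 * \<theta>2 i"
      by metis
    then have "\<psi> i = r0 * var i + r1 * \<theta>1 i + r2 * \<theta>2 i + r3 * \<phi> i" for i
      by (metis (no_types, lifting) add.commute add_diff_cancel_right' diff_minus_eq_add mult_1
        mult_minus_left uminus_add_conv_diff)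
    then show ?thesis by blast
  qed
  have n0: "n \<noteq> 0" using m_le_n degs by (simp add: m_def)
  obtain h1 where h1: "der (\<lambda>i. 1 * \<theta>1 i + h1 * var i) f = 0"
    "\<And>i. homogeneous (int d1) (1 * \<theta>1 i + h1 * var i)"
    using annihilator[OF tangent1 hom1 n0] by blast
  obtain h2 where h2: "der (\<lambda>i. 1 * \<theta>2 i + h2 * var i) f = 0"
    "\<And>i. homogeneous (int d2) (1 * \<theta>2 i + h2 * var i)"
    using annihilator[OF tangent2 hom2 n0] by blast
  obtain h3 where h3: "der (\<lambda>i. 1 * \<phi> i + h3 * var i) f = 0"
    "\<And>i. homogeneous (int n - int m) (1 * \<phi> i + h3 * var i)"
    using annihilator[OF tan\<phi> hom\<phi> n0] by blast
  define \<rho>1 where "\<rho>1 i = \<theta>1 i + h1 * var i" for i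
  define \<rho>2 where "\<rho>2 i = \<theta>2 i + h2 * var i" for i
  define \<rho>3 where "\<rho>3 i = \<phi> i + h3 * var i" for i
  have der\<rho>: "der \<rho>1 f = 0" "der \<rho>2 f = 0" "der \<rho>3 f = 0"
    using h1(1) h2(1) h3(1) by (simp_all add: \<rho>1_def[abs_def] \<rho>2_def[abs_def] \<rho>3_def[abs_def])
  have E: "der var f = of_nat n * f" by (rule euler[OF homogeneous_f])
  \<comment> \<open>Applying a combination to f isolates the Euler coefficient, as the three
    corrected fields annihilate f.\<close>
  have no_E: "r = 0" if "der (\<lambda>i. r * var i + (r1 * \<rho>1 i + r2 * \<rho>2 i + r3 * \<rho>3 i)) f = 0" for r r1 r2 r3
  proof -
    have "der (\<lambda>i. r * var i + (r1 * \<rho>1 i + r2 * \<rho>2 i + r3 * \<rho>3 i)) f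
        = r * der var f + r1 * der \<rho>1 f + r2 * der \<rho>2 f + r3 * der \<rho>3 f"
      by (simp add: der_def sum_UNIV_3 algebra_simps)
    then have "r * (of_nat n * f) = 0" using that by (simp add: der\<rho> E)
    then show ?thesis using n0 f_neq_0 by simp
  qed
  \<comment> \<open>The relation survives the correction: the two sides differ by a multiple of the
    Euler field that annihilates f, hence by zero.\<close>
  have rel\<rho>: "X0 * \<rho>3 i = p2 * \<rho>1 i - p1 * \<rho>2 i" for i
  proof -
    let ?r = "p2 * h1 - p1 * h2 + k - X0 * h3"
    have eq: "?r * var i + (- p2 * \<rho>1 i + p1 * \<rho>2 i + X0 * \<rho>3 i) = 0" for i
    proof -
      have "X0 * \<rho>3 i = p2 * \<theta>1 i - p1 * \<theta>2 i - k * var i + X0 * (h3 * var i)"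
        by (simp add: \<rho>3_def distrib_left rel)
      then show ?thesis by (simp add: \<rho>1_def \<rho>2_def algebra_simps)
    qed
    have "der (\<lambda>i. ?r * var i + (- p2 * \<rho>1 i + p1 * \<rho>2 i + X0 * \<rho>3 i)) f = 0"
      by (simp only: eq der_def mult_zero_left sum.neutral_const)
    then have "?r = 0" by (rule no_E)
    then show ?thesis using eq[of i] by (simp add: algebra_simps)
  qed
  define \<rho> where "\<rho> = vec3 \<rho>1 \<rho>2 \<rho>3"
  define g where "g = vec3 (- p2) p1 X0"
  have sum\<rho>: "(\<Sum>k\<in>UNIV. h k * \<rho> k i) = h 0 * \<rho>1 i + h 1 * \<rho>2 i + h 2 * \<rho>3 i" for h i
    by (simp add: \<rho>_def sum_UNIV_3)
  have "\<forall>k i. homogeneous (int (vec3 d1 d2 (n - m) k)) (\<rho> k i)"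
    using h1(2) h2(2) h3(2) m_le_n
    by (simp add: all_3 \<rho>_def \<rho>1_def \<rho>2_def \<rho>3_def of_nat_diff)
  \<comment> \<open>The relation has the coefficient x at the generator of degree n - m, whence the
    1.\<close>
  moreover define e where "e = int n - int m + 1"
  have "\<forall>k. homogeneous (e - int (vec3 d1 d2 (n - m) k)) (g k) \<and> int (vec3 d1 d2 (n - m) k) < e"
    unfolding all_3 using hp m_le_n degs
    by (simp add: g_def e_def homogeneous_uminus of_nat_diff n_degrees algebra_simps m_def)
  moreover have "\<exists>k. g k \<noteq> 0"
    by (rule exI[of _ 2]) (simp add: g_def)
  moreover have "\<forall>k. der (\<rho> k) f = 0"
    using der\<rho> by (simp add: all_3 \<rho>_def)
  moreover have "\<exists>h. \<forall>i. \<theta> i = (\<Sum>k\<in>UNIV. h k * \<rho> k i)" if \<theta>: "der \<theta> f = 0" for \<theta>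
  proof -
    obtain r0 r1 r2 r3 where r: "\<And>i. \<theta> i = r0 * var i + r1 * \<theta>1 i + r2 * \<theta>2 i + r3 * \<phi> i"
      using gen[OF der_f_tangent[OF \<theta>]] by blast
    let ?r = "r0 - r1 * h1 - r2 * h2 - r3 * h3"
    have eq: "\<theta> i = ?r * var i + (r1 * \<rho>1 i + r2 * \<rho>2 i + r3 * \<rho>3 i)" for i
      unfolding r \<rho>1_def \<rho>2_def \<rho>3_def by (simp add: algebra_simps)
    then have "\<theta> = (\<lambda>i. ?r * var i + (r1 * \<rho>1 i + r2 * \<rho>2 i + r3 * \<rho>3 i))" by blast
    from HOL.subst[OF this, where P = "\<lambda>t. der t f = 0", OF \<theta>] have "?r = 0" by (rule no_E)
    then have "\<forall>i. \<theta> i = (\<Sum>k\<in>UNIV. vec3 r1 r2 r3 k * \<rho> k i)"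
      using eq by (simp add: sum\<rho>)
    then show ?thesis by blast
  qed
  moreover have "\<forall>i. (\<Sum>k\<in>UNIV. g k * \<rho> k i) = 0"
    by (simp add: sum\<rho> g_def rel\<rho>)
  \<comment> \<open>Multiplying by x eliminates the third generator, and independence of
    \<open>\<theta>1\<close>, \<open>\<theta>2\<close> forces \<open>X0 * h 0 = - h 2 * p2\<close>
    and \<open>X0 * h 1 = h 2 * p1\<close>. As \<open>p1\<close>, \<open>p2\<close> are free of x
    and not both zero, x divides \<open>h 2\<close>.\<close>
  moreover have "\<exists>s. \<forall>k. h k = s * g k" if h: "\<forall>i. (\<Sum>k\<in>UNIV. h k * \<rho> k i) = 0" for h
  proof -
    have h0: "h 0 * \<rho>1 i + h 1 * \<rho>2 i + h 2 * \<rho>3 i = 0" for i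
      using h by (simp add: sum\<rho>)
    have z: "(X0 * h 0 + h 2 * p2) * \<rho>1 i + (X0 * h 1 - h 2 * p1) * \<rho>2 i = 0" for i
    proof -
      have "(X0 * h 0 + h 2 * p2) * \<rho>1 i + (X0 * h 1 - h 2 * p1) * \<rho>2 i
          = X0 * (h 0 * \<rho>1 i + h 1 * \<rho>2 i) + h 2 * (p2 * \<rho>1 i - p1 * \<rho>2 i)"
        by (simp add: algebra_simps)
      also have "\<dots> = X0 * (h 0 * \<rho>1 i + h 1 * \<rho>2 i + h 2 * \<rho>3 i)"
        by (simp add: algebra_simps flip: rel\<rho>)
      finally show ?thesis by (simp add: h0)
    qed
    have "((X0 * h 0 + h 2 * p2) * h1 + (X0 * h 1 - h 2 * p1) * h2) * var i
        + (X0 * h 0 + h 2 * p2) * \<theta>1 i + (X0 * h 1 - h 2 * p1) * \<theta>2 i = 0" for i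
      using z[of i] by (simp add: \<rho>1_def \<rho>2_def algebra_simps)
    then have *: "X0 * h 0 + h 2 * p2 = 0" "X0 * h 1 - h 2 * p1 = 0"
      using independent by blast+
    then have "res0 (X0 * h 0 + h 2 * p2) = 0" "res0 (X0 * h 1 - h 2 * p1) = 0"
      by (simp_all add: res0_hom)
    then have "res0 (h 2) = 0" using p by (auto simp: res0_hom)
    then obtain s where s: "h 2 = X0 * s" by (metis X0_dvd_iff dvdE)
    have "X0 * (h 0 + s * p2) = 0" "X0 * (h 1 - s * p1) = 0"
      using * by (simp_all add: s algebra_simps)
    then have "h 0 + s * p2 = 0" "h 1 - s * p1 = 0" by simp_all
    then have "h 0 = s * (- p2)" "h 1 = s * p1" "h 2 = s * X0"
      using s by (simp_all add: eq_neg_iff_add_eq_0 mult.commute)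
    then have "\<forall>k. h k = s * g k" unfolding all_3 by (simp add: g_def)
    then show ?thesis by blast
  qed
  ultimately show ?thesis unfolding three_syzygies_def by blast
qed

end

section \<open>Transport along linear maps and translation into a graded resolution\<close>

section \<open>Linear changes of coordinates\<close>

text \<open>Matrices as functions on the index type: identities between them unfold into polynomial
  identities in the nine entries.\<close>

type_synonym 'a mat3 = "3 \<Rightarrow> 3 \<Rightarrow> 'a"

definition mmul :: "'a mat3 \<Rightarrow> 'a mat3 \<Rightarrow> 'a::comm_ring_1 mat3" where
  "mmul A B i j = (\<Sum>k\<in>UNIV. A i k * B k j)"

definition one3 :: "'a::comm_ring_1 mat3" where
  "one3 i j = (if i = j then 1 else 0)"

definition mvmul :: "'a mat3 \<Rightarrow> (3 \<Rightarrow> 'a) \<Rightarrow> 3 \<Rightarrow> 'a::comm_ring_1" where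
  "mvmul A v i = (\<Sum>k\<in>UNIV. A i k * v k)"

definition tr3 :: "'a mat3 \<Rightarrow> 'a mat3" where
  "tr3 A i j = A j i"

lemma mmul_assoc: "mmul (mmul A B) C = mmul A (mmul B C)"
  by (intro ext) (simp add: mmul_def sum_UNIV_3 algebra_simps)

lemma mmul_one3 [simp]: "mmul one3 A = A" "mmul A one3 = A"
  by (simp_all add: mmul_def one3_def fun_eq_3 sum_UNIV_3)

lemma mvmul_mmul: "mvmul (mmul A B) v = mvmul A (mvmul B v)"
  by (intro ext) (simp add: mmul_def mvmul_def sum_UNIV_3 algebra_simps)

lemma mvmul_one3 [simp]: "mvmul one3 v = v"
  by (intro ext, simp add: mvmul_def one3_def if_distrib[of "\<lambda>x. x * _"] cong: if_cong)

lemma tr3_mmul: "tr3 (mmul A B) = mmul (tr3 B) (tr3 A)"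
  by (intro ext) (simp add: tr3_def mmul_def mult.commute)

lemma tr3_tr3 [simp]: "tr3 (tr3 A) = A"
  by (intro ext) (simp add: tr3_def)

lemma tr3_one3 [simp]: "tr3 one3 = one3"
  by (intro ext) (auto simp: tr3_def one3_def)

abbreviation cmat :: "complex mat3 \<Rightarrow> polyC3 mat3" where
  "cmat T \<equiv> \<lambda>i j. cst (T i j)"

text \<open>Composition of a polynomial with the linear map \<open>T\<close>; hence contravariant in
  \<open>T\<close>, see \<open>lsub_lsub\<close>.\<close>

definition lsub :: "complex mat3 \<Rightarrow> polyC3 \<Rightarrow> polyC3" where
  "lsub T = subst (mvmul (cmat T) var)"

lemma lsub_hom: "lsub T 0 = 0" "lsub T 1 = 1" "lsub T (cst c) = cst c" "lsub T (p + q) = lsub T p + lsub T q"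
  "lsub T (p - q) = lsub T p - lsub T q" "lsub T (- p) = - lsub T p" "lsub T (p * q) = lsub T p * lsub T q"
  "lsub T (p ^ n) = lsub T p ^ n" "lsub T (prod f A) = (\<Prod>x\<in>A. lsub T (f x))"
  "lsub T (sum f A) = (\<Sum>x\<in>A. lsub T (f x))" "lsub T (var i) = mvmul (cmat T) var i"
  by (simp_all add: lsub_def subst_simps)

lemma lsub_lsub: "lsub U (lsub T p) = lsub (mmul T U) p"
proof -
  have "(\<lambda>i. lsub U (mvmul (cmat T) var i)) = mvmul (cmat (mmul T U)) var"
    by (intro ext) (simp add: mvmul_def mmul_def lsub_hom cst_add cst_mult sum_UNIV_3 algebra_simps)
  then show ?thesis by (simp add: lsub_def subst_subst)
qed

lemma lsub_one3 [simp]: "lsub one3 p = p"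
proof -
  have "cmat one3 = one3" by (intro ext) (simp add: one3_def)
  then show ?thesis by (simp add: lsub_def subst_var_id)
qed

lemma homogeneous_lsub: "homogeneous k p \<Longrightarrow> homogeneous k (lsub T p)"
  unfolding lsub_def mvmul_def
  by (erule homogeneous_subst) (intro homogeneous_sum homogeneous_cst_mult homogeneous_var)

lemma pdiff_lsub: "pdiff j (lsub T p) = (\<Sum>i\<in>UNIV. lsub T (pdiff i p) * cst (T i j))"
proof -
  have "pdiff j (mvmul (cmat T) var i) = cst (T i j)" for i
    using pdiff_lf[of j "T i"] by (simp add: mvmul_def lf_def)
  then show ?thesis by (simp add: lsub_def pdiff_subst)
qed

lemma lsub_lf: "lsub T (lf a) = lf (mvmul (tr3 T) a)"
  by (simp add: lf_def lsub_hom mvmul_def tr3_def sum_UNIV_3 cst_add cst_mult algebra_simps)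

lemma der_lsub: "der \<theta> (lsub T p) = (\<Sum>i\<in>UNIV. mvmul (cmat T) \<theta> i * lsub T (pdiff i p))"
  by (simp add: der_def pdiff_lsub mvmul_def sum_UNIV_3 algebra_simps)

text \<open>Push-forward of vector fields along \<open>T\<close>, called \<open>M\<close>, carries
  the annihilators of the composed polynomial to those of f. It is semilinear: multipliers are
  composed with the inverse \<open>U\<close>.\<close>

lemma three_syzygies_lsub:
  assumes TU: "mmul T U = one3" "mmul U T = one3" and "three_syzygies (lsub T f) ds"
  shows "three_syzygies f ds"
proof -
  have inv [simp]: "lsub U (lsub T p) = p" "lsub T (lsub U p) = p" for p
    by (simp_all add: lsub_lsub TU)
  have cinv: "mmul (cmat T) (cmat U) = one3" "mmul (cmat U) (cmat T) = one3"
  proof -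
    have "mmul (cmat A) (cmat B) = cmat (mmul A B)" for A B
      by (intro ext) (simp add: mmul_def cst_sum cst_mult)
    then show "mmul (cmat T) (cmat U) = one3" "mmul (cmat U) (cmat T) = one3"
      by (simp_all add: TU) (simp_all add: one3_def fun_eq_iff)
  qed
  define M where "M \<theta> i = lsub U (mvmul (cmat T) \<theta> i)" for \<theta> i
  define M' where "M' \<psi> = mvmul (cmat U) (\<lambda>i. lsub T (\<psi> i))" for \<psi>
  have MM': "M (M' \<psi>) = \<psi>" for \<psi>
    by (intro ext) (simp add: M_def M'_def cinv flip: mvmul_mmul)
  have M'M: "M' (M \<theta>) = \<theta>" for \<theta>
    by (simp add: M_def[abs_def] M'_def cinv flip: mvmul_mmul)
  have der_M: "der (M \<theta>) f = lsub U (der \<theta> (lsub T f))" for \<theta>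
    by (simp add: der_lsub) (simp add: der_def M_def lsub_hom)
  have M_comb: "M (\<lambda>i. \<Sum>k\<in>UNIV. h k * \<rho> k i) i = (\<Sum>k\<in>UNIV. lsub U (h k) * M (\<rho> k) i)" for h :: "3 \<Rightarrow> polyC3" and \<rho> i
    by (simp add: M_def mvmul_def lsub_hom sum_UNIV_3 algebra_simps)
  obtain \<rho> g e where
    hom: "\<And>k i. homogeneous (int (ds k)) (\<rho> k i)"
    and g: "\<And>k. homogeneous (e - int (ds k)) (g k)" "\<And>k. int (ds k) < e" "\<exists>k. g k \<noteq> 0"
    and der: "\<And>k. der (\<rho> k) (lsub T f) = 0"
    and gen: "\<And>\<theta>. der \<theta> (lsub T f) = 0 \<Longrightarrow> \<exists>h. \<forall>i. \<theta> i = (\<Sum>k\<in>UNIV. h k * \<rho> k i)"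
    and rel: "\<And>i. (\<Sum>k\<in>UNIV. g k * \<rho> k i) = 0"
    and uniq: "\<And>h. (\<forall>i. (\<Sum>k\<in>UNIV. h k * \<rho> k i) = 0) \<Longrightarrow> \<exists>s. \<forall>k. h k = s * g k"
    using assms(3) unfolding three_syzygies_def by (elim exE conjE) blast
  define \<rho>' where "\<rho>' k = M (\<rho> k)" for k
  define g' where "g' k = lsub U (g k)" for k
  have "homogeneous (int (ds k)) (\<rho>' k i)" for k i
    unfolding \<rho>'_def M_def mvmul_def
    by (intro homogeneous_lsub homogeneous_sum homogeneous_cst_mult hom)
  moreover have "homogeneous (e - int (ds k)) (g' k)" for k
    unfolding g'_def by (intro homogeneous_lsub g)
  moreover have "\<exists>k. g' k \<noteq> 0"
    using g(3) unfolding g'_def by (metis inv(2) lsub_hom(1))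
  moreover have "der (\<rho>' k) f = 0" for k
    by (simp add: \<rho>'_def der_M der lsub_hom)
  moreover have "\<exists>h. \<forall>i. \<psi> i = (\<Sum>k\<in>UNIV. h k * \<rho>' k i)" if "der \<psi> f = 0" for \<psi>
  proof -
    have "lsub U (der (M' \<psi>) (lsub T f)) = 0" using that der_M[of "M' \<psi>"] by (simp add: MM')
    then have "der (M' \<psi>) (lsub T f) = 0" by (metis inv(2) lsub_hom(1))
    then obtain h where h: "\<And>i. M' \<psi> i = (\<Sum>k\<in>UNIV. h k * \<rho> k i)" using gen by blast
    then have "M' \<psi> = (\<lambda>i. \<Sum>k\<in>UNIV. h k * \<rho> k i)" by blast
    then have "\<psi> i = (\<Sum>k\<in>UNIV. lsub U (h k) * \<rho>' k i)" for i
      using M_comb[of h \<rho> i] MM'[of \<psi>] by (simp add: \<rho>'_def)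
    then show ?thesis by (intro exI[of _ "\<lambda>k. lsub U (h k)"]) blast
  qed
  moreover have M0: "M (\<lambda>_. 0) i = 0" "M' (\<lambda>_. 0) i = 0" for i
    by (simp_all add: M_def M'_def mvmul_def lsub_hom)
  have "(\<Sum>k\<in>UNIV. g' k * \<rho>' k i) = 0" for i
    using M_comb[of g \<rho> i] by (simp add: rel M0 \<rho>'_def g'_def)
  moreover have "\<exists>s. \<forall>k. h k = s * g' k" if h: "\<forall>i. (\<Sum>k\<in>UNIV. h k * \<rho>' k i) = 0" for h
  proof -
    let ?v = "\<lambda>i. \<Sum>k\<in>UNIV. lsub T (h k) * \<rho> k i"
    have "M ?v i = 0" for i
      using h M_comb[of "\<lambda>k. lsub T (h k)" \<rho> i] by (simp add: \<rho>'_def)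
    then have "M ?v = (\<lambda>_. 0)" by blast
    then have "M' (M ?v) i = 0" for i by (simp only: M0)
    then have "\<forall>i. ?v i = 0" unfolding M'M by blast
    from uniq[OF this] obtain s where "\<And>k. lsub T (h k) = s * g k" by blast
    then have "h k = lsub U s * g' k" for k by (metis inv(1) lsub_hom(7) g'_def)
    then show ?thesis by blast
  qed
  ultimately show ?thesis
    unfolding three_syzygies_def using g(2)
    by (intro exI[of _ \<rho>'] exI[of _ g'] exI[of _ e]) simp
qed

section \<open>The resolution of the Milnor algebra\<close>

text \<open>Translation between the index type \<open>3\<close> and the natural indices of
  \<open>mat\<close> and \<open>vec\<close>.\<close>

definition idx :: "3 \<Rightarrow> nat" where
  "idx i = (if i = 0 then 0 else if i = 1 then 1 else 2)"

lemma of_nat_idx [simp]: "of_nat (idx i) = i"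
proof -
  have "\<forall>i. of_nat (idx i) = i" unfolding all_3 by (simp add: idx_def)
  then show ?thesis by blast
qed

lemma idx_less [simp]: "idx i < 3"
  by (simp add: idx_def)

lemma idx_of_nat: "j < 3 \<Longrightarrow> idx (of_nat j) = j"
  by (cases "j = 0"; cases "j = 1"; cases "j = 2") (auto simp: idx_def)

lemma less_3_iff: "j < 3 \<longleftrightarrow> j = 0 \<or> j = 1 \<or> j = (2::nat)"
  by auto

lemma all_nat_less_3: "(\<forall>k<3. P k) \<longleftrightarrow> P 0 \<and> P 1 \<and> P (2::nat)"
  by (auto simp: less_3_iff)

lemma sum_less_3: "(\<Sum>j\<in>{0..<3}. f j) = (\<Sum>k\<in>UNIV. f (idx k))"
proof -
  have "{0..<3} = {0, 1, 2::nat}" by auto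
  then show ?thesis by (simp add: sum_UNIV_3 idx_def add.assoc)
qed

definition of3 :: "(3 \<Rightarrow> 'a) \<Rightarrow> 'a vec" where "of3 w = vec 3 (\<lambda>j. w (of_nat j))"
definition to3 :: "'a vec \<Rightarrow> 3 \<Rightarrow> 'a" where "to3 v i = v $ idx i"

lemma of3_carrier [simp]: "of3 w \<in> carrier_vec 3" by (simp add: of3_def)
lemma to3_of3 [simp]: "to3 (of3 w) = w" by (intro ext) (simp add: to3_def of3_def)
lemma of3_to3: "v \<in> carrier_vec 3 \<Longrightarrow> of3 (to3 v) = v"
  by (intro eq_vecI) (simp_all add: to3_def of3_def idx_of_nat)
lemma of3_eq_iff: "of3 v = of3 w \<longleftrightarrow> v = w" by (metis to3_of3)
lemma of3_0: "of3 (\<lambda>_. 0) = 0\<^sub>v 3" by (intro eq_vecI) (simp_all add: of3_def)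

lemma carrier_vec_3E:
  assumes "v \<in> carrier_vec 3" obtains w where "v = of3 w"
  using of3_to3[OF assms] by metis

lemma mat_mult_of3:
  "mat n 3 F *\<^sub>v of3 (w :: 3 \<Rightarrow> 'a::comm_ring_1) = vec n (\<lambda>i. \<Sum>k\<in>UNIV. F (i, idx k) * w k)"
  by (intro eq_vecI) (simp_all add: scalar_prod_def of3_def sum_less_3)

lemma mat_mult_of1: 
  "mat n 1 F *\<^sub>v vec 1 (\<lambda>_. s) = vec n (\<lambda>i. F (i, 0) * (s :: 'a::comm_ring_1))"
  by (intro eq_vecI) (simp_all add: scalar_prod_def)

text \<open>The gradient row, the matrix with the three generators as columns and the column of
  their relation form the complex. Minimality is degree counting: every entry is homogeneous of
  nonzero degree, so it has no constant term.\<close>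

lemma syzygy_curve_of_three_syzygies:
  assumes "reduced_plane_curve d f" "three_syzygies f ds" "1 < d"
    and "1 \<le> ds 0" "ds 0 \<le> ds 1" "ds 1 \<le> ds 2"
  shows "syzygy_curve d f [ds 0, ds 1, ds 2]"
proof -
  obtain \<rho> g e where
    hom: "\<And>k i. homogeneous (int (ds k)) (\<rho> k i)"
    and g: "\<And>k. homogeneous (e - int (ds k)) (g k)" "\<And>k. int (ds k) < e" "\<exists>k. g k \<noteq> 0"
    and der: "\<And>k. der (\<rho> k) f = 0"
    and gen: "\<And>\<theta>. der \<theta> f = 0 \<Longrightarrow> \<exists>h. \<forall>i. \<theta> i = (\<Sum>k\<in>UNIV. h k * \<rho> k i)"
    and rel: "\<And>i. (\<Sum>k\<in>UNIV. g k * \<rho> k i) = 0"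
    and uniq: "\<And>h. (\<forall>i. (\<Sum>k\<in>UNIV. h k * \<rho> k i) = 0) \<Longrightarrow> \<exists>s. \<forall>k. h k = s * g k"
    using assms(2) unfolding three_syzygies_def by (elim exE conjE) blast
  have homf: "homogeneous (int d) f" using assms(1) by (simp add: reduced_plane_curve_def)
  define A0 :: "polyC3 mat" where "A0 = mat 1 3 (\<lambda>(i, j). pdiff (of_nat j) f)"
  define A1 :: "polyC3 mat" where "A1 = mat 3 3 (\<lambda>(i, j). \<rho> (of_nat j) (of_nat i))"
  define A2 :: "polyC3 mat" where "A2 = mat 3 1 (\<lambda>(i, j). g (of_nat i))"
  have ds_pos: "0 < ds k" for k
  proof -
    have "\<forall>k. 0 < ds k" unfolding all_3 using assms by auto
    then show ?thesis by blast
  qed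
  have A0v: "A0 *\<^sub>v of3 w = vec 1 (\<lambda>_. der w f)" for w
    unfolding A0_def mat_mult_of3 by (simp add: der_def mult.commute)
  have A1v: "A1 *\<^sub>v of3 h = of3 (\<lambda>i. \<Sum>k\<in>UNIV. h k * \<rho> k i)" for h
    unfolding A1_def mat_mult_of3 by (simp add: of3_def mult.commute)
  have A2v: "A2 *\<^sub>v vec 1 (\<lambda>_. s) = of3 (\<lambda>k. s * g k)" for s
    unfolding A2_def mat_mult_of1 by (simp add: of3_def mult.commute)
  have vec1: "v = vec 1 (\<lambda>_. v $ 0)" if "v \<in> carrier_vec 1" for v :: "polyC3 vec"
    using that by (intro eq_vecI) auto
  \<comment> \<open>Generators of degree \<open>ds k\<close> are shifted by \<open>d - 1\<close>,
    the degree of the partial derivatives, and so is the relation of degree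
    \<open>e\<close>.\<close>
  let ?b = "[[0], replicate 3 (int d - 1), map (\<lambda>k. int d - 1 + int k) [ds 0, ds 1, ds 2],
    [e + int d - 1]]"
  have im0: "mat_image A0 = {vec 1 (\<lambda>_. p) | p. p \<in> jacobian_ideal f}"
  proof -
    have "mat_image A0 = {A0 *\<^sub>v of3 w | w. True}"
      unfolding mat_image_def by (auto simp: A0_def elim!: carrier_vec_3E)
    then show ?thesis by (auto simp: A0v jacobian_ideal_def der_def)
  qed
  have ker0: "mat_kernel A0 = mat_image A1"
  proof -
    have "mat_kernel A0 = {of3 w | w. der w f = 0}"
    proof -
      have "vec 1 (\<lambda>_. p) = 0\<^sub>v 1 \<longleftrightarrow> p = 0" for p :: polyC3
        by (auto simp: vec_eq_iff zero_vec_def)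
      then show ?thesis
        by (auto simp: mat_kernel_def A0v A0_def[THEN arg_cong, of dim_row]
            A0_def[THEN arg_cong, of dim_col] elim!: carrier_vec_3E)
    qed
    also have "\<dots> = {of3 (\<lambda>i. \<Sum>k\<in>UNIV. h k * \<rho> k i) | h. True}"
    proof -
      have "der (\<lambda>i. \<Sum>k\<in>UNIV. h k * \<rho> k i) f = (\<Sum>k\<in>UNIV. h k * der (\<rho> k) f)" for h
        by (simp add: der_def sum_UNIV_3 algebra_simps)
      then have 1: "der (\<lambda>i. \<Sum>k\<in>UNIV. h k * \<rho> k i) f = 0" for h by (simp add: der)
      have 2: "\<exists>h. w = (\<lambda>i. \<Sum>k\<in>UNIV. h k * \<rho> k i)" if "der w f = 0" for w
        using gen[OF that] by blast
      show ?thesis using 1 2 by blast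
    qed
    also have "\<dots> = mat_image A1"
    proof -
      have "mat_image A1 = {A1 *\<^sub>v of3 h | h. True}"
        unfolding mat_image_def by (auto simp: A1_def elim!: carrier_vec_3E)
      then show ?thesis by (simp add: A1v)
    qed
    finally show ?thesis .
  qed
  have ker1: "mat_kernel A1 = mat_image A2"
  proof -
    have "mat_kernel A1 = {of3 h | h. \<forall>i. (\<Sum>k\<in>UNIV. h k * \<rho> k i) = 0}"
      by (auto simp: mat_kernel_def A1v A1_def[THEN arg_cong, of dim_row] fun_eq_iff
            A1_def[THEN arg_cong, of dim_col] of3_eq_iff simp flip: of3_0 elim!: carrier_vec_3E)
    also have "\<dots> = {of3 (\<lambda>k. s * g k) | s. True}"
    proof -
      have 1: "(\<Sum>k\<in>UNIV. s * g k * \<rho> k i) = 0" for s i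
        using rel[of i] by (simp add: mult.assoc flip: sum_distrib_left)
      have 2: "\<exists>s. h = (\<lambda>k. s * g k)" if "\<forall>i. (\<Sum>k\<in>UNIV. h k * \<rho> k i) = 0" for h
        using uniq[OF that] by blast
      show ?thesis using 1 2 by blast
    qed
    also have "\<dots> = mat_image A2"
    proof -
      have dim: "dim_col A2 = 1" by (simp add: A2_def)
      have "\<exists>s. A2 *\<^sub>v v = A2 *\<^sub>v vec 1 (\<lambda>_. s)" if "v \<in> carrier_vec 1" for v
        using arg_cong[OF vec1[OF that], of "(*\<^sub>v) A2"] by blast
      moreover have "vec 1 (\<lambda>_. s) \<in> carrier_vec 1" for s :: polyC3 by simp
      ultimately have "mat_image A2 = {A2 *\<^sub>v vec 1 (\<lambda>_. s) | s. True}"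
        unfolding mat_image_def dim by blast
      then show ?thesis by (simp only: A2v)
    qed
    finally show ?thesis .
  qed
  have ker2: "mat_kernel A2 = {0\<^sub>v (dim_col A2)}"
  proof -
    have "v = 0\<^sub>v 1" if v: "v \<in> carrier_vec 1" "A2 *\<^sub>v v = 0\<^sub>v 3" for v
    proof -
      have "of3 (\<lambda>k. v $ 0 * g k) = of3 (\<lambda>_. 0)"
        using v(2) vec1[OF v(1)] A2v[of "v $ 0"] by (simp add: of3_0)
      then have "v $ 0 = 0" using g(3) by (metis of3_eq_iff mult_eq_0_iff)
      then show ?thesis using v(1) by (intro eq_vecI) auto
    qed
    moreover have "A2 *\<^sub>v 0\<^sub>v 1 = 0\<^sub>v 3"
      by (intro eq_vecI) (simp_all add: A2_def scalar_prod_def)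
    ultimately show ?thesis
      by (auto simp: mat_kernel_def A2_def[THEN arg_cong, of dim_row] A2_def[THEN arg_cong, of dim_col])
  qed
  have maps: "\<forall>k<3. graded_map (?b ! k) (?b ! Suc k) ([A0, A1, A2] ! k)"
  proof -
    have "homogeneous (int d - 1) (pdiff i f)" for i using homf by (rule homogeneous_pdiff)
    then have "graded_map [0] (replicate 3 (int d - 1)) A0"
      by (simp add: graded_map_def A0_def less_3_iff)
    moreover have "graded_map (replicate 3 (int d - 1)) (map (\<lambda>k. int d - 1 + int k) [ds 0, ds 1, ds 2]) A1"
      using hom by (auto simp: graded_map_def A1_def less_3_iff numeral_3_eq_3[symmetric]) 
    moreover have "graded_map (map (\<lambda>k. int d - 1 + int k) [ds 0, ds 1, ds 2]) [e + int d - 1] A2"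
      using g(1)[of 0] g(1)[of 1] g(1)[of 2]
      by (auto simp: graded_map_def A2_def less_3_iff numeral_3_eq_3[symmetric])
    ultimately show ?thesis unfolding all_nat_less_3 by simp
  qed
  have min: "\<forall>k<3. minimal_map ([A0, A1, A2] ! k)"
  proof -
    have "minimal_map A0"
      using homogeneous_lookup_0[OF homogeneous_pdiff[OF homf]] assms(3)
      by (simp add: minimal_map_def A0_def)
    moreover have "minimal_map A1"
      using homogeneous_lookup_0[OF hom] ds_pos by (simp add: minimal_map_def A1_def)
    moreover have "minimal_map A2"
    proof -
      have "Poly_Mapping.lookup (g k) 0 = 0" for k
        using homogeneous_lookup_0[OF g(1)[of k]] g(2)[of k] by simp
      then show ?thesis by (simp add: minimal_map_def A2_def)
    qed
    ultimately show ?thesis unfolding all_nat_less_3 by simp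
  qed
  have "minimal_graded_free_resolution (jacobian_ideal f) ?b [A0, A1, A2]"
    unfolding minimal_graded_free_resolution_def
    using im0 ker0 ker1 ker2 maps min by (auto simp: numeral_3_eq_3 less_Suc_eq)
  then have "\<exists>es A. sorted es \<and> length es + 2 = length [ds 0, ds 1, ds 2] \<and>
        minimal_graded_free_resolution (jacobian_ideal f)
          [[0], replicate 3 (int d - 1), map (\<lambda>k. int d - 1 + int k) [ds 0, ds 1, ds 2], es] A"
    by (intro exI[of _ "[e + int d - 1]"] exI[of _ "[A0, A1, A2]"]) simp
  then show ?thesis
    unfolding syzygy_curve_def using assms by auto
qed

section \<open>Reflections and equivariant vector fields\<close>

section \<open>Invariant vector fields\<close>

definition mdet :: "'a mat3 \<Rightarrow> 'a::comm_ring_1" where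
  "mdet A = det3 (A 0) (A 1) (A 2)"

text \<open>Indices are taken modulo 3.\<close>

definition adj3 :: "'a mat3 \<Rightarrow> 'a::comm_ring_1 mat3" where
  "adj3 A i j = A (j + 1) (i + 1) * A (j + 2) (i + 2) - A (j + 1) (i + 2) * A (j + 2) (i + 1)"

lemma mod_3_numerals [simp]: "(3 :: 3) = 0" "(4 :: 3) = 1"
  by simp_all

lemma mmul_adj3: "mmul A (adj3 A) i j = (if i = j then mdet A else 0)"
proof -
  have "\<forall>i j. mmul A (adj3 A) i j = (if i = j then mdet A else 0)"
    unfolding all_3 by (simp add: mmul_def adj3_def sum_UNIV_3 mdet_def det3_def algebra_simps)
  then show ?thesis by blast
qed

lemma adj3_mmul: "adj3 (mmul A B) = mmul (adj3 B) (adj3 A)"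
  unfolding fun_eq_3 by (simp add: mmul_def adj3_def sum_UNIV_3 algebra_simps)

lemma adj3_tr3: "adj3 (tr3 A) = tr3 (adj3 A)"
  by (intro ext) (simp add: adj3_def tr3_def algebra_simps)

lemma mdet_mmul: "mdet (mmul A B) = mdet A * mdet B"
  by (simp add: mmul_def mdet_def det3_def sum_UNIV_3 algebra_simps)

lemma mdet_tr3: "mdet (tr3 A) = mdet A"
  by (simp add: mdet_def det3_def tr3_def algebra_simps)

lemma mdet_one3 [simp]: "mdet one3 = 1"
  by (simp add: mdet_def det3_def one3_def)

definition grad :: "polyC3 \<Rightarrow> 3 \<Rightarrow> polyC3" where
  "grad p i = pdiff i p"

definition hess :: "polyC3 \<Rightarrow> polyC3 mat3" where
  "hess p i j = pdiff i (pdiff j p)"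

text \<open>The gradient is a covector; the adjugate of the Hessian, a quadratic form on covectors,
  converts it into a vector.\<close>

definition covariant :: "polyC3 \<Rightarrow> polyC3 \<Rightarrow> 3 \<Rightarrow> polyC3" where
  "covariant p q = mvmul (adj3 (hess p)) (grad q)"

lemma grad_invariant:
  assumes "lsub R p = p"
  shows "grad p = mvmul (tr3 (cmat R)) (\<lambda>i. lsub R (grad p i))"
proof
  fix j
  show "grad p j = mvmul (tr3 (cmat R)) (\<lambda>i. lsub R (grad p i)) j"
    using pdiff_lsub[of j R p] by (simp add: assms grad_def mvmul_def tr3_def mult.commute)
qed

lemma hess_invariant:
  assumes "lsub R p = p"
  shows "hess p = mmul (tr3 (cmat R)) (mmul (\<lambda>i j. lsub R (hess p i j)) (cmat R))"
proof (intro ext)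
  fix i j
  have "hess p i j = pdiff i (\<Sum>k\<in>UNIV. lsub R (pdiff k p) * cst (R k j))"
    using pdiff_lsub[of j R p] by (simp add: assms hess_def)
  also have "\<dots> = (\<Sum>k\<in>UNIV. (\<Sum>l\<in>UNIV. lsub R (pdiff l (pdiff k p)) * cst (R l i)) * cst (R k j))"
    by (simp add: pdiff_sum pdiff_mult pdiff_lsub)
  also have "\<dots> = mmul (tr3 (cmat R)) (mmul (\<lambda>i j. lsub R (hess p i j)) (cmat R)) i j"
    by (simp add: mmul_def tr3_def hess_def sum_UNIV_3 algebra_simps)
  finally show "hess p i j = mmul (tr3 (cmat R)) (mmul (\<lambda>i j. lsub R (hess p i j)) (cmat R)) i j" .
qed

lemma mdet_cmat: "mdet (cmat R) = cst (mdet R)"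
  by (simp add: mdet_def det3_def cst_add cst_diff cst_mult)

lemma mdet_lsub: "mdet (\<lambda>i j. lsub R (A i j)) = lsub R (mdet A)"
  by (simp add: mdet_def det3_def lsub_hom)

lemma adj3_lsub: "adj3 (\<lambda>i j. lsub R (A i j)) = (\<lambda>i j. lsub R (adj3 A i j))"
  by (intro ext) (simp add: adj3_def lsub_hom)

lemma mdet_sqr:
  assumes "mmul R R = one3"
  shows "mdet R * mdet R = 1"
  using mdet_mmul[of R R] by (simp add: assms)

text \<open>The Hessian is multiplied by \<open>R\<close> and its transpose, so its determinant
  picks up the square of \<open>mdet R\<close>, which is 1 for an involution.\<close>

lemma hess_det_invariant:
  assumes "mmul R R = one3" "lsub R p = p"
  shows "lsub R (mdet (hess p)) = mdet (hess p)"
proof -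
  have "mdet (hess p) = mdet (cmat R) * (mdet (\<lambda>i j. lsub R (hess p i j)) * mdet (cmat R))"
    by (subst hess_invariant[OF assms(2)]) (simp add: mdet_mmul mdet_tr3)
  also have "\<dots> = cst (mdet R * mdet R) * lsub R (mdet (hess p))"
    by (simp only: mdet_cmat mdet_lsub cst_mult ac_simps)
  finally show ?thesis by (simp add: mdet_sqr[OF assms(1)])
qed

lemma mmul_adj3_cmat: "mmul (cmat R) (adj3 (cmat R)) = (\<lambda>i j. cst (mdet R) * one3 i j)"
  by (intro ext) (simp add: mmul_adj3 mdet_cmat one3_def)

lemma mmul_scalar: "mmul (\<lambda>i j. c * one3 i j) A = (\<lambda>i j. c * A i j)"
  "mmul A (\<lambda>i j. c * one3 i j) = (\<lambda>i j. c * A i j)"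
  by (simp_all add: fun_eq_3 mmul_def sum_UNIV_3 one3_def)

text \<open>Passing to adjugates inverts \<open>R\<close> up to the factor \<open>mdet R\<close>;
  this factor occurs twice and disappears.\<close>

lemma adj3_hess_invariant:
  assumes "mmul R R = one3" "lsub R p = p"
  shows "mmul (cmat R) (mmul (adj3 (hess p)) (tr3 (cmat R))) = (\<lambda>i j. lsub R (adj3 (hess p) i j))"
proof -
  let ?R = "cmat R" and ?S = "\<lambda>i j. lsub R (adj3 (hess p) i j)"
  have eq: "adj3 (hess p) = mmul (mmul (adj3 ?R) ?S) (tr3 (adj3 ?R))"
    by (subst hess_invariant[OF assms(2)]) (simp add: adj3_mmul adj3_tr3 adj3_lsub)
  have "mmul ?R (mmul (adj3 (hess p)) (tr3 ?R))
      = mmul (mmul ?R (adj3 ?R)) (mmul ?S (tr3 (mmul ?R (adj3 ?R))))"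
    by (subst eq) (simp add: mmul_assoc tr3_mmul)
  also have "\<dots> = (\<lambda>i j. cst (mdet R) * (cst (mdet R) * ?S i j))"
  proof -
    have "tr3 (\<lambda>i j. cst (mdet R) * one3 i j) = (\<lambda>i j. cst (mdet R) * one3 i j)"
      by (intro ext) (simp add: tr3_def one3_def)
    then show ?thesis by (simp add: mmul_adj3_cmat mmul_scalar)
  qed
  also have "\<dots> = (\<lambda>i j. cst (mdet R * mdet R) * ?S i j)"
    by (simp only: cst_mult mult.assoc)
  finally show ?thesis by (simp add: mdet_sqr[OF assms(1)])
qed

text \<open>The transposed \<open>R\<close> on the right of the adjugate turns the substituted
  gradient back into the gradient, leaving a single \<open>R\<close> in front.\<close>

lemma covariant_equivariant:
  assumes "mmul R R = one3" "lsub R p = p" "lsub R q = q"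
  shows "lsub R (covariant p q i) = mvmul (cmat R) (covariant p q) i"
proof -
  have "lsub R (covariant p q i) = mvmul (\<lambda>i j. lsub R (adj3 (hess p) i j)) (\<lambda>i. lsub R (grad q i)) i"
    by (simp add: covariant_def mvmul_def lsub_hom)
  also have "\<dots> = mvmul (cmat R) (mvmul (adj3 (hess p))
      (mvmul (tr3 (cmat R)) (\<lambda>i. lsub R (grad q i)))) i"
    by (simp only: mvmul_mmul flip: adj3_hess_invariant[OF assms(1,2)])
  also have "\<dots> = mvmul (cmat R) (covariant p q) i"
    by (simp add: covariant_def flip: grad_invariant[OF assms(3)])
  finally show ?thesis .
qed

text \<open>The map x \<mapsto> x - 2 a(x) v, a reflection with mirror a = 0 when a(v) = 1.\<close>

definition reflection :: "(3 \<Rightarrow> complex) \<Rightarrow> (3 \<Rightarrow> complex) \<Rightarrow> complex mat3" where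
  "reflection a v i j = one3 i j - 2 * v i * a j"

lemma reflection_involution:
  assumes "(\<Sum>i\<in>UNIV. a i * v i) = 1"
  shows "mmul (reflection a v) (reflection a v) = one3"
proof (intro ext)
  fix i j
  have "mmul (reflection a v) (reflection a v) i j
      = mmul one3 one3 i j - 2 * mvmul one3 v i * a j - 2 * v i * mvmul (tr3 one3) a j
        + 4 * (\<Sum>k\<in>UNIV. a k * v k) * v i * a j"
    by (simp add: mmul_def mvmul_def reflection_def sum_UNIV_3 tr3_def algebra_simps del: tr3_one3 mmul_one3 mvmul_one3)
  then show "mmul (reflection a v) (reflection a v) i j = one3 i j"
    by (simp add: assms)
qed

lemma subst_proj_lsub_reflection:
  assumes "(\<Sum>i\<in>UNIV. a i * v i) = 1"
  shows "subst (proj a v) (lsub (reflection a v) p) = subst (proj a v) p"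
proof -
  have 1: "mvmul (cmat (reflection a v)) var i = var i - cst (2 * v i) * lf a" for i
  proof -
    have "mvmul (cmat (reflection a v)) var i
        = mvmul (cmat one3) var i - cst (2 * v i) * lf a"
      by (simp add: mvmul_def reflection_def lf_def cst_diff cst_mult sum_UNIV_3 algebra_simps)
    moreover have "cmat one3 = one3" by (intro ext) (simp add: one3_def)
    ultimately show ?thesis by simp
  qed
  have "subst (proj a v) (var i - cst (2 * v i) * lf a) = proj a v i" for i
    using subst_proj_lf[OF assms] by (simp add: subst_simps)
  then show ?thesis by (simp add: lsub_def subst_subst 1)
qed

text \<open>The form of the mirror is a left eigenvector for -1 (\<open>aR\<close>), while
  restriction to the mirror forgets the reflection by \<open>subst_proj_lsub_reflection\<close>; so
  the restricted value equals its own negative.\<close>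

lemma equivariant_tangent:
  assumes "(\<Sum>i\<in>UNIV. a i * v i) = 1"
    and "\<And>i. lsub (reflection a v) (\<theta> i) = mvmul (cmat (reflection a v)) \<theta> i"
  shows "lf a dvd der \<theta> (lf a)"
proof -
  let ?R = "reflection a v"
  have aR: "(\<Sum>i\<in>UNIV. a i * ?R i j) = - a j" for j
  proof -
    have "(\<Sum>i\<in>UNIV. a i * ?R i j) = mvmul (tr3 one3) a j - 2 * (\<Sum>i\<in>UNIV. a i * v i) * a j"
      by (simp add: mvmul_def reflection_def sum_UNIV_3 tr3_def algebra_simps del: tr3_one3 mmul_one3 mvmul_one3)
    then show ?thesis by (simp add: assms(1))
  qed
  have "lsub ?R (der \<theta> (lf a)) = (\<Sum>i\<in>UNIV. cst (a i) * mvmul (cmat ?R) \<theta> i)"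
    by (simp add: der_lf lsub_hom assms(2))
  also have "\<dots> = (\<Sum>j\<in>UNIV. cst (\<Sum>i\<in>UNIV. a i * ?R i j) * \<theta> j)"
    by (simp add: mvmul_def cst_mult cst_add sum_UNIV_3 algebra_simps)
  also have "\<dots> = - der \<theta> (lf a)"
    unfolding aR der_lf by (simp add: cst_uminus sum_negf)
  finally have "subst (proj a v) (der \<theta> (lf a)) = - subst (proj a v) (der \<theta> (lf a))"
    using subst_proj_lsub_reflection[OF assms(1), of "der \<theta> (lf a)"] by (simp add: subst_simps)
  then show ?thesis by (simp add: lf_dvd_iff[OF assms(1)])
qed

definition mirror :: "polyC3 \<Rightarrow> (3 \<Rightarrow> complex) \<Rightarrow> bool" where
  "mirror p a \<longleftrightarrow> (\<exists>v. (\<Sum>i\<in>UNIV. a i * v i) = 1 \<and> lsub (reflection a v) p = p)"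

lemma mirror_tangent:
  assumes "mirror p a"
  shows "lf a dvd der (covariant p (mdet (hess p))) (lf a)"
    and "lf a dvd der (covariant (mdet (hess p)) p) (lf a)"
proof -
  obtain v where v: "(\<Sum>i\<in>UNIV. a i * v i) = 1" and inv: "lsub (reflection a v) p = p"
    using assms by (auto simp: mirror_def)
  have R: "mmul (reflection a v) (reflection a v) = one3" by (rule reflection_involution[OF v])
  have inv': "lsub (reflection a v) (mdet (hess p)) = mdet (hess p)"
    by (rule hess_det_invariant[OF R inv])
  show "lf a dvd der (covariant p (mdet (hess p))) (lf a)"
    by (rule equivariant_tangent[OF v covariant_equivariant[OF R inv inv']])
  show "lf a dvd der (covariant (mdet (hess p)) p) (lf a)"
    by (rule equivariant_tangent[OF v covariant_equivariant[OF R inv' inv]])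
qed

lemma mirror_scale:
  assumes "mirror p a" "c \<noteq> 0"
  shows "mirror p (\<lambda>i. c * a i)"
proof -
  obtain v where v: "(\<Sum>i\<in>UNIV. a i * v i) = 1" and inv: "lsub (reflection a v) p = p"
    using assms by (auto simp: mirror_def)
  have "reflection (\<lambda>i. c * a i) (\<lambda>i. v i / c) = reflection a v"
    using assms(2) by (intro ext) (simp add: reflection_def)
  moreover have "(\<Sum>i\<in>UNIV. c * a i * (v i / c)) = 1" using v assms(2) by simp
  ultimately show ?thesis using inv by (auto simp: mirror_def intro!: exI[of _ "\<lambda>i. v i / c"])
qed

text \<open>Directions move by \<open>M\<close>, covectors by the transposed inverse. Mirrors are
  propagated by this rule both for the sextic and for the group.\<close>

lemma reflection_conjugate:
  assumes "mmul M N = one3"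
  shows "reflection (mvmul (tr3 N) a) (mvmul M v) = mmul M (mmul (reflection a v) N)"
proof (intro ext)
  fix i j
  have "mmul M (mmul (reflection a v) N) i j
      = mmul M (mmul one3 N) i j - 2 * mvmul M v i * mvmul (tr3 N) a j"
    by (simp add: mmul_def mvmul_def reflection_def tr3_def sum_UNIV_3 algebra_simps
        del: mmul_one3 mvmul_one3)
  then show "reflection (mvmul (tr3 N) a) (mvmul M v) i j = mmul M (mmul (reflection a v) N) i j"
    by (simp add: reflection_def assms)
qed

lemma dual_conjugate:
  assumes "mmul N M = one3"
  shows "(\<Sum>i\<in>UNIV. mvmul (tr3 N) a i * mvmul M v i) = (\<Sum>i\<in>UNIV. a i * v i :: complex)"
proof -
  have "(\<Sum>i\<in>UNIV. mvmul (tr3 N) a i * mvmul M v i) = (\<Sum>i\<in>UNIV. a i * mvmul (mmul N M) v i)"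
    by (simp add: mvmul_def tr3_def mmul_def sum_UNIV_3 algebra_simps)
  then show ?thesis by (simp add: assms)
qed

lemma mirror_conjugate:
  assumes "mirror p a" "mmul M M = one3" "lsub M p = p"
  shows "mirror p (mvmul (tr3 M) a)"
proof -
  obtain v where v: "(\<Sum>i\<in>UNIV. a i * v i) = 1" and inv: "lsub (reflection a v) p = p"
    using assms by (auto simp: mirror_def)
  have "lsub (mmul M (mmul (reflection a v) M)) p = p"
    using inv assms(3) by (simp flip: lsub_lsub)
  moreover have "(\<Sum>i\<in>UNIV. mvmul (tr3 M) a i * mvmul M v i) = 1"
    using v by (simp add: dual_conjugate[OF assms(2)])
  ultimately show ?thesis unfolding mirror_def reflection_conjugate[OF assms(2), symmetric] by blast
qed

lemma homogeneous_adj3: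
  assumes "\<And>i j. homogeneous k (A i j)"
  shows "homogeneous (k + k) (adj3 A i j)"
  unfolding adj3_def by (intro homogeneous_diff homogeneous_mult assms)

lemma homogeneous_covariant:
  assumes "homogeneous k p" "homogeneous n q"
  shows "homogeneous (2 * k + n - 5) (covariant p q i)"
proof -
  have "homogeneous ((k - 1 - 1) + (k - 1 - 1) + (n - 1)) (covariant p q i)"
    unfolding covariant_def mvmul_def hess_def[abs_def] grad_def
    by (intro homogeneous_sum homogeneous_mult homogeneous_adj3 homogeneous_pdiff assms)
  then show ?thesis by (simp add: algebra_simps)
qed

lemma homogeneous_hess_det:
  assumes "homogeneous k p"
  shows "homogeneous (3 * k - 6) (mdet (hess p))"
proof -
  have "homogeneous ((k - 1 - 1) + (k - 1 - 1) + (k - 1 - 1)) (mdet (hess p))"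
    unfolding mdet_def hess_def[abs_def] by (intro homogeneous_det3 homogeneous_pdiff assms)
  then show ?thesis by (simp add: algebra_simps)
qed

section \<open>Wiman's sextic, its 45 mirrors and the two vector fields\<close>

section \<open>Wiman's sextic and its Hessian\<close>

text \<open>The sextic as a symmetric cubic in the squares of the coordinates, which makes
  permutations and sign changes evident symmetries. The ring is generic because the coefficients
  become constant polynomials.\<close>

definition wim :: "'a::comm_ring_1 \<Rightarrow> 'a \<Rightarrow> 'a \<Rightarrow> 'a \<Rightarrow> 'a" where
  "wim r x y z = 4 * (x * x * x + y * y * y + z * z * z)
    + (3 * r - 15) * (x * x * y + x * x * z + y * y * x + y * y * z + z * z * x + z * z * y)
    + (60 + 12 * r) * (x * y * z)"

text \<open>After the substitution \<open>a = x\<^sup>2, b = \<omega>\<^sup>2 y\<^sup>2, c = \<omega> z\<^sup>2\<close> the sextic is a combination of the cube of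
  the icosahedral conic and of the product of the six axes of the icosahedron.\<close>

lemma wim_icosahedral:
  fixes t w a b c :: "'a::comm_ring_1"
  assumes t: "t * t = t + 1" and w: "w * w = - w - 1"
  shows "wim ((2 * t - 1) * (2 * w + 1)) a (w * b) (w * w * c)
    = 4 * ((a + b + c) * (a + b + c) * (a + b + c))
      + (6 * (t - 1) + (42 - 24 * t) * w) * ((t * t * a - b) * (t * t * b - c) * (t * t * c - a))"
proof -
  define r where "r = (2 * t - 1) * (2 * w + 1)"
  define B where "B = 6 * (t - 1) + (42 - 24 * t) * w"
  define T where "T = t * t"
  \<comment> \<open>Together with \<open>t\<close>, \<open>w\<close> and \<open>ww\<close> this
    reduces powers inside right-nested products, so that ring normalization decides identities in t
    and w.\<close>
  have tt: "t * (t * x) = t * x + x" for x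
    using t by (metis distrib_right mult.assoc mult_1)
  have ww: "w * (w * x) = - (w * x) - x" for x
    using w by (metis left_diff_distrib mult.assoc mult_1 mult_minus_left)
  have www: "w * w * w = 1"
    by (simp add: algebra_simps w ww)
  \<comment> \<open>Comparison of coefficients with the icosahedral expression, for the monomials of
    type a^2 b, a^2 c and abc.\<close>
  have k1: "(3 * r - 15) * w = 12 - B * T * T"
    unfolding r_def B_def T_def by (simp add: algebra_simps t w tt ww)
  have k2: "(3 * r - 15) * (w * w) = 12 + B * T"
    unfolding r_def B_def T_def by (simp add: algebra_simps t w tt ww)
  have k3: "60 + 12 * r = 24 + B * (T * T * T - 1)"
    unfolding r_def B_def T_def by (simp add: algebra_simps t w tt ww)
  have "wim r a (w * b) (w * w * c)
    = 4 * (a * a * a + (w * w * w) * b * b * b + (w * w * w) * (w * w * w) * c * c * c)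
      + ((3 * r - 15) * w) * (a * a * b + (w * w * w) * b * b * c + (w * w * w) * c * c * a)
      + ((3 * r - 15) * (w * w)) * (a * a * c + b * b * a + (w * w * w) * c * c * b)
      + (60 + 12 * r) * ((w * w * w) * a * b * c)"
    by (simp add: wim_def algebra_simps)
  also have "\<dots> = 4 * ((a + b + c) * (a + b + c) * (a + b + c))
      + B * ((T * a - b) * (T * b - c) * (T * c - a))"
    unfolding k1 k2 k3 www by (simp add: algebra_simps)
  finally show ?thesis by (simp add: B_def T_def r_def)
qed

text \<open>Half of the primed coordinates is a reflection of the icosahedral group. Every factor of
  the product splits into two linear forms, and the reflection permutes the six forms up to sign; 64
  is the sixth power of 2.\<close>

lemma icosahedral_invariant:
  fixes t x y z :: "'a::comm_ring_1"
  assumes t: "t * t = t + 1"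
  defines "x' \<equiv> x - t * y + (t - 1) * z" and "y' \<equiv> z - t * x - (t - 1) * y"
    and "z' \<equiv> (t - 1) * x + y + t * z"
  shows "x' * x' + y' * y' + z' * z' = 4 * (x * x + y * y + z * z)"
    and "(t * t * (x' * x') - y' * y') * (t * t * (y' * y') - z' * z') * (t * t * (z' * z') - x' * x')
      = 64 * ((t * t * (x * x) - y * y) * (t * t * (y * y) - z * z) * (t * t * (z * z) - x * x))"
proof -
  have tt: "t * (t * x) = t * x + x" for x
    using t by (metis distrib_right mult.assoc mult_1)
  show "x' * x' + y' * y' + z' * z' = 4 * (x * x + y * y + z * z)"
    unfolding x'_def y'_def z'_def by (simp add: algebra_simps t tt)
  have *: "t * t * (u * u) - v * v = (t * u + v) * (t * u - v)" for u v
    by (simp add: algebra_simps)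
  have "t * x' + y' = - 2 * (t * y - z)" "t * x' - y' = 2 * (t * x - y)"
    "t * y' + z' = 2 * (t * z - x)" "t * y' - z' = - 2 * (t * x + y)"
    "t * z' + x' = 2 * (t * z + x)" "t * z' - x' = 2 * (t * y + z)"
    unfolding x'_def y'_def z'_def by (simp_all add: algebra_simps t tt)
  then have "(t * t * (x' * x') - y' * y') * (t * t * (y' * y') - z' * z') * (t * t * (z' * z') - x' * x')
      = ((- 2 * (t * y - z)) * (2 * (t * x - y))) * ((2 * (t * z - x)) * (- 2 * (t * x + y)))
        * ((2 * (t * z + x)) * (2 * (t * y + z)))"
    by (simp only: *)
  also have "\<dots> = 64 * (((t * x + y) * (t * x - y)) * ((t * y + z) * (t * y - z)) * ((t * z + x) * (t * z - x)))"
  proof -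
    have "((- 2 * p1) * (2 * p2)) * ((2 * p3) * (- 2 * p4)) * ((2 * p5) * (2 * p6))
        = 64 * ((p4 * p2) * (p6 * p1) * (p5 * p3))" for p1 p2 p3 p4 p5 p6 :: 'a
      by (simp add: ac_simps)
    then show ?thesis by blast
  qed
  finally show "(t * t * (x' * x') - y' * y') * (t * t * (y' * y') - z' * z') * (t * t * (z' * z') - x' * x')
      = 64 * ((t * t * (x * x) - y * y) * (t * t * (y * y) - z * z) * (t * t * (z * z) - x * x))"
    by (simp only: *)
qed

text \<open>Monomials in this shape are closed under differentiation up to constants, so that
  derivatives of order four are computed by rewriting.\<close>

definition mono :: "nat \<Rightarrow> nat \<Rightarrow> nat \<Rightarrow> polyC3" where
  "mono a b c = X0 ^ a * X1 ^ b * X2 ^ c"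

lemma pdiff_mono:
  "pdiff 0 (mono a b c) = cst (of_nat a) * mono (a - 1) b c"
  "pdiff 1 (mono a b c) = cst (of_nat b) * mono a (b - 1) c"
  "pdiff 2 (mono a b c) = cst (of_nat c) * mono a b (c - 1)"
  by (simp_all add: mono_def pdiff_mult pdiff_power pdiff_var)

lemma pdiff_cst_mult: "pdiff i (cst c * p) = cst c * pdiff i p"
  by (simp add: pdiff_mult)

lemma pdiff_sorted:
  "pdiff 1 (pdiff 0 p) = pdiff 0 (pdiff 1 p)" "pdiff 2 (pdiff 0 p) = pdiff 0 (pdiff 2 p)"
  "pdiff 2 (pdiff 1 p) = pdiff 1 (pdiff 2 p)"
  by (rule pdiff_commute)+

lemma homogeneous_mono: "int a + int b + int c = k \<Longrightarrow> homogeneous k (mono a b c)"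
  unfolding mono_def
  using homogeneous_mult[OF homogeneous_mult[OF homogeneous_power[OF homogeneous_var]
      homogeneous_power[OF homogeneous_var]] homogeneous_power[OF homogeneous_var]]
  by auto

lemma mvmul_tr3_vec3: "mvmul (tr3 (vec3 (vec3 a b c) (vec3 d e f) (vec3 g h i))) (vec3 x y z)
    = vec3 (a * x + d * y + g * z) (b * x + e * y + h * z) (c * x + f * y + i * (z :: complex))"
  by (simp add: fun_eq_3 mvmul_def tr3_def sum_UNIV_3)

lemma mmul_vec3: "mmul (vec3 (vec3 a b c) (vec3 d e f) (vec3 g h i)) (vec3 (vec3 a' b' c') (vec3 d' e' f') (vec3 g' h' i'))
    = vec3 (vec3 (a * a' + b * d' + c * g') (a * b' + b * e' + c * h') (a * c' + b * f' + c * i'))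
      (vec3 (d * a' + e * d' + f * g') (d * b' + e * e' + f * h') (d * c' + e * f' + f * i'))
      (vec3 (g * a' + h * d' + i * g') (g * b' + h * e' + i * h') (g * c' + h * f' + i * (i' :: complex)))"
  by (simp add: fun_eq_3 mmul_def sum_UNIV_3)

lemma one3_vec3: "one3 = vec3 (vec3 1 0 0) (vec3 0 1 0) (vec3 0 0 1)"
  by (simp add: fun_eq_3 one3_def)

lemma lsub_vec3: "lsub (vec3 (vec3 a b c) (vec3 d e f) (vec3 g h i)) X0 = cst a * X0 + cst b * X1 + cst c * X2"
  "lsub (vec3 (vec3 a b c) (vec3 d e f) (vec3 g h i)) X1 = cst d * X0 + cst e * X1 + cst f * X2"
  "lsub (vec3 (vec3 a b c) (vec3 d e f) (vec3 g h i)) X2 = cst g * X0 + cst h * X1 + cst i * X2"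
  by (simp_all add: lsub_hom mvmul_def sum_UNIV_3)

text \<open>\<open>t\<close> is a golden ratio and \<open>w\<close> a primitive cube root of unity. Both choices of each occur, since
  the embedding of the alternating group is unique only up to automorphisms.\<close>

locale golden =
  fixes t w :: complex
  assumes t: "t * t = t + 1" and w: "w * w = - w - 1"
begin

text \<open>A square root of -15, see \<open>rr\<close>; the sextic depends on t and w through it
  alone.\<close>

definition r :: complex where "r = (2 * t - 1) * (2 * w + 1)"

definition WF :: polyC3 where
  "WF = cst 4 * (mono 6 0 0 + mono 0 6 0 + mono 0 0 6)
    + cst (3 * r - 15) * (mono 4 2 0 + mono 4 0 2 + mono 2 4 0 + mono 0 4 2 + mono 2 0 4 + mono 0 2 4)
    + cst (60 + 12 * r) * mono 2 2 2"

definition WG :: polyC3 where "WG = mdet (hess WF)"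

lemma tt: "t * (t * x) = t * x + x"
  using t by (metis distrib_right mult.assoc mult_1)

lemma ww: "w * (w * x) = - (w * x) - x"
  using w by (metis left_diff_distrib mult.assoc mult_1 mult_minus_left)

lemma rr: "r * r = - 15"
  unfolding r_def by (simp add: algebra_simps t w tt ww)

lemma homogeneous_WF: "homogeneous 6 WF"
  unfolding WF_def by (intro homogeneous_add homogeneous_cst_mult homogeneous_mono) simp_all

lemma homogeneous_WG: "homogeneous 12 WG"
  using homogeneous_hess_det[OF homogeneous_WF] by (simp add: WG_def)

lemma lsub_numeral: "lsub T (numeral n) = numeral n"
  by (simp add: lsub_def subst_simps)

subsection \<open>The sextic has 45 mirrors\<close>

lemma lsub_WF: "lsub T WF = wim (cst r) (lsub T X0 * lsub T X0) (lsub T X1 * lsub T X1) (lsub T X2 * lsub T X2)"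
  by (simp add: WF_def mono_def wim_def lsub_hom lsub_numeral cst_add cst_diff cst_mult power_numeral_reduce ac_simps)

lemma WF_wim: "WF = wim (cst r) (X0 * X0) (X1 * X1) (X2 * X2)"
proof -
  have "lsub one3 (var i) = var i" for i by simp
  then show ?thesis using lsub_WF[of one3] by simp
qed

definition mir :: "complex \<Rightarrow> complex \<Rightarrow> complex \<Rightarrow> bool" where
  "mir a b c = mirror WF (vec3 a b c)"

lemma wim_swap: "wim x b a c = wim x a b c" "wim x a c b = wim x a b c"
  by (simp_all add: wim_def algebra_simps)

text \<open>Symmetries of the sextic permute its mirrors, so a few mirrors produce all others by
  sign changes, permutations and one further reflection.\<close>

lemma mir_conjugate:
  assumes "mir a b c" "mmul M M = one3" "lsub M WF = WF" "mvmul (tr3 M) (vec3 a b c) = vec3 a' b' c'"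
  shows "mir a' b' c'"
  using mirror_conjugate[of WF "vec3 a b c" M] assms by (simp add: mir_def)

lemma mir_neg0: "mir a b c \<Longrightarrow> mir (- a) b c"
  by (erule mir_conjugate[where M = "vec3 (vec3 (-1) 0 0) (vec3 0 1 0) (vec3 0 0 1)"],
      simp add: mmul_vec3 one3_vec3, subst lsub_WF, subst WF_wim,
      simp add: lsub_vec3 cst_uminus, simp add: mvmul_tr3_vec3)

lemma mir_swap01: "mir a b c \<Longrightarrow> mir b a c"
  by (erule mir_conjugate[where M = "vec3 (vec3 0 1 0) (vec3 1 0 0) (vec3 0 0 1)"],
      simp add: mmul_vec3 one3_vec3, subst lsub_WF, subst WF_wim,
      simp add: lsub_vec3 wim_swap, simp add: mvmul_tr3_vec3)

lemma mir_swap12: "mir a b c \<Longrightarrow> mir a c b"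
  by (erule mir_conjugate[where M = "vec3 (vec3 1 0 0) (vec3 0 0 1) (vec3 0 1 0)"],
      simp add: mmul_vec3 one3_vec3, subst lsub_WF, subst WF_wim,
      simp add: lsub_vec3 wim_swap, simp add: mvmul_tr3_vec3)

lemma mir_swap02: "mir a b c \<Longrightarrow> mir c b a"
  by (blast intro: mir_swap01 mir_swap12)

lemma mir_neg2: "mir a b c \<Longrightarrow> mir a b (- c)"
  by (blast intro: mir_swap02 mir_neg0)

lemma mir_scale: "mir a b c \<Longrightarrow> s \<noteq> 0 \<Longrightarrow> mir (s * a) (s * b) (s * c)"
  using mirror_scale[of WF "vec3 a b c" s] vec3_eta[of "\<lambda>i. s * vec3 a b c i"] by (simp add: mir_def)

lemma mirI:
  assumes "a * x + b * y + c * z = 1"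
    and "lsub (vec3 (vec3 (1 - 2 * x * a) (- 2 * x * b) (- 2 * x * c))
        (vec3 (- 2 * y * a) (1 - 2 * y * b) (- 2 * y * c))
        (vec3 (- 2 * z * a) (- 2 * z * b) (1 - 2 * z * c))) WF = WF"
  shows "mir a b c"
proof -
  have "reflection (vec3 a b c) (vec3 x y z) = vec3 (vec3 (1 - 2 * x * a) (- 2 * x * b) (- 2 * x * c))
        (vec3 (- 2 * y * a) (1 - 2 * y * b) (- 2 * y * c))
        (vec3 (- 2 * z * a) (- 2 * z * b) (1 - 2 * z * c))"
    by (simp add: fun_eq_3 reflection_def one3_def)
  then show ?thesis
    using assms unfolding mir_def mirror_def by (intro exI[of _ "vec3 x y z"]) (simp add: sum_UNIV_3)
qed

lemma mir_coordinate: "mir 1 0 0"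
  by (rule mirI[where x = 1 and y = 0 and z = 0], simp, subst lsub_WF, subst WF_wim)
    (simp add: lsub_vec3 cst_uminus)

lemma mir_diagonal: "mir 1 1 0"
  by (rule mirI[where x = "1/2" and y = "1/2" and z = 0], simp, subst lsub_WF, subst WF_wim)
    (simp add: lsub_vec3 cst_uminus wim_swap)

text \<open>The reflection of \<open>icosahedral_invariant\<close> conjugated by diag(1, w, w^2),
  the coordinate change that exhibits the icosahedral shape of the sextic.\<close>

definition icosahedral :: "complex mat3" where
  "icosahedral = vec3 (vec3 (1/2) (- (t * w) / 2) ((t - 1) * (w * w) / 2))
     (vec3 (- (t * (w * w)) / 2) (- (t - 1) / 2) (w / 2))
     (vec3 ((t - 1) * w / 2) (w * w / 2) (t / 2))"

text \<open>In the coordinates x, w y, w^2 z the sextic is built from the icosahedral conic and the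
  six axes (\<open>ico\<close>), both preserved. All coordinates are doubled to clear denominators,
  which costs 64 in degree six.\<close>

lemma lsub_icosahedral: "lsub icosahedral WF = WF"
proof -
  define T W where "T = cst t" and "W = cst w"
  have T: "T * T = T + 1" using arg_cong[OF t, of cst] by (simp add: T_def cst_mult cst_add)
  have W: "W * W = - W - 1"
    using arg_cong[OF w, of cst] by (simp add: W_def cst_mult cst_diff cst_uminus)
  have r: "cst r = (2 * T - 1) * (2 * W + 1)"
    by (simp add: r_def T_def W_def cst_mult cst_add cst_diff)
  have WWW: "W * W * W = 1"
  proof -
    have "W * W * W = - (W * W) - W" by (simp add: W algebra_simps)
    then show ?thesis by (simp add: W)
  qed
  define ico :: "polyC3 \<Rightarrow> polyC3 \<Rightarrow> polyC3 \<Rightarrow> polyC3" where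
    "ico x y z = 4 * ((x * x + y * y + z * z) * (x * x + y * y + z * z) * (x * x + y * y + z * z))
      + (6 * (T - 1) + (42 - 24 * T) * W) * ((T * T * (x * x) - y * y) * (T * T * (y * y) - z * z)
        * (T * T * (z * z) - x * x))" for x y z
  have wim_ico: "wim (cst r) (x * x) (y * y) (z * z) = ico x (W * y) (W * W * z)" for x y z
  proof -
    have "W * (W * y * (W * y)) = (W * W * W) * (y * y)"
      "W * W * ((W * W * z) * (W * W * z)) = (W * W * W) * (W * W * W) * (z * z)"
      by (simp_all add: ac_simps)
    then have "wim (cst r) (x * x) (y * y) (z * z)
        = wim (cst r) (x * x) (W * (W * y * (W * y))) (W * W * ((W * W * z) * (W * W * z)))"
      by (simp only: WWW mult_1)
    then show ?thesis unfolding r wim_icosahedral[OF T W] ico_def .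
  qed
  let ?L = "lsub icosahedral"
  define x y z where "x = X0" and "y = W * X1" and "z = W * W * X2"
  have half: "2 * (cst (a / 2) * p) = cst a * p" "2 * cst (a / 2) = cst a" for a p
  proof -
    have "2 * cst (a / 2) = cst (2 * (a / 2))" by (simp only: cst_mult single_numeral)
    then show "2 * cst (a / 2) = cst a" by simp
    then show "2 * (cst (a / 2) * p) = cst a * p" by (simp only: flip: mult.assoc)
  qed
  have L0: "2 * ?L X0 = x - T * y + (T - 1) * z"
    unfolding icosahedral_def lsub_vec3 distrib_left half x_def y_def z_def T_def W_def
    by (simp add: cst_mult cst_uminus cst_diff algebra_simps)
  have L1: "2 * (W * ?L X1) = z - T * x - (T - 1) * y"
  proof -
    have "2 * ?L X1 = - (T * (W * W)) * X0 - (T - 1) * X1 + W * X2"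
      unfolding icosahedral_def lsub_vec3 distrib_left half T_def W_def
      by (simp add: cst_mult cst_uminus cst_diff algebra_simps)
    then have "W * (2 * ?L X1) = W * (- (T * (W * W)) * X0 - (T - 1) * X1 + W * X2)"
      by (simp only:)
    then have "2 * (W * ?L X1) = W * (- (T * (W * W)) * X0 - (T - 1) * X1 + W * X2)"
      by (simp only: mult.left_commute)
    also have "\<dots> = W * W * X2 - T * ((W * W * W) * X0) - (T - 1) * (W * X1)"
      by (simp add: algebra_simps)
    finally show ?thesis by (simp add: WWW x_def y_def z_def)
  qed
  have L2: "2 * (W * W * ?L X2) = (T - 1) * x + y + T * z"
  proof -
    have "2 * ?L X2 = (T - 1) * W * X0 + W * W * X1 + T * X2"
      unfolding icosahedral_def lsub_vec3 distrib_left half T_def W_def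
      by (simp add: cst_mult cst_uminus cst_diff algebra_simps)
    then have "W * W * (2 * ?L X2) = W * W * ((T - 1) * W * X0 + W * W * X1 + T * X2)"
      by (simp only:)
    then have "2 * (W * W * ?L X2) = W * W * ((T - 1) * W * X0 + W * W * X1 + T * X2)"
      by (simp only: mult.left_commute mult.assoc)
    also have "\<dots> = (T - 1) * ((W * W * W) * X0) + (W * W * W) * (W * X1) + T * (W * W * X2)"
      by (simp add: algebra_simps)
    finally show ?thesis by (simp add: WWW x_def y_def z_def)
  qed
  have ico64: "64 * ico a b c = ico (2 * a) (2 * b) (2 * c)" for a b c
  proof -
    have 1: "2 * a * (2 * a) + 2 * b * (2 * b) + 2 * c * (2 * c) = 4 * (a * a + b * b + c * c)"
      by (simp add: algebra_simps)
    have 2: "T * T * (2 * u * (2 * u)) - 2 * v * (2 * v) = 4 * (T * T * (u * u) - v * v)" for u v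
      by (simp add: algebra_simps)
    have 3: "4 * (4 * d * (4 * d) * (4 * d)) + B * (4 * x * (4 * y) * (4 * z))
        = 64 * (4 * (d * d * d) + B * (x * y * z))" for d B x y z :: polyC3
      by (simp add: algebra_simps)
    show ?thesis unfolding ico_def 1 2 3 ..
  qed
  have "64 * ?L WF = 64 * ico (?L X0) (W * ?L X1) (W * W * ?L X2)"
    by (simp add: lsub_WF wim_ico)
  also have "\<dots> = ico (x - T * y + (T - 1) * z) (z - T * x - (T - 1) * y) ((T - 1) * x + y + T * z)"
    by (simp only: ico64 L0 L1 L2)
  also have "\<dots> = 64 * ico x y z"
    unfolding ico_def icosahedral_invariant[OF T] by (simp add: algebra_simps)
  also have "ico x y z = WF"
    by (simp add: WF_wim wim_ico x_def y_def z_def)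
  finally show ?thesis by simp
qed

lemma icosahedral_involution: "mmul icosahedral icosahedral = one3"
  unfolding icosahedral_def mmul_vec3 one3_vec3 vec3_eq_iff
  by (simp add: field_simps t w tt ww)

text \<open>\<open>s\<close> is the inverse of t, and \<open>k'\<close> that of \<open>k\<close>;
  the value \<open>k\<close> comes out of moving a mirror by the icosahedral reflection.\<close>

definition s :: complex where "s = t - 1"
definition k :: complex where "k = t + w"
definition k' :: complex where "k' = (t - 1 - w) / 2"

lemma icosahedral_reflection:
  "reflection (vec3 1 (t * w) (- (s * (w * w)))) (vec3 (1 / 4) (t * (w * w) / 4) (- (s * w) / 4)) = icosahedral"
  "(\<Sum>i\<in>UNIV. vec3 1 (t * w) (- (s * (w * w))) i * vec3 (1 / 4) (t * (w * w) / 4) (- (s * w) / 4) i) = 1"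
  unfolding icosahedral_def fun_eq_3
  by (simp_all add: reflection_def one3_def sum_UNIV_3 s_def field_simps t w tt ww)

lemma mir_icosahedral: "mir 1 (t * w) (s * (w * w))"
proof -
  have "mir 1 (t * w) (- (s * (w * w)))"
    unfolding mir_def mirror_def using icosahedral_reflection lsub_icosahedral by metis
  then show ?thesis using mir_neg2 by fastforce
qed

text \<open>The icosahedral reflection moves an icosahedral mirror with permuted coordinates to -
  w^2 times (k, 1, 1), the last type of mirror.\<close>

lemma mir_k: "mir 1 k 1"
proof -
  have "mir (t * w) 1 (- (s * (w * w)))"
    using mir_icosahedral by (blast intro: mir_swap01 mir_neg2)
  then have "mir (- (w * w * k)) (- (w * w)) (- (w * w))"
    by (rule mir_conjugate[OF _ icosahedral_involution lsub_icosahedral])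
      (unfold icosahedral_def mvmul_tr3_vec3 vec3_eq_iff, simp add: s_def k_def field_simps t w tt ww)
  then have "mir ((- w) * (- (w * w * k))) ((- w) * (- (w * w))) ((- w) * (- (w * w)))"
    using w by (intro mir_scale) auto
  then have "mir k 1 1" by (simp add: algebra_simps w ww)
  then show ?thesis by (rule mir_swap01)
qed

subsection \<open>The covariant vector fields are independent\<close>

text \<open>Elements of Z[r] as pairs of integers: by \<open>q_simps\<close> the numerical
  evaluation becomes integer arithmetic, valid for every choice of t and w at once.\<close>

definition q :: "int \<Rightarrow> int \<Rightarrow> complex" where "q a b = of_int a + of_int b * r"

lemma q_simps: "q a b + q c d = q (a + c) (b + d)" "q a b - q c d = q (a - c) (b - d)"
  "- q a b = q (- a) (- b)" "q a b * q c d = q (a * c - 15 * (b * d)) (a * d + b * c)"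
  by (simp_all add: q_def algebra_simps rr)

text \<open>The norm a^2 + 15 b^2 is positive definite.\<close>

lemma q_eq_0: "q a b = 0 \<Longrightarrow> a = 0 \<and> b = 0"
proof -
  assume "q a b = 0"
  then have "q a b * q a (- b) = 0" by simp
  then have "of_int (a * a + 15 * (b * b)) = (0 :: complex)"
    unfolding q_simps by (simp add: q_def)
  then have "a * a + 15 * (b * b) = 0" by (simp only: of_int_eq_0_iff)
  moreover have "0 \<le> a * a" "0 \<le> b * b" by simp_all
  ultimately have "a * a = 0" "b * b = 0" by linarith+
  then show ?thesis by simp
qed

definition pt :: "3 \<Rightarrow> complex" where "pt = vec3 1 2 3"

lemma ev_mono: "ev pt (cst c * p) = c * ev pt p" "ev pt (mono i j l) = 2 ^ j * 3 ^ l"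
  by (simp_all add: mono_def ev_simps pt_def)

text \<open>The fields involve second derivatives of the Hessian determinant, itself made of second
  derivatives of the sextic: hence order four. With indices sorted by \<open>pdiff_sorted\<close>
  there are 3 + 6 + 10 + 15 values.\<close>

lemma jets_WF:
  "ev pt (pdiff 0 (WF)) = q 654 1602"
  "ev pt (pdiff 1 (WF)) = q (- 6792) 2376"
  "ev pt (pdiff 2 (WF)) = q (- 2358) 2214"
  "ev pt (pdiff 0 (pdiff 0 (WF))) = q (- 810) 1914"
  "ev pt (pdiff 0 (pdiff 1 (WF))) = q 3120 1104"
  "ev pt (pdiff 0 (pdiff 2 (WF))) = q (- 720) 1296"
  "ev pt (pdiff 1 (pdiff 1 (WF))) = q (- 6660) 2148"
  "ev pt (pdiff 1 (pdiff 2 (WF))) = q (- 7920) 2160"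
  "ev pt (pdiff 2 (pdiff 2 (WF))) = q 1590 1818"
  "ev pt (pdiff 0 (pdiff 0 (pdiff 0 (WF)))) = q (- 4200) 936"
  "ev pt (pdiff 0 (pdiff 0 (pdiff 1 (WF)))) = q 2640 1200"
  "ev pt (pdiff 0 (pdiff 0 (pdiff 2 (WF)))) = q (- 1440) 1440"
  "ev pt (pdiff 0 (pdiff 1 (pdiff 1 (WF)))) = q 600 744"
  "ev pt (pdiff 0 (pdiff 1 (pdiff 2 (WF)))) = q 2880 576"
  "ev pt (pdiff 0 (pdiff 2 (pdiff 2 (WF)))) = q (- 2400) 864"
  "ev pt (pdiff 1 (pdiff 1 (pdiff 1 (WF)))) = q (- 3360) 1440"
  "ev pt (pdiff 1 (pdiff 1 (pdiff 2 (WF)))) = q (- 6840) 1656"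
  "ev pt (pdiff 1 (pdiff 2 (pdiff 2 (WF)))) = q (- 6960) 1584"
  "ev pt (pdiff 2 (pdiff 2 (pdiff 2 (WF)))) = q 7560 1080"
  "ev pt (pdiff 0 (pdiff 0 (pdiff 0 (pdiff 0 (WF))))) = q (- 3240) 936"
  "ev pt (pdiff 0 (pdiff 0 (pdiff 0 (pdiff 1 (WF))))) = q (- 1440) 288"
  "ev pt (pdiff 0 (pdiff 0 (pdiff 0 (pdiff 2 (WF))))) = q (- 2160) 432"
  "ev pt (pdiff 0 (pdiff 0 (pdiff 1 (pdiff 1 (WF))))) = q 360 792"
  "ev pt (pdiff 0 (pdiff 0 (pdiff 1 (pdiff 2 (WF))))) = q 2880 576"
  "ev pt (pdiff 0 (pdiff 0 (pdiff 2 (pdiff 2 (WF))))) = q (- 2640) 912"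
  "ev pt (pdiff 0 (pdiff 1 (pdiff 1 (pdiff 1 (WF))))) = q (- 1440) 288"
  "ev pt (pdiff 0 (pdiff 1 (pdiff 1 (pdiff 2 (WF))))) = q 1440 288"
  "ev pt (pdiff 0 (pdiff 1 (pdiff 2 (pdiff 2 (WF))))) = q 960 192"
  "ev pt (pdiff 0 (pdiff 2 (pdiff 2 (pdiff 2 (WF))))) = q (- 2160) 432"
  "ev pt (pdiff 1 (pdiff 1 (pdiff 1 (pdiff 1 (WF))))) = q 2160 720"
  "ev pt (pdiff 1 (pdiff 1 (pdiff 1 (pdiff 2 (WF))))) = q (- 4320) 864"
  "ev pt (pdiff 1 (pdiff 1 (pdiff 2 (pdiff 2 (WF))))) = q (- 4440) 984"
  "ev pt (pdiff 1 (pdiff 2 (pdiff 2 (pdiff 2 (WF))))) = q (- 4320) 864"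
  "ev pt (pdiff 2 (pdiff 2 (pdiff 2 (pdiff 2 (WF))))) = q 11160 360"
  unfolding WF_def pdiff_add pdiff_cst_mult pdiff_mono
  by (simp_all add: ev_simps ev_mono q_def algebra_simps)

lemma jets_WG:
  "ev pt (pdiff 0 (WG)) = q 421695849600 (- 241236662400)"
  "ev pt (pdiff 1 (WG)) = q (- 1058345740800) (- 176582592000)"
  "ev pt (pdiff 2 (WG)) = q (- 1597320259200) (- 793389168000)"
  "ev pt (pdiff 0 (pdiff 0 (WG))) = q 200181974400 57361219200"
  "ev pt (pdiff 0 (pdiff 1 (WG))) = q 1053172108800 (- 97151270400)"
  "ev pt (pdiff 0 (pdiff 2 (WG))) = q 777376051200 (- 838887321600)"
  "ev pt (pdiff 1 (pdiff 1 (WG))) = q (- 2083273862400) (- 159527750400)"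
  "ev pt (pdiff 1 (pdiff 2 (WG))) = q (- 2842809177600) (- 508733913600)"
  "ev pt (pdiff 2 (pdiff 2 (WG))) = q (- 4220760182400) (- 2290308566400)"
  unfolding WG_def mdet_def det3_def hess_def pdiff_add pdiff_diff pdiff_mult pdiff_sorted
  by (simp_all only: ev_simps jets_WF q_simps) (simp_all add: q_def)

lemma covariant_values:
  "ev pt (covariant WF WG 0) = q 161894961189536256000 53637897212554752000"
  "ev pt (covariant WF WG 1) = q 154193569482304512000 (- 61477774595214336000)"
  "ev pt (covariant WF WG 2) = q (- 138859954080901632000) 54165910360029696000"
  "ev pt (covariant WG WF 0) = q (- 135735308145616147845120000000) (- 24629498176012005371904000000)"
  "ev pt (covariant WG WF 1) = q (- 169512998068481140776960000000) 24536000958265896984576000000"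
  "ev pt (covariant WG WF 2) = q 72945708495044191211520000000 (- 225368666342145183744000000)"
  unfolding covariant_def mvmul_def adj3_def hess_def grad_def sum_UNIV_3
  by (simp_all add: pdiff_sorted ev_simps jets_WF jets_WG q_simps)

lemma det_covariants_neq_0: "det3 var (covariant WF WG) (covariant WG WF) \<noteq> 0"
proof -
  have pt: "pt 0 = q 1 0" "pt 1 = q 2 0" "pt 2 = q 3 0" by (simp_all add: pt_def q_def)
  have "ev pt (det3 var (covariant WF WG) (covariant WG WF)) = q 50547085768757722721445110331288531763200000000000 (- 36548265073180337063280696695594994892800000000000)"
    by (simp add: det3_def ev_simps covariant_values pt q_simps)
  moreover have "q 50547085768757722721445110331288531763200000000000 (- 36548265073180337063280696695594994892800000000000) \<noteq> 0" using q_eq_0 by force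
  ultimately show ?thesis by (metis ev.ins_0)
qed

subsection \<open>The 45 lines\<close>

text \<open>An entry \<open>((b, c), [e, \<dots>])\<close> stands for the lines \<open>e x + b y + c z = 0\<close>, which meet
  \<open>x = 0\<close> in the same point.\<close>

definition tab :: "((complex \<times> complex) \<times> complex list) list" where
  "tab = [((0, 1), [0, 1, - 1]), ((1, 0), [0, 1, - 1]), ((1, 1), [0, k, - k]), ((1, - 1), [0, k, - k]),
    ((1, k), [1, - 1]), ((1, - k), [1, - 1]), ((1, k'), [k', - k']), ((1, - k'), [k', - k']),
    ((1, s * s * w), [s * (w * w), - (s * (w * w))]), ((1, - (s * s * w)), [s * (w * w), - (s * (w * w))]),
    ((1, t * t * (w * w)), [t * w, - (t * w)]), ((1, - (t * t * (w * w))), [t * w, - (t * w)]),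
    ((1, t * w), [t * t * (w * w), - (t * t * (w * w)), s * (w * w), - (s * (w * w))]),
    ((1, - (t * w)), [t * t * (w * w), - (t * t * (w * w)), s * (w * w), - (s * (w * w))]),
    ((1, s * (w * w)), [t * w, - (t * w), s * s * w, - (s * s * w)]),
    ((1, - (s * (w * w))), [t * w, - (t * w), s * s * w, - (s * s * w)])]"

lemma kk': "k * k' = 1" and ts: "t * s = 1" and www: "w * (w * w) = 1"
  by (simp_all add: k_def k'_def s_def field_simps t w tt ww)

lemma nonzero: "t \<noteq> 0" "s \<noteq> 0" "w \<noteq> 0" "k \<noteq> 0" "k' \<noteq> 0"
  using kk' ts www by auto

lemma mir_signs: "mir e b c \<Longrightarrow> mir e b c \<and> mir (- e) b c \<and> mir e b (- c) \<and> mir (- e) b (- c)"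
  by (blast intro: mir_neg0 mir_neg2)

text \<open>Representatives in the normalization of \<open>tab\<close>; signs are added by
  \<open>mir_signs\<close>. In (1, t w, s w^2) the last two entries are inverse to each other, so
  dividing by either of them gives the triples with t^2 w^2 and s^2 w.\<close>

lemma mir_lines:
  shows "mir 0 0 1" "mir 1 0 1" "mir 0 1 0" "mir 1 1 0" "mir 0 1 1" "mir k 1 1" "mir 1 1 k" "mir k' 1 k'"
    "mir (s * (w * w)) 1 (s * s * w)" "mir (t * w) 1 (t * t * (w * w))"
    "mir (t * t * (w * w)) 1 (t * w)" "mir (s * (w * w)) 1 (t * w)"
    "mir (t * w) 1 (s * (w * w))" "mir (s * s * w) 1 (s * (w * w))"
proof -
  note perm = mir_swap01 mir_swap12 mir_swap02
  show "mir 0 0 1" "mir 0 1 0" using mir_coordinate by (blast intro: perm)+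
  show "mir 1 0 1" "mir 1 1 0" "mir 0 1 1" using mir_diagonal by (blast intro: perm)+
  show "mir k 1 1" "mir 1 1 k" using mir_k by (blast intro: perm)+
  show "mir k' 1 k'" using mir_scale[OF mir_k nonzero(5)] by (simp add: kk' mult.commute)
  show "mir (s * (w * w)) 1 (t * w)" "mir (t * w) 1 (s * (w * w))"
    using mir_icosahedral by (blast intro: perm)+
  have e1: "s * (w * w) * (t * w) = 1"
  proof -
    have "s * (w * w) * (t * w) = (t * s) * (w * (w * w))" by (simp only: ac_simps)
    then show ?thesis by (simp add: ts www)
  qed
  have e2: "s * (w * w) * (s * (w * w)) = s * s * w"
  proof -
    have "s * (w * w) * (s * (w * w)) = s * s * (w * (w * (w * w)))" by (simp only: ac_simps)
    then show ?thesis by (simp add: www)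
  qed
  have sw: "s * (w * w) \<noteq> 0" "t * w \<noteq> 0" using nonzero by auto
  have "mir (s * (w * w) * 1) (s * (w * w) * (t * w)) (s * (w * w) * (s * (w * w)))"
    by (rule mir_scale[OF mir_icosahedral sw(1)])
  then have "mir (s * (w * w)) 1 (s * s * w)" by (simp only: e1 e2 mult_1_right)
  then show "mir (s * (w * w)) 1 (s * s * w)" "mir (s * s * w) 1 (s * (w * w))"
    by (blast intro: perm)+
  have "mir (t * w * 1) (t * w * (t * w)) (t * w * (s * (w * w)))"
    by (rule mir_scale[OF mir_icosahedral sw(2)])
  moreover have "t * w * (s * (w * w)) = 1" "t * w * (t * w) = t * t * (w * w)"
    using e1 by (simp_all only: ac_simps)
  ultimately have "mir (t * w) (t * t * (w * w)) 1" by (simp only: mult_1_right)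
  then show "mir (t * w) 1 (t * t * (w * w))" "mir (t * t * (w * w)) 1 (t * w)"
    by (blast intro: perm)+
qed

lemma mir_tab: "\<forall>x\<in>set tab. \<forall>e\<in>set (snd x). mir e (fst (fst x)) (snd (fst x))"
  using mir_lines mir_lines[THEN mir_signs] by (simp add: tab_def)

text \<open>Rough intervals around the two golden ratios are all that the distinctness of the slopes
  asks for.\<close>

lemma t_real:
  obtains \<tau> where "t = of_real \<tau>" "16/10 < \<tau> \<and> \<tau> < 17/10 \<or> - 7/10 < \<tau> \<and> \<tau> < - 6/10"
proof -
  define \<phi> where "\<phi> = (1 + sqrt 5) / 2"
  have s5: "2.2 < sqrt 5" "sqrt 5 < 2.4"
    by (rule real_less_rsqrt, simp add: power2_eq_square)
      (rule real_less_lsqrt, simp_all add: power2_eq_square)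
  have "complex_of_real (sqrt 5) * complex_of_real (sqrt 5) = 5"
    by (simp flip: of_real_mult)
  then have "(t - of_real \<phi>) * (t - of_real (1 - \<phi>)) = 0"
    by (simp add: \<phi>_def field_simps t tt)
  then have "t = of_real \<phi> \<or> t = of_real (1 - \<phi>)" by simp
  then show thesis using s5 by (elim disjE) (rule that, assumption, simp add: \<phi>_def field_simps)+
qed

lemma Im_w: "Im w \<noteq> 0"
proof
  assume "Im w = 0"
  then have "Re w * Re w + Re w + 1 = 0" using arg_cong[OF w, of Re] by simp
  moreover have "Re w * Re w + Re w + 1 = (Re w + 1/2) * (Re w + 1/2) + 3/4"
    by (simp add: algebra_simps)
  moreover have "0 \<le> (Re w + 1/2) * (Re w + 1/2)" by simp
  ultimately show False by linarith
qed

definition slopes :: "complex list" where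
  "slopes = [k, - k, k', - k', s * s * w, - (s * s * w), t * t * (w * w), - (t * t * (w * w)),
    t * w, - (t * w), s * (w * w), - (s * (w * w))]"

lemma distinct_slopes: "distinct ([0, 1, - 1] @ slopes)"
proof -
  obtain \<tau> where \<tau>: "t = of_real \<tau>" "16/10 < \<tau> \<and> \<tau> < 17/10 \<or> - 7/10 < \<tau> \<and> \<tau> < - 6/10"
    by (rule t_real)
  have "of_real (\<tau> * \<tau>) = (of_real (\<tau> + 1) :: complex)" using t \<tau>(1) by simp
  then have \<tau>\<tau>: "\<tau> * \<tau> = \<tau> + 1" by (simp only: of_real_eq_iff)
  \<comment> \<open>The coefficient of w in the real basis 1, w of the complex numbers. It already
    separates the twelve slopes from each other and from 0, 1 and -1, where it vanishes.\<close>
  define f where "f z = Im z / Im w" for z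
  have f_minus: "f (- z) = - f z" for z by (simp add: f_def)
  have im: "f z = a" if "z = of_real a * w + of_real b" for z a b
    using that Im_w by (simp add: f_def)
  have tc: "of_real (2 - \<tau>) = 2 - t" "of_real (- (\<tau> + 1)) = - (t + 1)" "of_real (1 - \<tau>) = 1 - t"
    using \<tau>(1) by simp_all
  have "s * s * w = (2 - t) * w + of_real 0" "t * t * (w * w) = - (t + 1) * w + - (t + 1)"
    "s * (w * w) = (1 - t) * w + (1 - t)"
    by (simp_all add: s_def algebra_simps t w tt)
  then have "s * s * w = of_real (2 - \<tau>) * w + of_real 0"
    "t * t * (w * w) = of_real (- (\<tau> + 1)) * w + of_real (- (\<tau> + 1))"
    "s * (w * w) = of_real (1 - \<tau>) * w + of_real (1 - \<tau>)"
    by (simp_all only: tc)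
  from this[THEN im] have "f (s * s * w) = 2 - \<tau>" "f (t * t * (w * w)) = - (\<tau> + 1)"
    "f (s * (w * w)) = 1 - \<tau>"
    by simp_all
  moreover have "f (t * w) = \<tau>"
    by (rule im[of _ _ 0]) (simp flip: \<tau>(1))
  moreover have "f k = 1"
    by (rule im[of _ _ \<tau>]) (simp add: k_def flip: \<tau>(1))
  moreover have "f k' = - 1/2"
    by (rule im[of _ _ "(\<tau> - 1) / 2"]) (simp add: k'_def field_simps flip: \<tau>(1))
  ultimately have slopes: "map f slopes = [1, - 1, - 1/2, 1/2, 2 - \<tau>, \<tau> - 2, - (\<tau> + 1), \<tau> + 1,
      \<tau>, - \<tau>, 1 - \<tau>, \<tau> - 1]"
    by (simp only: slopes_def list.map f_minus) simp
  have "distinct (map f slopes)" "0 \<notin> set (map f slopes)"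
    unfolding slopes using \<tau>(2) by (auto; linarith)+
  moreover have "f 0 = 0" "f 1 = 0" "f (- 1) = 0" by (simp_all add: f_def)
  ultimately show ?thesis by (auto simp: distinct_map image_iff)
qed

lemma length_tab [simp]: "length tab = 16"
  by (simp add: tab_def)

lemma map_fst_tab: "map fst tab = (0, 1) # map (Pair 1) ([0, 1, - 1] @ slopes)"
  by (simp add: tab_def slopes_def)

lemma points_tab:
  assumes "m < 16" "n < 16" "m \<noteq> n"
  shows "fst (fst (tab ! m)) * snd (fst (tab ! n)) \<noteq> fst (fst (tab ! n)) * snd (fst (tab ! m))"
proof -
  let ?cs = "[0, 1, - 1] @ slopes"
  have len: "length ?cs = 15" by (simp add: slopes_def)
  have "fst (tab ! i) = map fst tab ! i" if "i < 16" for i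
    using that by simp
  then have fst: "fst (tab ! i) = ((0, 1) # map (Pair 1) ?cs) ! i" if "i < 16" for i
    using that unfolding map_fst_tab by blast
  have zero: "fst (tab ! 0) = (0, 1)" by (simp add: fst)
  have Suc: "fst (tab ! Suc i) = (1, ?cs ! i)" if "i < 15" for i
  proof -
    have "Suc i < 16" using that by simp
    then have "fst (tab ! Suc i) = map (Pair 1) ?cs ! i" using fst by (simp only: nth_Cons_Suc)
    also have "\<dots> = (1, ?cs ! i)" by (rule nth_map) (use that len in simp)
    finally show ?thesis .
  qed
  show ?thesis
  proof (cases m)
    case 0
    then obtain j where "n = Suc j" "j < 15" using assms by (cases n) auto
    then show ?thesis using 0 zero Suc[of j] by simp
  next
    case m: (Suc i)
    then have i: "i < 15" using assms by simp
    show ?thesis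
    proof (cases n)
      case 0
      then show ?thesis using m zero Suc[OF i] by simp
    next
      case n: (Suc j)
      then have j: "j < 15" "i \<noteq> j" using assms m by simp_all
      then have "?cs ! i \<noteq> ?cs ! j"
        using distinct_slopes len i nth_eq_iff_index_eq by metis
      then show ?thesis unfolding m n Suc[OF i] Suc[OF j(1)] by simp
    qed
  qed
qed

sublocale lines: line_family "{..<16::nat}" "\<lambda>p. fst (fst (tab ! p))" "\<lambda>p. snd (fst (tab ! p))"
  "\<lambda>p. set (snd (tab ! p))"
proof
  have "\<forall>x\<in>set tab. set (snd x) \<noteq> {} \<and> (fst (fst x) \<noteq> 0 \<or> snd (fst x) \<noteq> 0)"
    by (simp add: tab_def)
  then show "set (snd (tab ! p)) \<noteq> {}" "fst (fst (tab ! p)) \<noteq> 0 \<or> snd (fst (tab ! p)) \<noteq> 0"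
    if "p \<in> {..<16}" for p
    using that by simp_all
qed (use points_tab in auto)

lemma card_lines: "lines.n = 44" "lines.m = 16"
proof -
  have "lines.n = (\<Sum>p<16. card (set (snd (tab ! p))))"
    by (rule lines.card_L)
  also have "\<dots> = sum_list (map (\<lambda>x. card (set (snd x))) tab)"
    by (simp add: sum_list_sum_nth atLeast0LessThan)
  also have "\<dots> = sum_list (map (\<lambda>x. length (snd x)) tab)"
  proof -
    \<comment> \<open>Each row consists of 0, 1, -1 or slopes, so its distinctness is inherited from
      \<open>distinct_slopes\<close>; the letters a, b, c, d hide the arithmetic from
      simplification.\<close>
    have "distinct [0, 1, - 1 :: complex] \<and> distinct [0, k, - k] \<and> distinct [1, - 1 :: complex] \<and> distinct [k', - k'] \<and>
        distinct [d, - d] \<and> distinct [c, - c] \<and> distinct [b, - b, d, - d] \<and> distinct [c, - c, a, - a]"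
      if "distinct ([0, 1, - 1] @ [k, - k, k', - k', a, - a, b, - b, c, - c, d, - d])" for a b c d :: complex
      using that by auto
    from this[OF distinct_slopes[unfolded slopes_def]]
    have "\<forall>x\<in>set tab. distinct (snd x)" unfolding tab_def by (simp only: list.set ball_simps snd_conv)
    then show ?thesis by (intro arg_cong[of _ _ sum_list] map_cong refl) (simp add: distinct_card)
  qed
  also have "\<dots> = 44" by (simp add: tab_def)
  finally show "lines.n = 44" .
qed (simp add: lines.m_def)

lemma tangent_covariants: "lines.tangent (covariant WF WG)" "lines.tangent (covariant WG WF)"
proof -
  have mir: "mirror WF (vec3 e (fst (fst (tab ! p))) (snd (fst (tab ! p))))"
    if "p < 16" "e \<in> set (snd (tab ! p))" for p e
    using mir_tab that by (simp add: mir_def)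
  show "lines.tangent (covariant WF WG)" "lines.tangent (covariant WG WF)"
    using mirror_tangent[OF mir]
    by (auto simp: lines.tangent_def lines.L_def lines.form_def WG_def)
qed

text \<open>The degrees are 12 + 12 - 5 = 19 and 24 + 6 - 5 = 25. With the Euler field they add up
  to 45 = 1 + 44, so the determinant is a constant times x f.\<close>

theorem deletion_wiman: "three_syzygies lines.f (vec3 19 25 28)"
proof -
  have h1: "homogeneous (int 19) (covariant WF WG i)" for i
    using homogeneous_covariant[OF homogeneous_WF homogeneous_WG] by simp
  have h2: "homogeneous (int 25) (covariant WG WF i)" for i
    using homogeneous_covariant[OF homogeneous_WG homogeneous_WF] by simp
  have X0: "X0 dvd covariant WF WG 0" "X0 dvd covariant WG WF 0"
    using mirror_tangent[OF mir_coordinate[unfolded mir_def]]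
    by (simp_all add: WG_def flip: var_eq_lf)
  obtain \<kappa> where \<kappa>: "det3 var (covariant WF WG) (covariant WG WF) = cst \<kappa> * X0 * lines.f"
    by (rule lines.det3_eq_multiple[OF lines.tangent_var tangent_covariants dvd_refl X0 homogeneous_var h1 h2])
      (simp add: card_lines, rule that)
  interpret free_deletion "{..<16::nat}" "\<lambda>p. fst (fst (tab ! p))" "\<lambda>p. snd (fst (tab ! p))"
    "\<lambda>p. set (snd (tab ! p))" 19 25 "covariant WF WG" "covariant WG WF" \<kappa>
  proof
    show "\<kappa> \<noteq> 0" using \<kappa> det_covariants_neq_0 by auto
  qed (use h1 h2 X0 \<kappa> tangent_covariants in \<open>simp_all\<close>)
  show ?thesis using deletion by (simp add: card_lines)
qed

end

section \<open>Rigidity of projective representations of A6 on three-space\<close>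

section \<open>Projective representations of the alternating group\<close>

definition smul :: "'a::comm_ring_1 \<Rightarrow> 'a mat3 \<Rightarrow> 'a mat3" where
  "smul c A i j = c * A i j"

lemma smul_simps: "mmul (smul c A) B = smul c (mmul A B)" "mmul A (smul c B) = smul c (mmul A B)"
  "smul c (smul d A) = smul (c * d) A" "smul 1 A = A" "mdet (smul c A) = c * c * c * mdet A"
  by (simp_all add: fun_eq_iff smul_def mmul_def sum_UNIV_3 mdet_def det3_def algebra_simps)

definition trc :: "'a mat3 \<Rightarrow> 'a::comm_ring_1" where
  "trc A = A 0 0 + A 1 1 + A 2 2"

lemma trc_mmul_commute: "trc (mmul A B) = trc (mmul B A)"
  by (simp add: trc_def mmul_def sum_UNIV_3 algebra_simps)

text \<open>Cayley-Hamilton divided by the matrix. For determinant one it expresses the inverse,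
  whose trace is the constant term.\<close>

lemma cayley_hamilton_adj: "adj3 A i j = mmul A A i j - trc A * A i j + trc (adj3 A) * one3 i j"
proof -
  have "\<forall>i j. adj3 A i j = mmul A A i j - trc A * A i j + trc (adj3 A) * one3 i j"
    unfolding all_3 by (simp add: adj3_def mmul_def trc_def one3_def sum_UNIV_3 algebra_simps)
  then show ?thesis by blast
qed

lemma adj3_inverse:
  assumes "mmul A B = one3" "mdet A = 1"
  shows "adj3 A = B"
proof -
  have "mmul A (adj3 A) = one3"
    using assms by (intro ext) (simp add: mmul_adj3 one3_def)
  moreover have "mmul (adj3 A) A = one3"
  proof -
    have "mmul (tr3 A) (adj3 (tr3 A)) = one3"
      using assms by (intro ext) (simp add: mmul_adj3 one3_def mdet_tr3)
    then have "tr3 (mmul (adj3 A) A) = one3" by (simp add: tr3_mmul adj3_tr3)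
    then show ?thesis by (metis tr3_tr3 tr3_one3)
  qed
  ultimately show ?thesis by (metis assms(1) mmul_assoc mmul_one3)
qed

lemma left_inverse_right_inverse:
  fixes A B :: "'a::field mat3"
  assumes "mmul A B = one3"
  shows "mmul B A = one3"
proof -
  have "mdet A * mdet B = 1" using assms mdet_mmul by (metis mdet_one3)
  then have d: "mdet B \<noteq> 0" by auto
  have "mmul B (smul (1 / mdet B) (adj3 B)) = one3"
    using d by (intro ext) (simp add: smul_simps, simp add: smul_def mmul_adj3 one3_def)
  then have "A = smul (1 / mdet B) (adj3 B)" by (metis assms mmul_assoc mmul_one3)
  then show ?thesis using \<open>mmul B (smul (1 / mdet B) (adj3 B)) = one3\<close> by simp
qed

text \<open>The adjugate of \<open>A\<close> is \<open>A\<close> itself, and Cayley-Hamilton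
  collapses to (1 + trc A)(one3 - A) = 0.\<close>

lemma trc_involution:
  fixes A :: "complex mat3"
  assumes "mmul A A = one3" "mdet A = 1" "A \<noteq> one3"
  shows "trc A = - 1"
proof -
  have adj: "adj3 A = A" by (rule adj3_inverse) (use assms in auto)
  have "(1 + trc A) * (one3 i j - A i j) = 0" for i j
    using cayley_hamilton_adj[of A i j] by (simp add: adj assms(1) algebra_simps)
  moreover obtain i j where "A i j \<noteq> one3 i j" using assms(3) by (meson ext)
  ultimately have "1 + trc A = 0" by (metis eq_iff_diff_eq_0 mult_eq_0_iff)
  then show ?thesis by (simp add: add_eq_0_iff)
qed

abbreviation A6 :: "(nat \<Rightarrow> nat) set" where "A6 \<equiv> carrier (alt_group 6)"

lemma A6_comp: "\<sigma> \<in> A6 \<Longrightarrow> \<tau> \<in> A6 \<Longrightarrow> \<sigma> \<circ> \<tau> \<in> A6"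
  using group.is_monoid[OF alt_group_is_group[of 6]] monoid.m_closed
  by (metis alt_group_mult)

lemma A6_id: "id \<in> A6"
  by (simp add: alt_group_carrier permutes_id evenperm_id)

text \<open>\<open>\<rho>\<close> picks one matrix out of each projective class, so it is
  multiplicative only up to scalars depending on the pair; \<open>pr\<close> and \<open>nrm\<close>
  are insensitive to the choice.\<close>

locale proj_rep =
  fixes \<rho> :: "(nat \<Rightarrow> nat) \<Rightarrow> complex mat3"
  assumes rho_mult: "\<And>\<sigma> \<tau>. \<sigma> \<in> A6 \<Longrightarrow> \<tau> \<in> A6 \<Longrightarrow> \<exists>c. c \<noteq> 0 \<and> mmul (\<rho> \<sigma>) (\<rho> \<tau>) = smul c (\<rho> (\<sigma> \<circ> \<tau>))"
    and rho_det: "\<And>\<sigma>. \<sigma> \<in> A6 \<Longrightarrow> mdet (\<rho> \<sigma>) \<noteq> 0"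
    and rho_faithful: "\<And>\<sigma> c. \<sigma> \<in> A6 \<Longrightarrow> \<rho> \<sigma> = smul c one3 \<Longrightarrow> \<sigma> = id"
begin

definition pr :: "(nat \<Rightarrow> nat) \<Rightarrow> complex mat3 \<Rightarrow> bool" where
  "pr \<sigma> M \<longleftrightarrow> \<sigma> \<in> A6 \<and> (\<exists>c. c \<noteq> 0 \<and> M = smul c (\<rho> \<sigma>))"

lemma pr_rho: "\<sigma> \<in> A6 \<Longrightarrow> pr \<sigma> (\<rho> \<sigma>)"
  by (auto simp: pr_def smul_simps intro!: exI[of _ 1])

lemma pr_smul: "pr \<sigma> M \<Longrightarrow> c \<noteq> 0 \<Longrightarrow> pr \<sigma> (smul c M)"
  unfolding pr_def smul_simps(3) by (metis mult_eq_0_iff smul_simps(3))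

lemma pr_mult: "pr \<sigma> M \<Longrightarrow> pr \<tau> N \<Longrightarrow> pr (\<sigma> \<circ> \<tau>) (mmul M N)"
proof -
  assume "pr \<sigma> M" "pr \<tau> N"
  then obtain c d where c: "c \<noteq> 0" "M = smul c (\<rho> \<sigma>)" "\<sigma> \<in> A6" "d \<noteq> 0" "N = smul d (\<rho> \<tau>)" "\<tau> \<in> A6"
    unfolding pr_def by blast
  obtain e where "e \<noteq> 0" "mmul (\<rho> \<sigma>) (\<rho> \<tau>) = smul e (\<rho> (\<sigma> \<circ> \<tau>))"
    using rho_mult c by blast
  then have "mmul M N = smul (d * (c * e)) (\<rho> (\<sigma> \<circ> \<tau>))" "d * (c * e) \<noteq> 0"
    using c by (simp_all add: smul_simps)
  then show ?thesis unfolding pr_def using A6_comp c(3,6) by blast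
qed

lemma pr_unique: "pr \<sigma> M \<Longrightarrow> pr \<sigma> N \<Longrightarrow> \<exists>c. c \<noteq> 0 \<and> N = smul c M"
proof -
  assume "pr \<sigma> M" "pr \<sigma> N"
  then obtain c d where "c \<noteq> 0" "M = smul c (\<rho> \<sigma>)" "d \<noteq> 0" "N = smul d (\<rho> \<sigma>)"
    unfolding pr_def by blast
  then show ?thesis by (intro exI[of _ "d / c"]) (simp add: smul_simps)
qed

lemma pr_det: "pr \<sigma> M \<Longrightarrow> mdet M \<noteq> 0"
  by (auto simp: pr_def smul_simps rho_det)

lemma pr_id: "pr id one3"
proof -
  let ?R = "\<rho> id"
  obtain c where c: "c \<noteq> 0" "mmul ?R ?R = smul c ?R" using rho_mult[OF A6_id A6_id] by auto
  let ?B = "smul (1 / mdet ?R) (adj3 ?R)"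
  have B: "mmul ?R ?B = one3"
    using rho_det[OF A6_id]
    by (intro ext) (simp add: smul_simps, simp add: smul_def mmul_adj3 one3_def)
  have "mmul (mmul ?R ?R) ?B = smul c (mmul ?R ?B)" using c by (simp add: smul_simps)
  then have "?R = smul c one3" using B by (simp add: mmul_assoc)
  then have "one3 = smul (1 / c) ?R" using c by (simp add: smul_simps)
  then show ?thesis unfolding pr_def using c A6_id by (metis divide_eq_0_iff one_neq_zero)
qed

lemma pr_scalar: "pr \<sigma> (smul c one3) \<Longrightarrow> \<sigma> = id"
proof -
  assume "pr \<sigma> (smul c one3)"
  then obtain d where "d \<noteq> 0" "smul c one3 = smul d (\<rho> \<sigma>)" "\<sigma> \<in> A6" unfolding pr_def by blast
  then have "\<rho> \<sigma> = smul (1 / d) (smul c one3)" by (simp add: smul_simps)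
  then show ?thesis using rho_faithful \<open>\<sigma> \<in> A6\<close> by (simp add: smul_simps)
qed

text \<open>Every involution has a unique lift of order two in the special linear group.\<close>

definition nrm :: "(nat \<Rightarrow> nat) \<Rightarrow> complex mat3 \<Rightarrow> bool" where
  "nrm \<sigma> N \<longleftrightarrow> pr \<sigma> N \<and> mmul N N = one3 \<and> mdet N = 1"

lemma nrm_ex:
  assumes "\<sigma> \<in> A6" "\<sigma> \<circ> \<sigma> = id"
  shows "\<exists>N. nrm \<sigma> N"
proof -
  let ?M = "\<rho> \<sigma>"
  have M: "pr \<sigma> ?M" by (rule pr_rho[OF assms(1)])
  have "pr id (mmul ?M ?M)" using pr_mult[OF M M] by (simp add: assms(2))
  then obtain c where c: "c \<noteq> 0" "mmul ?M ?M = smul c one3" using pr_unique[OF pr_id] by blast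
  have d: "mdet ?M * mdet ?M = c * c * c" using mdet_mmul[of ?M ?M] by (simp add: c smul_simps)
  have d0: "mdet ?M \<noteq> 0" by (rule pr_det[OF M])
  \<comment> \<open>From M^2 = c follows det^2 = c^3; hence k = c / det satisfies both k^2 c = 1 and
    k^3 det = 1.\<close>
  let ?k = "c / mdet ?M"
  have "?k * ?k * c = 1" using d d0 c by (simp add: field_simps)
  moreover have "?k * ?k * ?k * mdet ?M = 1" using d d0 c by (simp add: field_simps)
  ultimately have "nrm \<sigma> (smul ?k ?M)"
    unfolding nrm_def using pr_smul[OF M, of ?k] c d0
    by (simp only: smul_simps mult.assoc divide_eq_0_iff) simp
  then show ?thesis by blast
qed

text \<open>The ratio of two such lifts has square and cube 1.\<close>

lemma nrm_unique: "nrm \<sigma> M \<Longrightarrow> nrm \<sigma> N \<Longrightarrow> M = N"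
proof -
  assume M: "nrm \<sigma> M" and N: "nrm \<sigma> N"
  then obtain c where c: "N = smul c M" using pr_unique unfolding nrm_def by blast
  have "smul (c * c) one3 = one3" using M N unfolding nrm_def c by (simp add: smul_simps)
  then have "c * c = 1" by (metis (no_types, lifting) smul_def one3_def mult_1_right)
  moreover have "c * c * c = 1" using M N unfolding nrm_def c by (simp add: smul_simps)
  ultimately have "c = 1" by simp
  then show ?thesis by (simp add: c smul_simps)
qed

lemma nrm_conj:
  assumes "nrm \<tau> M" "nrm \<sigma> N"
  shows "nrm (\<tau> \<circ> \<sigma> \<circ> \<tau>) (mmul M (mmul N M))"
proof -
  have "pr (\<tau> \<circ> \<sigma> \<circ> \<tau>) (mmul (mmul M N) M)"
    using assms pr_mult unfolding nrm_def by blast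
  moreover have "mmul (mmul M (mmul N M)) (mmul M (mmul N M)) = one3"
  proof -
    have "mmul (mmul M (mmul N M)) (mmul M (mmul N M)) = mmul M (mmul N (mmul (mmul M M) (mmul N M)))"
      by (simp only: mmul_assoc)
    also have "\<dots> = mmul M (mmul N (mmul one3 (mmul N M)))"
      using assms by (simp only: nrm_def)
    also have "\<dots> = mmul M (mmul (mmul N N) M)"
      by (simp only: mmul_one3 mmul_assoc)
    finally show ?thesis using assms by (simp add: nrm_def)
  qed
  ultimately show ?thesis using assms by (simp add: nrm_def mmul_assoc mdet_mmul)
qed

text \<open>A priori the lifts commute only up to a scalar c. The determinant gives c^3 = 1;
  conjugation by the involution \<open>M\<close> exchanges MN and NM, which gives c^2 = 1.\<close>

lemma nrm_commute:
  assumes "nrm \<sigma> M" "nrm \<tau> N" "\<sigma> \<circ> \<tau> = \<tau> \<circ> \<sigma>"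
  shows "mmul M N = mmul N M" and "nrm (\<sigma> \<circ> \<tau>) (mmul M N)"
proof -
  have p: "pr \<sigma> M" "pr \<tau> N" and M2: "mmul M M = one3" and N2: "mmul N N = one3"
    and d: "mdet M = 1" "mdet N = 1"
    using assms by (auto simp: nrm_def)
  have "pr (\<sigma> \<circ> \<tau>) (mmul M N)" "pr (\<sigma> \<circ> \<tau>) (mmul N M)"
    using pr_mult p assms(3) by metis+
  then obtain c where c: "mmul N M = smul c (mmul M N)" using pr_unique by blast
  have "mdet (mmul N M) = c * c * c * mdet (mmul M N)" unfolding c smul_simps ..
  then have c3: "c * c * c = 1" by (simp add: mdet_mmul d)
  have "mmul M (mmul (mmul N M) M) = mmul M N" by (simp add: mmul_assoc M2)
  then have "smul c (mmul M (mmul (mmul M N) M)) = mmul M N" by (simp add: c smul_simps)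
  moreover have "mmul M (mmul (mmul M N) M) = mmul N M" by (simp add: M2 flip: mmul_assoc)
  ultimately have "smul (c * c) (mmul M N) = mmul M N" by (simp add: c smul_simps)
  then have "smul (c * c) (mmul (mmul M N) N) = mmul (mmul M N) N" by (metis smul_simps(1))
  then have "smul (c * c) (mmul M M) = mmul M M" by (metis N2 mmul_assoc mmul_one3(2) smul_simps(1))
  then have "smul (c * c) one3 = one3" by (simp add: M2)
  then have "c * c = 1" by (metis (no_types, lifting) smul_def one3_def mult_1_right)
  then have "c = 1" using c3 by simp
  then show eq: "mmul M N = mmul N M" using c by (simp add: smul_simps)
  have "mmul (mmul M N) (mmul M N) = mmul (mmul M N) (mmul N M)" by (simp add: eq)
  also have "\<dots> = mmul M (mmul (mmul N N) M)" by (simp add: mmul_assoc)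
  finally show "nrm (\<sigma> \<circ> \<tau>) (mmul M N)"
    using \<open>pr (\<sigma> \<circ> \<tau>) (mmul M N)\<close> by (simp add: nrm_def mdet_mmul d M2 N2)
qed

lemma nrm_not_one: "nrm \<sigma> N \<Longrightarrow> \<sigma> \<noteq> id \<Longrightarrow> N \<noteq> one3"
  using pr_scalar[of \<sigma> 1] by (auto simp: nrm_def smul_simps)

lemma nrm_trc: "nrm \<sigma> N \<Longrightarrow> \<sigma> \<noteq> id \<Longrightarrow> trc N = - 1"
  using nrm_not_one[of \<sigma> N] by (intro trc_involution) (simp_all only: nrm_def not_False_eq_True)

lemma nrm_adj3: "nrm \<sigma> N \<Longrightarrow> adj3 N = N"
  by (simp add: nrm_def adj3_inverse)

text \<open>The inverse of \<open>mmul M N\<close> is \<open>mmul N M\<close>, which has the same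
  trace, so a single unknown determines the characteristic polynomial.\<close>

lemma product_char_poly:
  assumes "nrm \<sigma> M" "nrm \<tau> N"
  shows "mmul (mmul M N) (mmul M N) i j
    = trc (mmul M N) * (mmul M N i j - one3 i j) + mmul N M i j"
proof -
  have MN: "mmul M M = one3" "mmul N N = one3" "mdet M = 1" "mdet N = 1"
    using assms by (auto simp: nrm_def)
  have "mmul (mmul M N) (mmul N M) = mmul M (mmul (mmul N N) M)" by (simp only: mmul_assoc)
  then have adj: "adj3 (mmul M N) = mmul N M"
    by (intro adj3_inverse) (simp_all add: MN mdet_mmul)
  show ?thesis
    using cayley_hamilton_adj[of "mmul M N" i j] trc_mmul_commute[of M N]
    by (simp add: adj algebra_simps)
qed

fun pw :: "complex mat3 \<Rightarrow> nat \<Rightarrow> complex mat3" where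
  "pw X 0 = one3" | "pw X (Suc n) = mmul X (pw X n)"

lemma pw_Suc2: "pw X (Suc n) = mmul (pw X n) X"
proof (induction n)
  case (Suc n)
  have "pw X (Suc (Suc n)) = mmul X (mmul (pw X n) X)" using Suc by simp
  then show ?case by (simp flip: mmul_assoc)
qed simp

lemma pr_pw: "pr \<sigma> X \<Longrightarrow> pr (\<sigma> ^^ n) (pw X n)"
proof (induction n)
  case 0
  then show ?case using pr_id by (simp add: id_def)
next
  case (Suc n)
  then show ?case using pr_mult[of \<sigma> X "\<sigma> ^^ n" "pw X n"] by (simp only: pw.simps funpow.simps)
qed

text \<open>A scalar power c of MN is inverted by conjugation with M, so c^2 = 1, and the
  determinant gives c^3 = 1. The order of a product of two involutions thus lifts without cube roots
  of unity.\<close>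

lemma product_power:
  assumes "nrm \<sigma> M" "nrm \<tau> N" "(\<sigma> \<circ> \<tau>) ^^ n = id"
  shows "pw (mmul M N) n = one3"
proof -
  have MN: "mmul M M = one3" "mmul N N = one3" "mdet M = 1" "mdet N = 1"
    using assms by (auto simp: nrm_def)
  let ?X = "mmul M N" and ?Y = "mmul N M"
  have "pr id (pw ?X n)"
    using pr_pw[of "\<sigma> \<circ> \<tau>" ?X n] pr_mult assms unfolding nrm_def by metis
  then obtain c where c: "pw ?X n = smul c one3" using pr_unique[OF pr_id] by blast
  have MX: "mmul M (pw ?X k) = mmul (pw ?Y k) M" for k
  proof (induction k)
    case (Suc k)
    have "mmul M (pw ?X (Suc k)) = mmul (mmul M M) (mmul N (pw ?X k))" by (simp add: mmul_assoc)
    also have "\<dots> = mmul N (mmul (mmul M M) (pw ?X k))" by (simp add: MN)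
    also have "\<dots> = mmul ?Y (mmul M (pw ?X k))" by (simp add: mmul_assoc)
    also have "\<dots> = mmul (pw ?Y (Suc k)) M" by (simp add: Suc mmul_assoc)
    finally show ?case .
  qed simp
  have XY: "mmul ?X ?Y = one3"
  proof -
    have "mmul ?X ?Y = mmul M (mmul (mmul N N) M)" by (simp only: mmul_assoc)
    then show ?thesis by (simp add: MN)
  qed
  have inv: "mmul (pw ?X k) (pw ?Y k) = one3" for k
  proof (induction k)
    case (Suc k)
    have "mmul (pw ?X (Suc k)) (pw ?Y (Suc k)) = mmul (mmul (pw ?X k) ?X) (mmul ?Y (pw ?Y k))"
      by (subst pw_Suc2[of ?X]) (simp only: pw.simps)
    also have "\<dots> = mmul (pw ?X k) (mmul (mmul ?X ?Y) (pw ?Y k))" by (simp only: mmul_assoc)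
    finally show ?case using Suc by (simp add: XY)
  qed simp
  have "pw ?Y n = smul c one3"
  proof -
    have "mmul (mmul M (pw ?X n)) M = pw ?Y n" by (simp add: MX mmul_assoc MN)
    then show ?thesis by (simp add: c smul_simps MN)
  qed
  then have "smul (c * c) one3 = one3" using inv[of n] by (simp add: c smul_simps)
  then have "c * c = 1" by (metis (no_types, lifting) smul_def one3_def mult_1_right)
  moreover have "mdet (pw ?X k) = 1" for k by (induction k) (simp_all add: mdet_mmul MN)
  then have "c * c * c = 1" using c smul_simps(5)[of c one3] by (metis mdet_one3 mult_1_right)
  ultimately have "c = 1" by simp
  then show ?thesis by (simp add: c smul_simps)
qed

lemma mmul_lincomb: "mmul X (\<lambda>i j. a * A i j + b * B i j + c * C i j) i j
    = a * mmul X A i j + b * mmul X B i j + c * (mmul X C i j :: complex)"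
  by (simp add: mmul_def sum_UNIV_3 algebra_simps)

lemma product_cube:
  assumes "nrm \<sigma> M" "nrm \<tau> N"
  defines "X \<equiv> mmul M N"
  shows "pw X (Suc (Suc (Suc n))) i j
    = trc X * pw X (Suc (Suc n)) i j - trc X * pw X (Suc n) i j + pw X n i j"
proof -
  have MN: "mmul M M = one3" "mmul N N = one3"
    using assms by (auto simp: nrm_def)
  have "mmul X X = (\<lambda>i j. trc X * X i j + (- trc X) * one3 i j + 1 * mmul N M i j)"
    using product_char_poly[OF assms(1,2)] by (intro ext) (simp add: X_def algebra_simps)
  then have 1: "mmul X (mmul X X) i j = trc X * mmul X X i j - trc X * X i j + mmul X (mmul N M) i j" for i j
    using mmul_lincomb[of X "trc X" X "- trc X" one3 1 "mmul N M" i j] by simp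
  have "mmul X (mmul N M) = mmul M (mmul (mmul N N) M)" by (simp only: X_def mmul_assoc)
  then have "mmul X (mmul N M) = one3" by (simp add: MN)
  then have X3: "mmul X (mmul X X) = (\<lambda>i j. trc X * mmul X X i j + (- trc X) * X i j + 1 * one3 i j)"
    using 1 by (intro ext) simp
  have "pw X (Suc (Suc (Suc n))) = mmul (pw X n) (mmul X (mmul X X))"
    by (simp only: pw_Suc2 mmul_assoc)
  then have "pw X (Suc (Suc (Suc n))) i j = trc X * mmul (pw X n) (mmul X X) i j
      + (- trc X) * mmul (pw X n) X i j + 1 * mmul (pw X n) one3 i j"
    unfolding X3 mmul_lincomb[symmetric] by simp
  then show ?thesis by (simp add: pw_Suc2[symmetric] del: pw.simps) (simp add: pw_Suc2 mmul_assoc del: pw.simps)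
qed

lemma product_not_idempotent:
  assumes "nrm \<sigma> M" "nrm \<tau> N" "\<sigma> \<circ> \<tau> \<noteq> id"
  shows "\<exists>i j. mmul (mmul M N) (mmul M N) i j \<noteq> mmul M N i j"
proof (rule ccontr)
  let ?X = "mmul M N"
  assume "\<not> ?thesis"
  then have "mmul ?X ?X = ?X" by blast
  then have "mmul M (mmul ?X ?X) = mmul M ?X" by simp
  moreover have MM: "mmul M (mmul M Z) = Z" "mmul N (mmul N Z) = Z" for Z
    using assms by (simp_all only: nrm_def mmul_assoc[symmetric] mmul_one3)
  ultimately have "mmul N ?X = N" by (simp only: mmul_assoc)
  then have "mmul N (mmul N ?X) = mmul N N" by simp
  then have "?X = one3" using assms by (simp only: MM nrm_def)
  moreover have "pr (\<sigma> \<circ> \<tau>) ?X" using assms pr_mult by (simp add: nrm_def)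
  ultimately show False using assms(3) pr_scalar[of "\<sigma> \<circ> \<tau>" 1] by (simp add: smul_simps)
qed

text \<open>The cubic recurrence turns X^3 = 1 into x (X^2 - X) = 0 for the trace x.\<close>

lemma product_order_3:
  assumes "nrm \<sigma> M" "nrm \<tau> N" "(\<sigma> \<circ> \<tau>) ^^ 3 = id" "\<sigma> \<circ> \<tau> \<noteq> id"
  shows "trc (mmul M N) = 0"
proof -
  let ?X = "mmul M N"
  obtain i j where ij: "mmul ?X ?X i j \<noteq> ?X i j" using product_not_idempotent assms by blast
  have "pw ?X 3 i j = one3 i j" using product_power assms by metis
  moreover have "pw ?X 3 i j = trc ?X * mmul ?X ?X i j - trc ?X * ?X i j + one3 i j"
    using product_cube[OF assms(1,2), of 0 i j] by (simp add: numeral_3_eq_3)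
  moreover have "a * (b - c) = 0" if "a * b - a * c + d = d" for a b c d :: complex
    using that by (simp add: right_diff_distrib)
  ultimately have "trc ?X * (mmul ?X ?X i j - ?X i j) = 0" by metis
  moreover have "mmul ?X ?X i j - ?X i j \<noteq> 0" using ij by simp
  ultimately show ?thesis using mult_eq_0_iff by blast
qed

text \<open>The recurrence turns X^5 = 1 into (x^2 - x - 1)((x - 1) X^2 - x X + 1) = 0 for the trace
  x. If the first factor were nonzero, multiplying the quadratic relation by X and reducing X^3
  would give X^2 = X.\<close>

lemma product_order_5:
  assumes "nrm \<sigma> M" "nrm \<tau> N" "(\<sigma> \<circ> \<tau>) ^^ 5 = id" "\<sigma> \<circ> \<tau> \<noteq> id"
  shows "trc (mmul M N) * trc (mmul M N) = trc (mmul M N) + 1"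
proof (rule ccontr)
  define X x where "X = mmul M N" and "x = trc X"
  assume "\<not> ?thesis"
  then have x: "x * x - x - 1 \<noteq> 0" by (simp add: x_def X_def algebra_simps)
  have rec: "pw X (Suc (Suc (Suc n))) i j = x * pw X (Suc (Suc n)) i j - x * pw X (Suc n) i j + pw X n i j" for n i j
    using product_cube[OF assms(1,2)] by (simp only: X_def x_def)
  have p5: "pw X 5 i j = one3 i j" for i j using product_power[OF assms(1-3)] by (simp add: X_def)
  have 1: "(x - 1) * mmul X X i j = x * X i j - one3 i j" for i j
  proof -
    have "pw X 5 i j = x * pw X 4 i j - x * pw X 3 i j + pw X 2 i j"
      "pw X 4 i j = x * pw X 3 i j - x * pw X 2 i j + pw X 1 i j"
      "pw X 3 i j = x * pw X 2 i j - x * pw X 1 i j + pw X 0 i j"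
      using rec[of "Suc (Suc 0)" i j] rec[of "Suc 0" i j] rec[of 0 i j]
      by (simp_all only: numeral_eq_Suc pred_numeral_simps BitM.simps One_nat_def numeral_2_eq_2 numeral_3_eq_3)
    moreover have "pw X 2 = mmul X X" "pw X 1 = X" "pw X 0 = one3"
      by (simp_all add: numeral_2_eq_2)
    ultimately have "(x * x - x - 1) * ((x - 1) * mmul X X i j - x * X i j + one3 i j) = 0"
      using p5[of i j] by (simp add: algebra_simps)
    then have "(x - 1) * mmul X X i j - x * X i j + one3 i j = 0" using x mult_eq_0_iff by blast
    then show ?thesis by (simp add: algebra_simps)
  qed
  have 2: "mmul X X i j = X i j" for i j
  proof -
    have "(\<lambda>i j. (x - 1) * mmul X X i j + 0 * X i j + 0 * X i j) = (\<lambda>i j. x * X i j + (- 1) * one3 i j + 0 * X i j)"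
      using 1 by (intro ext) simp
    then have "mmul X (\<lambda>i j. (x - 1) * mmul X X i j + 0 * X i j + 0 * X i j) i j
        = mmul X (\<lambda>i j. x * X i j + (- 1) * one3 i j + 0 * X i j) i j" by simp
    then have a: "(x - 1) * mmul X (mmul X X) i j = x * mmul X X i j - X i j"
      unfolding mmul_lincomb by simp
    have "mmul X (mmul X X) i j = x * mmul X X i j - x * X i j + one3 i j"
      using rec[of 0 i j] by simp
    then have "(x - 1) * (x * mmul X X i j - x * X i j + one3 i j) = x * mmul X X i j - X i j"
      using a by simp
    then have "x * ((x - 1) * mmul X X i j) - (x - 1) * (x * X i j - one3 i j) = x * mmul X X i j - X i j"
      by (simp add: algebra_simps)
    then have "x * mmul X X i j = (x + 1) * X i j - one3 i j"
      unfolding 1 by (simp add: algebra_simps)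
    then show ?thesis using 1[of i j] by (simp add: algebra_simps)
  qed
  then show False using product_not_idempotent[OF assms(1,2,4)] by (simp add: X_def)
qed

end

subsection \<open>Involutions of the alternating group\<close>

text \<open>The double transposition (a b)(c d).\<close>

definition S :: "nat \<Rightarrow> nat \<Rightarrow> nat \<Rightarrow> nat \<Rightarrow> nat \<Rightarrow> nat" where
  "S a b c d = Transposition.transpose a b \<circ> Transposition.transpose c d"

lemma A6_permutes: "\<sigma> \<in> A6 \<Longrightarrow> \<sigma> permutes {1..6}"
  by (simp add: alt_group_carrier)

lemma A6_eqI:
  assumes "\<sigma> \<in> A6" "\<tau> \<in> A6"
    and "\<sigma> 1 = \<tau> 1" "\<sigma> 2 = \<tau> 2" "\<sigma> 3 = \<tau> 3" "\<sigma> 4 = \<tau> 4" "\<sigma> 5 = \<tau> 5" "\<sigma> 6 = \<tau> 6"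
  shows "\<sigma> = \<tau>"
proof
  fix x :: nat
  have "x = 1 \<or> x = 2 \<or> x = 3 \<or> x = 4 \<or> x = 5 \<or> x = 6 \<or> x \<notin> {1..6}" by auto
  then show "\<sigma> x = \<tau> x"
    using assms A6_permutes permutes_not_in by metis
qed

lemma S_in_A6:
  assumes "a \<in> {1..6}" "b \<in> {1..6}" "c \<in> {1..6}" "d \<in> {1..6}" "a \<noteq> b" "c \<noteq> d"
  shows "S a b c d \<in> A6"
proof -
  have "S a b c d permutes {1..6}"
    unfolding S_def using assms by (intro permutes_compose permutes_swap_id) auto
  moreover have "evenperm (S a b c d)"
    unfolding S_def using assms
    by (simp add: evenperm_comp permutation_swap_id evenperm_swap)
  ultimately show ?thesis by (simp add: alt_group_carrier)
qed

lemma A6_funpow: "\<sigma> \<in> A6 \<Longrightarrow> \<sigma> ^^ n \<in> A6"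
  by (induction n) (auto intro: A6_comp simp: A6_id[unfolded id_def] id_def)

lemma S_invol: "{a, b} \<inter> {c, d} = {} \<Longrightarrow> S a b c d \<circ> S a b c d = id"
  by (intro ext) (auto simp: S_def Transposition.transpose_def)

lemma S_conj:
  assumes "\<tau> \<circ> \<tau>' = id" "\<tau>' \<circ> \<tau> = id"
  shows "\<tau> \<circ> S a b c d \<circ> \<tau>' = S (\<tau> a) (\<tau> b) (\<tau> c) (\<tau> d)"
proof -
  have inv: "\<tau> (\<tau>' x) = x" "\<tau>' (\<tau> x) = x" for x
    using fun_cong[OF assms(1), of x] fun_cong[OF assms(2), of x] by simp_all
  have iff: "\<tau>' x = y \<longleftrightarrow> x = \<tau> y" for x y using inv by metis
  have "\<tau> (Transposition.transpose a b (\<tau>' x)) = Transposition.transpose (\<tau> a) (\<tau> b) x" for a b x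
    by (simp add: Transposition.transpose_def iff inv)
  then have "\<tau> (Transposition.transpose a b (Transposition.transpose c d (\<tau>' x)))
      = Transposition.transpose (\<tau> a) (\<tau> b) (Transposition.transpose (\<tau> c) (\<tau> d) x)" for x
    by (metis inv)
  then show ?thesis by (intro ext) (simp add: S_def)
qed

lemma S_reorder: "S b a c d = S a b c d" "S a b d c = S a b c d"
  "{a, b} \<inter> {c, d} = {} \<Longrightarrow> S c d a b = S a b c d"
  by (simp_all add: S_def Transposition.transpose_commute)
    (intro ext, auto simp: Transposition.transpose_def)

text \<open>By parity: a single transposition and a product of three disjoint ones are odd.\<close>

lemma involution_cases:
  assumes "\<sigma> \<in> A6" "\<sigma> \<circ> \<sigma> = id" "\<sigma> \<noteq> id"
  obtains a b c d where "\<sigma> = S a b c d" "{a, b, c, d} \<subseteq> {1..6}" "distinct [a, b, c, d]"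
proof -
  have inv: "\<sigma> (\<sigma> x) = x" for x using fun_cong[OF assms(2), of x] by simp
  have in6: "x \<in> {1..6}" if "\<sigma> x \<noteq> x" for x
    using that A6_permutes[OF assms(1)] permutes_not_in by metis
  have in6': "\<sigma> x \<in> {1..6}" if "\<sigma> x \<noteq> x" for x
    using in6[of "\<sigma> x"] that inv by metis
  have even: "evenperm \<sigma>" using assms(1) by (simp add: alt_group_carrier)
  obtain a where a: "\<sigma> a \<noteq> a" using assms(3) by (metis ext id_apply)
  define b where "b = \<sigma> a"
  have "\<exists>c. c \<notin> {a, b} \<and> \<sigma> c \<noteq> c"
  proof (rule ccontr)
    assume "\<not> ?thesis"
    then have "\<sigma> = Transposition.transpose a b"
      using inv by (intro ext) (auto simp: Transposition.transpose_def b_def)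
    then have "evenperm (Transposition.transpose a b)" using even by simp
    then show False using a by (simp add: evenperm_swap b_def)
  qed
  then obtain c where c: "c \<notin> {a, b}" "\<sigma> c \<noteq> c" by blast
  define d where "d = \<sigma> c"
  have dist: "distinct [a, b, c, d]"
    using a c inv by (simp add: b_def d_def) metis
  have sub: "{a, b, c, d} \<subseteq> {1..6}"
    using in6 in6' a c by (simp add: b_def d_def)
  have "\<sigma> = S a b c d"
  \<comment> \<open>A third moved pair would exhaust the six points and make \<sigma> odd.\<close>
  proof (cases "\<exists>e. e \<notin> {a, b, c, d} \<and> \<sigma> e \<noteq> e")
    case True
    then obtain e where e: "e \<notin> {a, b, c, d}" "\<sigma> e \<noteq> e" by blast
    define f where "f = \<sigma> e"
    have dist6: "distinct [a, b, c, d, e, f]"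
      using a c e inv dist by (simp add: b_def d_def f_def) metis
    have "{a, b, c, d, e, f} \<subseteq> {1..6}"
      using sub in6 in6' e by (simp add: f_def)
    moreover have "card {a, b, c, d, e, f} = 6" using dist6 by simp
    ultimately have all: "{a, b, c, d, e, f} = {1..6}" by (intro card_subset_eq) auto
    have "\<sigma> = S a b c d \<circ> Transposition.transpose e f"
    proof
      fix x
      show "\<sigma> x = (S a b c d \<circ> Transposition.transpose e f) x"
      proof (cases "x \<in> {a, b, c, d, e, f}")
        case True
        then show ?thesis using dist6 inv
          by (auto simp: S_def Transposition.transpose_def b_def d_def f_def)
      next
        case False
        then have "\<sigma> x = x" using in6 all by blast
        then show ?thesis using False by (auto simp: S_def Transposition.transpose_def)
      qed
    qed
    moreover have "permutation (S a b c d)" "evenperm (S a b c d)"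
      using S_in_A6[of a b c d] sub dist alt_group_carrier alt_group_carrier' by auto
    ultimately have "evenperm \<sigma> \<longleftrightarrow> evenperm (Transposition.transpose e f)"
      by (simp add: evenperm_comp permutation_swap_id)
    then show ?thesis using even e by (simp add: evenperm_swap f_def)
  next
    case False
    show ?thesis
    proof
      fix x
      show "\<sigma> x = S a b c d x"
      proof (cases "x \<in> {a, b, c, d}")
        case True
        then show ?thesis using dist inv
          by (auto simp: S_def Transposition.transpose_def b_def d_def)
      next
        case x: False
        then have "\<sigma> x = x" using False by blast
        then show ?thesis using x by (auto simp: S_def Transposition.transpose_def)
      qed
    qed
  qed
  then show thesis using that sub dist by blast
qed

text \<open>The 45 involutions in the order of \<open>line_list\<close>, so that
  \<open>involution_lines\<close> matches them with their axes position by position.\<close>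

definition quads :: "(nat \<times> nat \<times> nat \<times> nat) list" where
  "quads = [(1, 2, 3, 4), (1, 4, 2, 3), (2, 4, 5, 6), (1, 3, 5, 6), (1, 3, 2, 4), (1, 4, 5, 6), (2, 3, 5, 6), (3, 4, 5, 6), (1, 6, 2, 5), (1, 5, 2, 6), (1, 2, 5, 6), (3, 5, 4, 6), (3, 6, 4, 5), (2, 6, 3, 5), (1, 6, 4, 5), (2, 5, 3, 6), (1, 5, 4, 6), (1, 5, 3, 6), (2, 5, 4, 6), (2, 6, 4, 5), (1, 6, 3, 5), (2, 5, 3, 4), (1, 5, 3, 4), (1, 2, 3, 5), (1, 2, 4, 5), (1, 6, 3, 4), (2, 6, 3, 4), (1, 2, 4, 6), (1, 2, 3, 6), (1, 4, 3, 5), (2, 3, 4, 5), (1, 5, 2, 4), (1, 3, 2, 5), (1, 4, 2, 5), (1, 5, 2, 3), (1, 3, 4, 5), (2, 4, 3, 5), (2, 4, 3, 6), (1, 3, 4, 6), (1, 4, 2, 6), (1, 6, 2, 3), (1, 3, 2, 6), (1, 6, 2, 4), (1, 4, 3, 6), (2, 3, 4, 6)]"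

lemma involution_quads:
  assumes "\<sigma> \<in> A6" "\<sigma> \<circ> \<sigma> = id" "\<sigma> \<noteq> id"
  obtains a b c d where "\<sigma> = S a b c d" "(a, b, c, d) \<in> set quads"
proof -
  obtain a b c d where abcd: "\<sigma> = S a b c d" "{a, b, c, d} \<subseteq> {1..6}" "distinct [a, b, c, d]"
    by (rule involution_cases[OF assms])
  define a' b' c' d' where "a' = min a b" and "b' = max a b" and "c' = min c d" and "d' = max c d"
  have ab: "a' < b'" "{a, b} = {a', b'}" and cd: "c' < d'" "{c, d} = {c', d'}"
  proof -
    have "a \<noteq> b" "c \<noteq> d" using abcd(3) by simp_all
    then show "a' < b'" "c' < d'" by (simp_all add: a'_def b'_def c'_def d'_def min_def max_def)
    show "{a, b} = {a', b'}" "{c, d} = {c', d'}"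
      by (simp_all add: a'_def b'_def c'_def d'_def min_def max_def insert_commute)
  qed
  have disj: "{a', b'} \<inter> {c', d'} = {}" using abcd(3) ab(2) cd(2) by auto
  have \<sigma>: "\<sigma> = S a' b' c' d'"
    using abcd(1) S_reorder(1)[of b a] S_reorder(2)[of _ _ d c]
    by (simp add: a'_def b'_def c'_def d'_def min_def max_def)
  have in6: "{a', b', c', d'} \<subseteq> {1..6}" using abcd(2) ab(2) cd(2) by blast
  \<comment> \<open>Normal form: increasing pairs, ordered by their first entries. The nesting of
    quantifiers and premises lets simplification discard cases early.\<close>
  have sorted: "(p, q, u, v) \<in> set quads"
    if "{p, q, u, v} \<subseteq> {1..6}" "p < q" "u < v" "p < u" "{p, q} \<inter> {u, v} = {}" for p q u v
  proof -
    let ?I = "{1, 2, 3, 4, 5, 6} :: nat set"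
    have all: "\<forall>p\<in>?I. \<forall>q\<in>?I. p < q \<longrightarrow> (\<forall>u\<in>?I. p < u \<longrightarrow> (q \<noteq> u \<longrightarrow>
        (\<forall>v\<in>?I. u < v \<longrightarrow> (q \<noteq> v \<longrightarrow> (p, q, u, v) \<in> set quads))))"
      unfolding quads_def by simp
    have I: "p \<in> ?I" "q \<in> ?I" "u \<in> ?I" "v \<in> ?I" using that(1) by auto
    have ne: "q \<noteq> u" "q \<noteq> v" using that(5) by auto
    show ?thesis
      using all[THEN bspec, OF I(1), THEN bspec, OF I(2), THEN mp, OF that(2), THEN bspec, OF I(3),
        THEN mp, OF that(4), THEN mp, OF ne(1), THEN bspec, OF I(4), THEN mp, OF that(3),
        THEN mp, OF ne(2)] .
  qed
  show thesis
  proof (cases "a' < c'")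
    case True
    show thesis by (rule that[OF \<sigma> sorted[OF in6 ab(1) cd(1) True disj]])
  next
    case False
    then have less: "c' < a'" using disj by auto
    have swap: "{c', d', a', b'} \<subseteq> {1..6}" "{c', d'} \<inter> {a', b'} = {}" using in6 disj by auto
    have "\<sigma> = S c' d' a' b'" using \<sigma> S_reorder(3)[OF disj] by simp
    then show thesis by (rule that[OF _ sorted[OF swap(1) cd(1) ab(1) less swap(2)]])
  qed
qed

lemma quads_valid:
  assumes "(a, b, c, d) \<in> set quads"
  shows "S a b c d \<in> A6" "S a b c d \<circ> S a b c d = id" "S a b c d \<noteq> id"
proof -
  have "list_all (\<lambda>(a, b, c, d). 1 \<le> a \<and> a < b \<and> b \<le> 6 \<and> 1 \<le> c \<and> c < d \<and> d \<le> 6 \<and>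
      a \<noteq> c \<and> a \<noteq> d \<and> b \<noteq> c \<and> b \<noteq> d) quads"
    unfolding quads_def by simp
  then have "1 \<le> a \<and> a < b \<and> b \<le> 6 \<and> 1 \<le> c \<and> c < d \<and> d \<le> 6 \<and> a \<noteq> c \<and> a \<noteq> d \<and> b \<noteq> c \<and> b \<noteq> d"
    using assms unfolding list_all_iff by - (drule bspec, assumption, simp)
  then have abcd: "{a, b, c, d} \<subseteq> {1..6}" "distinct [a, b, c, d]"
    by auto
  then show "S a b c d \<in> A6" using S_in_A6[of a b c d] by simp
  show "S a b c d \<circ> S a b c d = id" using abcd S_invol[of a b c d] by simp
  have "S a b c d a = b" using abcd(2) by (simp add: S_def Transposition.transpose_def)
  then show "S a b c d \<noteq> id" using abcd(2) by auto
qed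

section \<open>Coordinates adapted to the representation\<close>

text \<open>Target shapes of the lifts: \<open>D1\<close>, \<open>D2\<close>, \<open>D3\<close> are
  the Klein four-group without the identity; \<open>T1\<close> and \<open>T2\<close> stand for
  involutions that centralize one of its elements and exchange the other two.\<close>

definition D1 :: "complex mat3" where "D1 = vec3 (vec3 1 0 0) (vec3 0 (- 1) 0) (vec3 0 0 (- 1))"
definition D2 :: "complex mat3" where "D2 = vec3 (vec3 (- 1) 0 0) (vec3 0 1 0) (vec3 0 0 (- 1))"
definition D3 :: "complex mat3" where "D3 = vec3 (vec3 (- 1) 0 0) (vec3 0 (- 1) 0) (vec3 0 0 1)"
definition T1 :: "complex mat3" where "T1 = vec3 (vec3 (- 1) 0 0) (vec3 0 0 (- 1)) (vec3 0 (- 1) 0)"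
definition T2 :: "complex mat3" where "T2 = vec3 (vec3 0 0 (- 1)) (vec3 0 (- 1) 0) (vec3 (- 1) 0 0)"

text \<open>\<open>Q\<close> is (1 + aA)(1 + bB)/4, the projection onto the common eigenspace, of
  trace 1. The column and the row of \<open>Q\<close> through a nonzero diagonal entry are right and
  left eigenvectors, and idempotency of \<open>Q\<close> normalizes their pairing.\<close>

lemma commuting_involutions_eigenvectors:
  fixes A B :: "complex mat3"
  assumes "mmul A A = one3" "mmul B B = one3" "mmul A B = mmul B A"
    and "trc A = - 1" "trc B = - 1" "trc (mmul A B) = - 1"
    and "a * a = 1" "b * b = 1" "a + b + a * b = - 1"
  obtains x y where "mvmul A x = (\<lambda>i. a * x i)" "mvmul B x = (\<lambda>i. b * x i)"
    "mvmul (tr3 A) y = (\<lambda>i. a * y i)" "mvmul (tr3 B) y = (\<lambda>i. b * y i)" "(\<Sum>i\<in>UNIV. y i * x i) = 1"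
proof -
  define Q :: "complex mat3" where
    "Q i j = (one3 i j + a * A i j + b * B i j + a * b * mmul A B i j) / 4" for i j
  have lin: "mmul M Q i j = (M i j + a * mmul M A i j + b * mmul M B i j + a * b * mmul M (mmul A B) i j) / 4"
    "mmul Q M i j = (M i j + a * mmul A M i j + b * mmul B M i j + a * b * mmul (mmul A B) M i j) / 4" for M i j
  proof -
    have "mmul M Q i j = (mmul M one3 i j + a * mmul M A i j + b * mmul M B i j + a * b * mmul M (mmul A B) i j) / 4"
      "mmul Q M i j = (mmul one3 M i j + a * mmul A M i j + b * mmul B M i j + a * b * mmul (mmul A B) M i j) / 4"
      unfolding mmul_def[of M] mmul_def[of _ M] Q_def sum_UNIV_3 by (simp_all add: field_simps)
    then show "mmul M Q i j = (M i j + a * mmul M A i j + b * mmul M B i j + a * b * mmul M (mmul A B) i j) / 4"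
      "mmul Q M i j = (M i j + a * mmul A M i j + b * mmul B M i j + a * b * mmul (mmul A B) M i j) / 4"
      by (simp_all only: mmul_one3)
  qed
  have AA: "mmul A (mmul A M) = M" "mmul B (mmul B M) = M" for M
    using assms(1,2) by (simp_all only: mmul_assoc[symmetric] mmul_one3)
  have AB: "mmul A (mmul B A) = B" "mmul B (mmul A B) = A" "mmul (mmul A B) B = A" "mmul (mmul A B) A = B"
    using AA assms(1-3) by (simp_all add: mmul_assoc) (metis AA)+
  have aa: "a * (a * z) = z" "b * (b * z) = z" for z
    using assms(7,8) by (simp_all only: mult.assoc[symmetric] mult_1)
  have AQ: "mmul A Q i j = a * Q i j" "mmul Q A i j = a * Q i j" for i j
    unfolding lin using assms(1,3,7) AA AB
    by (simp_all add: Q_def field_simps aa)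
  have BQ: "mmul B Q i j = b * Q i j" "mmul Q B i j = b * Q i j" for i j
    unfolding lin using assms(2,3,8) AA AB
    by (simp_all add: Q_def field_simps aa)
  have QQ: "mmul Q Q i j = Q i j" for i j
  proof -
    have ABQ: "mmul (mmul A B) Q i j = a * (b * Q i j)"
    proof -
      have "mmul B Q = (\<lambda>i j. b * Q i j + 0 * Q i j + 0 * Q i j)" using BQ by (intro ext) simp
      then have "mmul A (mmul B Q) i j = b * mmul A Q i j"
        by (simp add: mmul_def sum_UNIV_3 algebra_simps)
      then show ?thesis by (simp add: mmul_assoc AQ)
    qed
    show ?thesis unfolding lin(2)[of Q] using assms(7,8)
      by (simp add: AQ BQ ABQ aa field_simps)
  qed
  have "trc Q = (3 + a * trc A + b * trc B + a * b * trc (mmul A B)) / 4"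
    by (simp add: trc_def Q_def one3_def field_simps)
  also have "\<dots> = 1"
    using assms(4-6,9) by (simp add: algebra_simps)
  finally have "trc Q \<noteq> 0" by simp
  then have "Q 0 0 \<noteq> 0 \<or> Q 1 1 \<noteq> 0 \<or> Q 2 2 \<noteq> 0" by (auto simp: trc_def)
  then obtain k where k: "Q k k \<noteq> 0" by blast
  define x where "x i = Q i k" for i
  define y where "y j = Q k j / Q k k" for j
  show thesis
  proof (rule that)
    show "mvmul A x = (\<lambda>i. a * x i)"
      using AQ(1)[of _ k] by (intro ext) (simp add: mvmul_def mmul_def x_def)
    show "mvmul B x = (\<lambda>i. b * x i)"
      using BQ(1)[of _ k] by (intro ext) (simp add: mvmul_def mmul_def x_def)
    show "mvmul (tr3 A) y = (\<lambda>i. a * y i)"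
    proof
      fix i
      have "mvmul (tr3 A) y i = mmul Q A k i / Q k k"
        by (simp add: mvmul_def mmul_def y_def tr3_def sum_divide_distrib mult.commute)
      then show "mvmul (tr3 A) y i = a * y i" by (simp add: AQ y_def)
    qed
    show "mvmul (tr3 B) y = (\<lambda>i. b * y i)"
    proof
      fix i
      have "mvmul (tr3 B) y i = mmul Q B k i / Q k k"
        by (simp add: mvmul_def mmul_def y_def tr3_def sum_divide_distrib mult.commute)
      then show "mvmul (tr3 B) y i = b * y i" by (simp add: BQ y_def)
    qed
    have "(\<Sum>i\<in>UNIV. y i * x i) = mmul Q Q k k / Q k k"
      by (simp add: mmul_def x_def y_def sum_divide_distrib)
    then show "(\<Sum>i\<in>UNIV. y i * x i) = 1" using k by (simp add: QQ)
  qed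
qed

lemma conj_mult:
  assumes "mmul G H = (one3 :: 'a::comm_ring_1 mat3)"
  shows "mmul (mmul H (mmul A G)) (mmul H (mmul B G)) = mmul H (mmul (mmul A B) G)"
proof -
  have "mmul (mmul H (mmul A G)) (mmul H (mmul B G)) = mmul H (mmul A (mmul (mmul G H) (mmul B G)))"
    by (simp only: mmul_assoc)
  then show ?thesis by (simp add: assms mmul_assoc)
qed

text \<open>The three nontrivial characters of the four-group occur once each; the right
  eigenvectors are the columns of \<open>G\<close>, the left ones the rows of its inverse
  \<open>H\<close>.\<close>

lemma diagonalize_commuting_involutions:
  fixes A B :: "complex mat3"
  assumes "mmul A A = one3" "mmul B B = one3" "mmul A B = mmul B A"
    and "trc A = - 1" "trc B = - 1" "trc (mmul A B) = - 1"
  obtains G H where "mmul H G = one3" "mmul G H = one3" "mmul H (mmul A G) = D1" "mmul H (mmul B G) = D2"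
proof -
  note ev = commuting_involutions_eigenvectors[OF assms]
  define al be :: "3 \<Rightarrow> complex" where "al = vec3 1 (- 1) (- 1)" and "be = vec3 (- 1) 1 (- 1)"
  let ?P = "\<lambda>j x y. mvmul A x = (\<lambda>i. al j * x i) \<and> mvmul B x = (\<lambda>i. be j * x i) \<and>
    mvmul (tr3 A) y = (\<lambda>i. al j * y i) \<and> mvmul (tr3 B) y = (\<lambda>i. be j * y i) \<and> (\<Sum>i\<in>UNIV. y i * x i) = 1"
  have "\<exists>z. ?P j (fst z) (snd z)" for j
  proof -
    have "\<forall>j. al j * al j = 1 \<and> be j * be j = 1 \<and> al j + be j + al j * be j = - 1"
      unfolding all_3 by (simp add: al_def be_def)
    then have "al j * al j = 1" "be j * be j = 1" "al j + be j + al j * be j = - 1" by blast+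
    then obtain x y where "mvmul A x = (\<lambda>i. al j * x i)" "mvmul B x = (\<lambda>i. be j * x i)"
      "mvmul (tr3 A) y = (\<lambda>i. al j * y i)" "mvmul (tr3 B) y = (\<lambda>i. be j * y i)" "(\<Sum>i\<in>UNIV. y i * x i) = 1"
      by (rule ev)
    then show ?thesis by (intro exI[of _ "(x, y)"]) simp
  qed
  then have "\<forall>j. ?P j (fst (z j)) (snd (z j))" if "z = (\<lambda>j. SOME u. ?P j (fst u) (snd u))" for z
    unfolding that by (intro allI) (rule someI_ex)
  then obtain z where z: "\<And>j. ?P j (fst (z j)) (snd (z j))" by blast
  define x y where "x j = fst (z j)" and "y j = snd (z j)" for j
  have x: "mvmul A (x j) = (\<lambda>i. al j * x j i)" "mvmul B (x j) = (\<lambda>i. be j * x j i)"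
    and y: "mvmul (tr3 A) (y j) = (\<lambda>i. al j * y j i)" "mvmul (tr3 B) (y j) = (\<lambda>i. be j * y j i)"
    and xy: "(\<Sum>i\<in>UNIV. y j i * x j i) = 1" for j
    using z[of j] by (simp_all add: x_def y_def)
  have adj: "(\<Sum>i\<in>UNIV. y i' i * mvmul M (x j) i) = (\<Sum>i\<in>UNIV. mvmul (tr3 M) (y i') i * x j i)" for M i' j
    by (simp add: mvmul_def tr3_def sum_UNIV_3 algebra_simps)
  \<comment> \<open>Left and right eigenvectors of different characters pair to zero.\<close>
  have orth: "(\<Sum>i\<in>UNIV. y i' i * x j i) = (if i' = j then 1 else 0)" for i' j
  proof -
    let ?s = "\<Sum>i\<in>UNIV. y i' i * x j i"
    have "al j * ?s = al i' * ?s" "be j * ?s = be i' * ?s"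
      using adj[of i' A j] adj[of i' B j] by (simp_all add: x y sum_distrib_left algebra_simps)
    moreover have "al i' \<noteq> al j \<or> be i' \<noteq> be j" if "i' \<noteq> j"
    proof -
      have "\<forall>i' j. i' \<noteq> j \<longrightarrow> al i' \<noteq> al j \<or> be i' \<noteq> be j"
        unfolding all_3 by (simp add: al_def be_def)
      then show ?thesis using that by blast
    qed
    ultimately show ?thesis using xy[of j] by auto
  qed
  define G H where "G i j = x j i" and "H i j = y i j" for i j
  have HG: "mmul H G = one3"
    by (intro ext) (simp add: mmul_def G_def H_def orth one3_def)
  have "mmul H (mmul A G) i j = al j * one3 i j" for i j
  proof -
    have "mmul H (mmul A G) i j = (\<Sum>k\<in>UNIV. y i k * mvmul A (x j) k)"
      by (simp add: mmul_def mvmul_def G_def H_def)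
    then show ?thesis using orth[of i j] by (simp add: x one3_def sum_distrib_left[symmetric] mult.left_commute)
  qed
  then have "mmul H (mmul A G) = D1"
    unfolding fun_eq_3 D1_def by (simp add: one3_def al_def)
  moreover have "mmul H (mmul B G) i j = be j * one3 i j" for i j
  proof -
    have "mmul H (mmul B G) i j = (\<Sum>k\<in>UNIV. y i k * mvmul B (x j) k)"
      by (simp add: mmul_def mvmul_def G_def H_def)
    then show ?thesis using orth[of i j] by (simp add: x one3_def sum_distrib_left[symmetric] mult.left_commute)
  qed
  then have "mmul H (mmul B G) = D2"
    unfolding fun_eq_3 D2_def by (simp add: one3_def be_def)
  ultimately show thesis using HG left_inverse_right_inverse[OF HG] that by blast
qed

definition diag3 :: "complex \<Rightarrow> complex \<Rightarrow> complex \<Rightarrow> complex mat3" where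
  "diag3 a b c = vec3 (vec3 a 0 0) (vec3 0 b 0) (vec3 0 0 c)"

lemma mat3_eta: "vec3 (vec3 (A 0 0) (A 0 1) (A 0 2)) (vec3 (A 1 0) (A 1 1) (A 1 2)) (vec3 (A 2 0) (A 2 1) (A 2 2)) = A"
  by (simp add: fun_eq_3)

lemma mdet_vec3: "mdet (vec3 (vec3 a b c) (vec3 d e f) (vec3 g h i))
    = a * (e * i - f * h) - b * (d * i - f * g) + c * (d * h - e * (g :: complex))"
  by (simp add: mdet_def det3_def)

lemma normalizing_involution:
  fixes X A B C :: "complex mat3"
  assumes "mmul X X = one3" "mmul X (mmul A X) = A" "mmul X (mmul B X) = C"
  shows "mmul X A = mmul A X" "mmul X B = mmul C X"
proof -
  have "mmul X (mmul X (mmul M X)) = mmul M X" for M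
    using assms(1) by (simp only: mmul_assoc[symmetric] mmul_one3)
  then have "mmul X A = mmul A X" "mmul X C = mmul B X" using assms(2,3) by metis+
  moreover have "mmul (mmul X (mmul B X)) X = mmul X B"
    using assms(1) by (simp add: mmul_assoc)
  ultimately show "mmul X A = mmul A X" "mmul X B = mmul C X" using assms(3) by simp_all
qed

text \<open>The commutation rules kill all entries outside the pattern, and the determinant fixes
  the sign of the first one; a scalar stays free.\<close>

lemma involution_swapping_23:
  assumes "mmul X X = one3" "mdet X = 1" "mmul X (mmul D1 X) = D1" "mmul X (mmul D2 X) = D3"
  obtains \<beta> where "\<beta> \<noteq> 0" "X = vec3 (vec3 (- 1) 0 0) (vec3 0 0 \<beta>) (vec3 0 (1 / \<beta>) 0)"
proof -
  obtain a b c d e f g h i where X: "X = vec3 (vec3 a b c) (vec3 d e f) (vec3 g h i)"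
    using mat3_eta by metis
  have c: "mmul X D1 = mmul D1 X" "mmul X D2 = mmul D3 X"
    using normalizing_involution[OF assms(1,3,4)] by simp_all
  have z: "b = 0" "c = 0" "d = 0" "g = 0" "e = 0" "i = 0"
    using c unfolding X D1_def D2_def D3_def mmul_vec3 vec3_eq_iff by auto
  have "a * a = 1" "f * h = 1"
    using assms(1) unfolding X one3_vec3 mmul_vec3 vec3_eq_iff by (auto simp: z)
  moreover have "- a * (f * h) = 1"
    using assms(2) unfolding X mdet_vec3 by (simp add: z ac_simps)
  ultimately have "a = - 1" "f * h = 1" by (auto simp: minus_equation_iff)
  moreover from this have "f \<noteq> 0" by auto
  ultimately have "a = - 1" "h = 1 / f" "f \<noteq> 0"
    by (simp_all add: eq_divide_eq mult.commute)
  then show thesis using that[of f] X z by simp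
qed

lemma involution_swapping_13:
  assumes "mmul X X = one3" "mdet X = 1" "mmul X (mmul D2 X) = D2" "mmul X (mmul D1 X) = D3"
  obtains \<gamma> where "\<gamma> \<noteq> 0" "X = vec3 (vec3 0 0 \<gamma>) (vec3 0 (- 1) 0) (vec3 (1 / \<gamma>) 0 0)"
proof -
  obtain a b c d e f g h i where X: "X = vec3 (vec3 a b c) (vec3 d e f) (vec3 g h i)"
    using mat3_eta by metis
  have c: "mmul X D2 = mmul D2 X" "mmul X D1 = mmul D3 X"
    using normalizing_involution[OF assms(1,3,4)] by simp_all
  have z: "b = 0" "d = 0" "f = 0" "h = 0" "a = 0" "i = 0"
    using c unfolding X D1_def D2_def D3_def mmul_vec3 vec3_eq_iff by auto
  have "e * e = 1" "c * g = 1"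
    using assms(1) unfolding X one3_vec3 mmul_vec3 vec3_eq_iff by (auto simp: z)
  moreover have "- e * (c * g) = 1"
    using assms(2) unfolding X mdet_vec3 by (simp add: z ac_simps)
  ultimately have "e = - 1" "c * g = 1" by (auto simp: minus_equation_iff)
  moreover from this have "c \<noteq> 0" by auto
  ultimately have "e = - 1" "g = 1 / c" "c \<noteq> 0"
    by (simp_all add: eq_divide_eq mult.commute)
  then show thesis using that[of c] X z by simp
qed

lemma S_apply: "S a b c d x = Transposition.transpose a b (Transposition.transpose c d x)"
  by (simp add: S_def)

lemmas S_eval = S_apply Transposition.transpose_def

lemma S_products:
  "S 1 2 3 4 \<circ> S 1 3 2 4 = S 1 4 2 3" "S 1 3 2 4 \<circ> S 1 2 3 4 = S 1 4 2 3"
  "S 1 3 2 4 \<circ> S 1 3 5 6 = S 2 4 5 6" "S 1 3 5 6 \<circ> S 1 3 2 4 = S 2 4 5 6"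
  "S 1 4 2 3 \<circ> S 2 3 5 6 = S 1 4 5 6" "S 2 3 5 6 \<circ> S 1 4 2 3 = S 1 4 5 6"
  by (intro A6_eqI A6_comp S_in_A6; simp add: S_eval)+

lemma S_conjugates:
  "S 1 2 5 6 \<circ> S 1 2 3 4 \<circ> S 1 2 5 6 = S 1 2 3 4" "S 1 2 5 6 \<circ> S 1 3 2 4 \<circ> S 1 2 5 6 = S 1 4 2 3"
  "S 1 3 5 6 \<circ> S 1 3 2 4 \<circ> S 1 3 5 6 = S 1 3 2 4" "S 1 3 5 6 \<circ> S 1 2 3 4 \<circ> S 1 3 5 6 = S 1 4 2 3"
  "S 1 2 5 6 \<circ> S 1 3 5 6 \<circ> S 1 2 5 6 = S 2 3 5 6"
  by (intro A6_eqI A6_comp S_in_A6; simp add: S_eval)+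

context proj_rep
begin

text \<open>Diagonalization leaves the freedom of rescaling the axes. Up to a common factor these
  are two parameters, and \<open>K\<close> uses them to absorb the unknowns \<open>\<beta>\<close>
  and \<open>\<gamma>\<close> in the lifts \<open>T\<close> and \<open>T'\<close>.\<close>

lemma adapted_coordinates:
  obtains G H A B T T' where "mmul H G = one3" "mmul G H = one3"
    "nrm (S 1 2 3 4) A" "nrm (S 1 3 2 4) B" "nrm (S 1 2 5 6) T" "nrm (S 1 3 5 6) T'"
    "mmul H (mmul A G) = D1" "mmul H (mmul B G) = D2" "mmul H (mmul T G) = T1" "mmul H (mmul T' G) = T2"
proof -
  have q: "(1, 2, 3, 4) \<in> set quads" "(1, 3, 2, 4) \<in> set quads" "(1, 2, 5, 6) \<in> set quads" "(1, 3, 5, 6) \<in> set quads"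
    "(1, 4, 2, 3) \<in> set quads"
    by (simp_all add: quads_def)
  obtain A B T T' where N: "nrm (S 1 2 3 4) A" "nrm (S 1 3 2 4) B" "nrm (S 1 2 5 6) T" "nrm (S 1 3 5 6) T'"
    using nrm_ex[OF quads_valid(1)[OF q(1)] quads_valid(2)[OF q(1)]]
      nrm_ex[OF quads_valid(1)[OF q(2)] quads_valid(2)[OF q(2)]]
      nrm_ex[OF quads_valid(1)[OF q(3)] quads_valid(2)[OF q(3)]]
      nrm_ex[OF quads_valid(1)[OF q(4)] quads_valid(2)[OF q(4)]] by (elim exE)
  have "S 1 2 3 4 \<circ> S 1 3 2 4 = S 1 3 2 4 \<circ> S 1 2 3 4" by (simp only: S_products)
  note AB = nrm_commute[OF N(1,2) this, unfolded S_products]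
  have trc: "trc A = - 1" "trc B = - 1" "trc (mmul A B) = - 1"
    using nrm_trc N(1,2) AB(2) quads_valid(3) q by blast+
  have A2: "mmul A A = one3" "mmul B B = one3" "mmul T T = one3" "mmul T' T' = one3"
    and dT: "mdet T = 1" "mdet T' = 1" using N by (simp_all add: nrm_def)
  obtain G0 H0 where HG0: "mmul H0 G0 = one3" "mmul G0 H0 = one3"
    and D: "mmul H0 (mmul A G0) = D1" "mmul H0 (mmul B G0) = D2"
    by (rule diagonalize_commuting_involutions[OF A2(1,2) AB(1) trc])
  define c where "c M = mmul H0 (mmul M G0)" for M
  have cm: "mmul (c M) (c N) = c (mmul M N)" for M N
    unfolding c_def by (rule conj_mult[OF HG0(2)])
  have c1: "c one3 = one3" by (simp add: c_def HG0)
  have cdet: "mdet (c M) = mdet M" for M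
  proof -
    have "mdet H0 * mdet G0 = 1" using HG0(1) mdet_mmul by (metis mdet_one3)
    then show ?thesis by (simp add: c_def mdet_mmul mult.commute mult.left_commute)
  qed
  have D3: "c (mmul A B) = D3"
  proof -
    have "c (mmul A B) = mmul D1 D2" using cm[of A B] D by (simp add: c_def)
    then show ?thesis by (simp add: D1_def D2_def D3_def mmul_vec3)
  qed
  have conj: "mmul (c T) (mmul (c A) (c T)) = c A" "mmul (c T) (mmul (c B) (c T)) = c (mmul A B)"
    "mmul (c T') (mmul (c B) (c T')) = c B" "mmul (c T') (mmul (c A) (c T')) = c (mmul A B)"
  proof -
    have "mmul T (mmul A T) = A" "mmul T (mmul B T) = mmul A B" "mmul T' (mmul B T') = B" "mmul T' (mmul A T') = mmul A B"
      using nrm_conj[OF N(3) N(1)] nrm_conj[OF N(3) N(2)] nrm_conj[OF N(4) N(2)] nrm_conj[OF N(4) N(1)]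
        N(1,2) AB(2) nrm_unique unfolding S_conjugates by blast+
    then show "mmul (c T) (mmul (c A) (c T)) = c A" "mmul (c T) (mmul (c B) (c T)) = c (mmul A B)"
      "mmul (c T') (mmul (c B) (c T')) = c B" "mmul (c T') (mmul (c A) (c T')) = c (mmul A B)"
      by (simp_all only: cm)
  qed
  have sq: "mmul (c T) (c T) = one3" "mmul (c T') (c T') = one3" by (simp_all add: cm A2 c1)
  have det: "mdet (c T) = 1" "mdet (c T') = 1" by (simp_all add: cdet dT)
  have cAB: "c A = D1" "c B = D2" using D by (simp_all add: c_def)
  obtain \<beta> where \<beta>: "\<beta> \<noteq> 0" "c T = vec3 (vec3 (- 1) 0 0) (vec3 0 0 \<beta>) (vec3 0 (1 / \<beta>) 0)"
    by (rule involution_swapping_23[OF sq(1) det(1) conj(1)[unfolded cAB] conj(2)[unfolded cAB D3]])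
  obtain \<gamma> where \<gamma>: "\<gamma> \<noteq> 0" "c T' = vec3 (vec3 0 0 \<gamma>) (vec3 0 (- 1) 0) (vec3 (1 / \<gamma>) 0 0)"
    by (rule involution_swapping_13[OF sq(2) det(2) conj(3)[unfolded cAB] conj(4)[unfolded cAB D3]])
  define K K' where "K = diag3 (- \<gamma>) (- \<beta>) 1" and "K' = diag3 (- 1 / \<gamma>) (- 1 / \<beta>) 1"
  have KK: "mmul K' K = one3" "mmul K K' = one3"
    using \<beta>(1) \<gamma>(1) by (simp_all add: K_def K'_def diag3_def mmul_vec3 one3_vec3)
  define G H where "G = mmul G0 K" and "H = mmul K' H0"
  have HG: "mmul H G = one3"
  proof -
    have "mmul H G = mmul K' (mmul (mmul H0 G0) K)" by (simp only: G_def H_def mmul_assoc)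
    then show ?thesis by (simp add: HG0 KK)
  qed
  have conjc: "mmul H (mmul M G) = mmul K' (mmul (c M) K)" for M
    by (simp only: G_def H_def c_def mmul_assoc)
  show thesis
  proof (rule that[OF HG left_inverse_right_inverse[OF HG] N])
    show "mmul H (mmul A G) = D1" "mmul H (mmul B G) = D2" "mmul H (mmul T G) = T1" "mmul H (mmul T' G) = T2"
      unfolding conjc cAB \<beta>(2) \<gamma>(2) K_def K'_def diag3_def D1_def D2_def T1_def T2_def mmul_vec3
      using \<beta>(1) \<gamma>(1) by simp_all
  qed
qed

lemma proj_rep_conj:
  assumes "mmul H G = one3" "mmul G H = one3"
  shows "proj_rep (\<lambda>\<sigma>. mmul H (mmul (\<rho> \<sigma>) G))"
proof
  show "\<exists>c. c \<noteq> 0 \<and> mmul (mmul H (mmul (\<rho> \<sigma>) G)) (mmul H (mmul (\<rho> \<tau>) G)) = smul c (mmul H (mmul (\<rho> (\<sigma> \<circ> \<tau>)) G))"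
    if "\<sigma> \<in> A6" "\<tau> \<in> A6" for \<sigma> \<tau>
    using rho_mult[OF that] by (auto simp: conj_mult[OF assms(2)] smul_simps)
  have "mdet H * mdet G = 1" using assms(1) mdet_mmul by (metis mdet_one3)
  then show "mdet (mmul H (mmul (\<rho> \<sigma>) G)) \<noteq> 0" if "\<sigma> \<in> A6" for \<sigma>
    using rho_det[OF that] by (auto simp: mdet_mmul)
  show "\<sigma> = id" if "\<sigma> \<in> A6" "mmul H (mmul (\<rho> \<sigma>) G) = smul c one3" for \<sigma> c
  proof -
    have "\<rho> \<sigma> = mmul (mmul G H) (mmul (\<rho> \<sigma>) (mmul G H))" by (simp add: assms)
    also have "\<dots> = mmul G (mmul (mmul H (mmul (\<rho> \<sigma>) G)) H)" by (simp only: mmul_assoc)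
    also have "\<dots> = smul c one3" unfolding that(2) by (simp add: smul_simps assms)
    finally show ?thesis by (rule rho_faithful[OF that(1)])
  qed
qed

lemma nrm_conj_rep:
  assumes "mmul H G = one3" "mmul G H = one3" "nrm \<sigma> N"
  shows "proj_rep.nrm (\<lambda>\<sigma>. mmul H (mmul (\<rho> \<sigma>) G)) \<sigma> (mmul H (mmul N G))"
proof -
  interpret conj: proj_rep "\<lambda>\<sigma>. mmul H (mmul (\<rho> \<sigma>) G)" by (rule proj_rep_conj[OF assms(1,2)])
  have "mdet H * mdet G = 1" using assms(1) mdet_mmul by (metis mdet_one3)
  then show ?thesis
    using assms unfolding conj.nrm_def nrm_def conj.pr_def pr_def
    by (auto simp: smul_simps conj_mult[OF assms(2)] mdet_mmul)
qed

end

locale a6_coords = proj_rep +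
  assumes d1: "nrm (S 1 2 3 4) D1" and d2: "nrm (S 1 3 2 4) D2"
    and t1: "nrm (S 1 2 5 6) T1" and t2: "nrm (S 1 3 5 6) T2"
begin

text \<open>Two more involutions are words in the normalized ones; they supply further trace
  conditions with known matrices.\<close>

lemma more_lifts: "nrm (S 2 4 5 6) (mmul D2 T2)" "nrm (S 1 4 5 6) (mmul (mmul D1 D2) (mmul T1 (mmul T2 T1)))"
proof -
  show "nrm (S 2 4 5 6) (mmul D2 T2)"
    using nrm_commute(2)[OF d2 t2] by (simp only: S_products)
  have "nrm (S 1 4 2 3) (mmul D1 D2)"
    using nrm_commute(2)[OF d1 d2] by (simp only: S_products)
  moreover have "nrm (S 2 3 5 6) (mmul T1 (mmul T2 T1))"
    using nrm_conj[OF t1 t2] by (simp only: S_conjugates)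
  ultimately show "nrm (S 1 4 5 6) (mmul (mmul D1 D2) (mmul T1 (mmul T2 T1)))"
    using nrm_commute(2) S_products by metis
qed

lemma orders:
  "(S 1 2 3 5 \<circ> S 1 2 3 4) ^^ 3 = id" "(S 1 2 3 5 \<circ> S 1 2 5 6) ^^ 3 = id"
  "(S 1 2 3 5 \<circ> S 2 4 5 6) ^^ 3 = id" "(S 1 2 3 5 \<circ> S 1 4 5 6) ^^ 3 = id"
  "(S 1 2 3 5 \<circ> S 1 3 2 4) ^^ 5 = id"
  "S 1 2 3 5 \<circ> S 1 2 3 4 \<noteq> id" "S 1 2 3 5 \<circ> S 1 2 5 6 \<noteq> id"
  "S 1 2 3 5 \<circ> S 2 4 5 6 \<noteq> id" "S 1 2 3 5 \<circ> S 1 4 5 6 \<noteq> id" "S 1 2 3 5 \<circ> S 1 3 2 4 \<noteq> id"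
proof -
  show "(S 1 2 3 5 \<circ> S 1 2 3 4) ^^ 3 = id" "(S 1 2 3 5 \<circ> S 1 2 5 6) ^^ 3 = id"
    "(S 1 2 3 5 \<circ> S 2 4 5 6) ^^ 3 = id" "(S 1 2 3 5 \<circ> S 1 4 5 6) ^^ 3 = id"
    "(S 1 2 3 5 \<circ> S 1 3 2 4) ^^ 5 = id"
    by (intro A6_eqI A6_funpow A6_comp S_in_A6 A6_id; simp add: S_eval eval_nat_numeral)+
  have "(S 1 2 3 5 \<circ> S 1 2 3 4) 3 \<noteq> 3" "(S 1 2 3 5 \<circ> S 1 2 5 6) 3 \<noteq> 3"
    "(S 1 2 3 5 \<circ> S 2 4 5 6) 3 \<noteq> 3" "(S 1 2 3 5 \<circ> S 1 4 5 6) 3 \<noteq> 3" "(S 1 2 3 5 \<circ> S 1 3 2 4) 3 \<noteq> 3"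
    by (simp_all add: S_eval)
  then show "S 1 2 3 5 \<circ> S 1 2 3 4 \<noteq> id" "S 1 2 3 5 \<circ> S 1 2 5 6 \<noteq> id"
    "S 1 2 3 5 \<circ> S 2 4 5 6 \<noteq> id" "S 1 2 3 5 \<circ> S 1 4 5 6 \<noteq> id" "S 1 2 3 5 \<circ> S 1 3 2 4 \<noteq> id"
    by (auto simp del: comp_apply)
qed

text \<open>Traces against known lifts are linear in the entries of the unknown \<open>U\<close>;
  being its own adjugate adds quadratic equations. The product of order five contributes the golden
  ratio \<open>x\<close>.\<close>

lemma icosahedral_lift:
  obtains t w where "golden t w" "nrm (S 1 2 3 5) (smul (- 1) (golden.icosahedral t w))"
proof -
  have q: "(1, 2, 3, 5) \<in> set quads" by (simp add: quads_def)
  obtain U where U: "nrm (S 1 2 3 5) U"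
    using nrm_ex[OF quads_valid(1)[OF q] quads_valid(2)[OF q]] by blast
  obtain a b c d e f g h i where X: "U = vec3 (vec3 a b c) (vec3 d e f) (vec3 g h i)"
    using mat3_eta by metis
  define x where "x = trc (mmul U D2)"
  have "trc U = - 1" by (rule nrm_trc[OF U quads_valid(3)[OF q]])
  moreover have "trc (mmul U D1) = 0" "trc (mmul U T1) = 0" "trc (mmul U (mmul D2 T2)) = 0"
    "trc (mmul U (mmul (mmul D1 D2) (mmul T1 (mmul T2 T1)))) = 0"
    using product_order_3 U d1 t1 more_lifts orders by blast+
  moreover have x2: "x * x = x + 1"
    unfolding x_def using product_order_5 U d2 orders by blast
  ultimately have tr: "a + e + i = - 1" "a - e - i = 0" "- a - f - h = 0" "c - e + g = 0" "b + d - i = 0"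
    "x = - a + e - i"
    unfolding X x_def D1_def D2_def T1_def T2_def mmul_vec3 by (simp_all add: trc_def)
  have "adj3 U = U" by (rule nrm_adj3[OF U])
  then have adj: "e * i - f * h = a" "b * f - c * e = c" "d * h - e * g = g"
    unfolding X fun_eq_3 by (simp_all add: adj3_def mult.commute)
  have add_eqs: "p + p' = q + q'" if "p = q" "p' = q'" for p p' q q' :: complex
    using that by simp
  have a: "2 * a = - 1" using add_eqs[OF tr(1) tr(2)] by simp
  have e: "2 * e = x - 1" using add_eqs[OF tr(1) tr(6)[symmetric]] by simp
  have i: "2 * i = - x"
  proof -
    have "- (2 * i) = x" using add_eqs[OF tr(6)[symmetric] tr(2)] by simp
    then show ?thesis by (metis minus_minus)
  qed
  \<comment> \<open>The entries f and h have sum 1/2 and product 1/4, so -2 f is a root of w^2 + w +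
    1.\<close>
  define w where "w = - 2 * f"
  have f: "2 * f = - w" by (simp add: w_def)
  have h: "2 * h = 1 + w"
  proof -
    have "h = - a - f" using tr(3) by (metis right_minus_eq)
    then have "2 * h = - (2 * a) - 2 * f" by simp
    then show ?thesis by (simp add: a f)
  qed
  have "f * h = e * i - a" using adj(1) by (metis add_diff_cancel_left' diff_add_cancel)
  then have "4 * (f * h) = 4 * (e * i) - 4 * a" by simp
  also have "\<dots> = (2 * e) * (2 * i) - 2 * (2 * a)" by simp
  also have "\<dots> = 1" unfolding a e i using x2 by (simp add: algebra_simps)
  finally have "(2 * f) * (2 * h) = 1" by simp
  then have fh: "- w * (1 + w) = 1" unfolding f h .
  have "w * w = - w - (- w * (1 + w))" by (simp add: algebra_simps)
  then have w: "w * w = - w - 1" unfolding fh .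
  interpret golden x w by unfold_locales (rule x2, rule w)
  have "b + d = i" using tr(5) by simp
  then have "d = i - b" by (metis add_diff_cancel_left')
  then have d: "2 * d = - x - 2 * b" by (simp add: i right_diff_distrib)
  have g: "g = e - c" using tr(4) by (simp add: add_eq_0_iff)
  have bf: "b * f = c * (1 + e)" and dh: "d * h = g * (1 + e)"
    using adj(2,3) by (simp_all add: algebra_simps) 
  \<comment> \<open>Adding the two equations eliminates c, since c + g = e.\<close>
  have "4 * (b * f + d * h) = 4 * (e * (1 + e))" unfolding bf dh g by (simp add: algebra_simps)
  then have "(2 * b) * (2 * f) + (2 * d) * (2 * h) = (2 * e) * (2 + 2 * e)" by (simp add: algebra_simps)
  then have "2 * b * (- w) + (- x - 2 * b) * (1 + w) = (x - 1) * (2 + (x - 1))"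
    unfolding f d h e .
  then have "(2 * w + 1) * (2 * b) = - x * (2 + w)"
  proof -
    have "(2 * w + 1) * (2 * b) = - x * (1 + w) - (x * x - 1)
        - (2 * b * (- w) + (- x - 2 * b) * (1 + w) - (x - 1) * (2 + (x - 1)))"
      by (simp add: algebra_simps)
    also have "2 * b * (- w) + (- x - 2 * b) * (1 + w) - (x - 1) * (2 + (x - 1)) = 0"
      using \<open>2 * b * (- w) + (- x - 2 * b) * (1 + w) = (x - 1) * (2 + (x - 1))\<close>
      by (simp only: diff_self)
    finally show ?thesis by (simp add: x2 algebra_simps)
  qed
  \<comment> \<open>The square of 2 w + 1 is -3, so multiplication by 2 w + 1 solves for b.\<close>
  then have "(2 * w + 1) * ((2 * w + 1) * (2 * b)) = (2 * w + 1) * (- x * (2 + w))" by (simp only:)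
  also have "\<dots> = - 3 * (x * w)"
    by (simp add: algebra_simps w ww)
  also have "(2 * w + 1) * ((2 * w + 1) * (2 * b)) = - 3 * (2 * b)"
    by (simp add: algebra_simps w ww)
  finally have b: "2 * b = x * w" by simp
  have "4 * (c * (1 + e)) = 4 * (b * f)" by (simp add: bf)
  then have "(2 * c) * (2 + 2 * e) = (2 * b) * (2 * f)" by (simp add: algebra_simps)
  then have "(2 * c) * (x + 1) = - (x * (w * w))" unfolding b e f by (simp add: algebra_simps)
  \<comment> \<open>For a golden ratio x the inverse of x + 1 is 2 - x.\<close>
  then have "(2 * c) * ((x + 1) * (2 - x)) = - (x * (2 - x) * (w * w))" by (simp only: mult.assoc[symmetric]) (simp add: ac_simps)
  moreover have "(x + 1) * (2 - x) = 1" "x * (2 - x) = x - 1" by (simp_all add: algebra_simps x2)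
  ultimately have c: "2 * c = - ((x - 1) * (w * w))" by simp
  have half: "y = z / 2" if "2 * y = z" for y z :: complex using that by auto
  note entries = half[OF a] half[OF b] half[OF c] half[OF d] half[OF e] half[OF f] half[OF h] half[OF i]
  have "U = smul (- 1) icosahedral"
    unfolding X fun_eq_3 icosahedral_def smul_def
    unfolding vec3_simps entries g b by (simp add: field_simps w)
  then show thesis using U that golden_axioms by blast
qed

end

context golden
begin

definition line_list :: "(complex \<times> complex \<times> complex) list" where
  "line_list = (1, 0, 0) # concat (map (\<lambda>((b, c), es). map (\<lambda>e. (e, b, c)) es) tab)"

end

locale a6_golden = a6_coords \<rho> + golden t w
  for \<rho> :: "(nat \<Rightarrow> nat) \<Rightarrow> complex mat3" and t w :: complex +
  assumes u: "nrm (S 1 2 3 5) (smul (- 1) icosahedral)"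
begin

text \<open>The axis of \<sigma> has the equation \<open>a\<close>. A reflection has determinant -1,
  so the normalized lift is its negative.\<close>

definition R :: "(nat \<Rightarrow> nat) \<Rightarrow> (3 \<Rightarrow> complex) \<Rightarrow> bool" where
  "R \<sigma> a \<longleftrightarrow> (\<exists>v. (\<Sum>i\<in>UNIV. a i * v i) = 1 \<and> nrm \<sigma> (smul (- 1) (reflection a v)))"

lemma R_conj:
  assumes "R \<sigma> a" "nrm \<tau> M"
  shows "R (\<tau> \<circ> \<sigma> \<circ> \<tau>) (mvmul (tr3 M) a)"
proof -
  obtain v where v: "(\<Sum>i\<in>UNIV. a i * v i) = 1" "nrm \<sigma> (smul (- 1) (reflection a v))"
    using assms(1) unfolding R_def by blast
  have M: "mmul M M = one3" using assms(2) by (simp add: nrm_def)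
  have "nrm (\<tau> \<circ> \<sigma> \<circ> \<tau>) (smul (- 1) (reflection (mvmul (tr3 M) a) (mvmul M v)))"
    using nrm_conj[OF assms(2) v(2)] by (simp add: smul_simps reflection_conjugate[OF M])
  then show ?thesis unfolding R_def using dual_conjugate[OF M, of a v] v(1) by metis
qed

lemma R_scale:
  assumes "R \<sigma> (vec3 x y z)" "c \<noteq> 0" "x' = c * x" "y' = c * y" "z' = c * z"
  shows "R \<sigma> (vec3 x' y' z')"
proof -
  obtain v where v: "(\<Sum>i\<in>UNIV. vec3 x y z i * v i) = 1" "nrm \<sigma> (smul (- 1) (reflection (vec3 x y z) v))"
    using assms(1) unfolding R_def by blast
  have "reflection (vec3 x' y' z') (\<lambda>i. v i / c) = reflection (vec3 x y z) v"
    using assms(2-) by (simp add: fun_eq_3 reflection_def)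
  moreover have "(\<Sum>i\<in>UNIV. vec3 x' y' z' i * (v i / c)) = 1"
    using v(1) assms(2-) by (simp add: sum_UNIV_3)
  ultimately show ?thesis unfolding R_def using v(2) by metis
qed

text \<open>A sufficient condition for equality of double transpositions that simplification decides
  on numerals.\<close>

definition same :: "nat \<Rightarrow> nat \<Rightarrow> nat \<Rightarrow> nat \<Rightarrow> nat \<Rightarrow> nat \<Rightarrow> nat \<Rightarrow> nat \<Rightarrow> bool" where
  "same a b c d a' b' c' d' \<longleftrightarrow>
    ((a = a' \<and> b = b' \<or> a = b' \<and> b = a') \<and> (c = c' \<and> d = d' \<or> c = d' \<and> d = c')) \<or>
    ((a = c' \<and> b = d' \<or> a = d' \<and> b = c') \<and> (c = a' \<and> d = b' \<or> c = b' \<and> d = a') \<and>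
      a \<noteq> c \<and> a \<noteq> d \<and> b \<noteq> c \<and> b \<noteq> d)"

lemma same_S:
  assumes "same a b c d a' b' c' d'"
  shows "S a b c d = S a' b' c' d'"
proof -
  have aligned: "S p q u v = S p' q' u' v'"
    if "p = p' \<and> q = q' \<or> p = q' \<and> q = p'" "u = u' \<and> v = v' \<or> u = v' \<and> v = u'" for p q u v p' q' u' v'
    using that by (elim disjE conjE; hypsubst; simp only: S_reorder(1,2))
  consider "a = a' \<and> b = b' \<or> a = b' \<and> b = a'" "c = c' \<and> d = d' \<or> c = d' \<and> d = c'"
    | "c = a' \<and> d = b' \<or> c = b' \<and> d = a'" "a = c' \<and> b = d' \<or> a = d' \<and> b = c'" "{a, b} \<inter> {c, d} = {}"
    using assms unfolding same_def by auto
  then show ?thesis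
  proof cases
    case 1
    then show ?thesis by (rule aligned)
  next
    case 2
    then show ?thesis using aligned[OF 2(1,2)] S_reorder(3)[OF 2(3)] by simp
  qed
qed

lemma step:
  assumes "R (S a b c d) v" "nrm \<tau> M" "\<tau> \<circ> \<tau> = id" "same (\<tau> a) (\<tau> b) (\<tau> c) (\<tau> d) a' b' c' d'"
  shows "R (S a' b' c' d') (mvmul (tr3 M) v)"
  using R_conj[OF assms(1,2)] S_conj[OF assms(3,3)] same_S[OF assms(4)] by simp

lemma R_neg: "R \<sigma> (vec3 x y z) \<Longrightarrow> R \<sigma> (vec3 (- x) (- y) (- z))"
  by (erule R_scale[where c = "- 1"]) simp_all

text \<open>Equations of axes matter only up to scalars; both signs are allowed so that
  representatives can be chosen freely.\<close>

lemma monomial_step: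
  assumes "R (S a b c d) (vec3 x y z)" "nrm \<tau> M" "\<tau> \<circ> \<tau> = id" "same (\<tau> a) (\<tau> b) (\<tau> c) (\<tau> d) a' b' c' d'"
    and "mvmul (tr3 M) (vec3 x y z) = vec3 x1 y1 z1"
    and "x' = x1 \<and> y' = y1 \<and> z' = z1 \<or> x' = - x1 \<and> y' = - y1 \<and> z' = - z1"
  shows "R (S a' b' c' d') (vec3 x' y' z')"
proof -
  have "R (S a' b' c' d') (vec3 x1 y1 z1)" using step[OF assms(1-4)] unfolding assms(5) .
  from this R_neg[OF this] show ?thesis using assms(6) by (elim disjE conjE) (simp_all only:)
qed

lemma involutive: "S 1 2 3 4 \<circ> S 1 2 3 4 = id" "S 1 3 2 4 \<circ> S 1 3 2 4 = id" "S 1 2 5 6 \<circ> S 1 2 5 6 = id"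
  "S 1 3 5 6 \<circ> S 1 3 5 6 = id" "S 1 2 3 5 \<circ> S 1 2 3 5 = id"
  by (rule S_invol; simp)+

lemma step_D1:
  assumes "R (S a b c d) (vec3 x y z)"
    and "same (S 1 2 3 4 a) (S 1 2 3 4 b) (S 1 2 3 4 c) (S 1 2 3 4 d) a' b' c' d'"
    and "x' = x \<and> y' = - y \<and> z' = - z \<or> x' = - x \<and> y' = y \<and> z' = z"
  shows "R (S a' b' c' d') (vec3 x' y' z')"
  by (rule monomial_step[OF assms(1) d1 involutive(1) assms(2), of x "- y" "- z"])
    (use assms(3) in \<open>simp_all add: D1_def mvmul_tr3_vec3\<close>)

lemma step_D2:
  assumes "R (S a b c d) (vec3 x y z)"
    and "same (S 1 3 2 4 a) (S 1 3 2 4 b) (S 1 3 2 4 c) (S 1 3 2 4 d) a' b' c' d'"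
    and "x' = x \<and> y' = - y \<and> z' = z \<or> x' = - x \<and> y' = y \<and> z' = - z"
  shows "R (S a' b' c' d') (vec3 x' y' z')"
  by (rule monomial_step[OF assms(1) d2 involutive(2) assms(2), of "- x" y "- z"])
    (use assms(3) in \<open>auto simp add: D2_def mvmul_tr3_vec3\<close>)

lemma step_T1:
  assumes "R (S a b c d) (vec3 x y z)"
    and "same (S 1 2 5 6 a) (S 1 2 5 6 b) (S 1 2 5 6 c) (S 1 2 5 6 d) a' b' c' d'"
    and "x' = x \<and> y' = z \<and> z' = y \<or> x' = - x \<and> y' = - z \<and> z' = - y"
  shows "R (S a' b' c' d') (vec3 x' y' z')"
  by (rule monomial_step[OF assms(1) t1 involutive(3) assms(2), of "- x" "- z" "- y"])
    (use assms(3) in \<open>auto simp add: T1_def mvmul_tr3_vec3\<close>)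

lemma step_T2:
  assumes "R (S a b c d) (vec3 x y z)"
    and "same (S 1 3 5 6 a) (S 1 3 5 6 b) (S 1 3 5 6 c) (S 1 3 5 6 d) a' b' c' d'"
    and "x' = z \<and> y' = y \<and> z' = x \<or> x' = - z \<and> y' = - y \<and> z' = - x"
  shows "R (S a' b' c' d') (vec3 x' y' z')"
  by (rule monomial_step[OF assms(1) t2 involutive(4) assms(2), of "- z" "- y" "- x"])
    (use assms(3) in \<open>auto simp add: T2_def mvmul_tr3_vec3\<close>)

text \<open>The only conjugation by a matrix that is not monomial; it leads to the axes containing
  \<open>k\<close>.\<close>

lemma step_U:
  assumes "R (S a b c d) (vec3 (t * w) 1 (- (s * (w * w))))"
    and "same (S 1 2 3 5 a) (S 1 2 3 5 b) (S 1 2 3 5 c) (S 1 2 3 5 d) a' b' c' d'"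
  shows "R (S a' b' c' d') (vec3 k 1 1)"
proof -
  have "mvmul (tr3 (smul (- 1) icosahedral)) (vec3 (t * w) 1 (- (s * (w * w))))
      = (\<lambda>i. - mvmul (tr3 icosahedral) (vec3 (t * w) 1 (- (s * (w * w)))) i)"
    by (intro ext) (simp add: mvmul_def tr3_def smul_def sum_UNIV_3)
  also have "\<dots> = vec3 (w * w * k) (w * w) (w * w)"
    unfolding icosahedral_def mvmul_tr3_vec3 fun_eq_3
    by (simp add: s_def k_def field_simps t w tt ww)
  finally have R: "R (S a' b' c' d') (vec3 (w * w * k) (w * w) (w * w))"
    using step[OF assms(1) u involutive(5) assms(2)] by simp
  have wk: "w * (w * w * k) = k" by (simp only: mult.assoc[symmetric]) (simp add: mult.assoc www)
  show ?thesis by (rule R_scale[OF R nonzero(3)]) (simp_all only: wk www)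
qed

lemma base_d1: "R (S 1 2 3 4) (vec3 1 0 0)"
proof -
  have "smul (- 1) (reflection (vec3 1 0 0) (vec3 1 0 0)) = D1"
    by (simp add: fun_eq_3 smul_def reflection_def one3_def D1_def)
  then show ?thesis using d1 unfolding R_def
    by (intro exI[of _ "vec3 1 0 0"]) (simp add: sum_UNIV_3)
qed

lemma base_t: "R (S 1 2 5 6) (vec3 0 1 (- 1))"
proof -
  have "smul (- 1) (reflection (vec3 0 1 (- 1)) (vec3 0 (1 / 2) (- 1 / 2))) = T1"
    by (simp add: fun_eq_3 smul_def reflection_def one3_def T1_def)
  then show ?thesis using t1 unfolding R_def
    by (intro exI[of _ "vec3 0 (1 / 2) (- 1 / 2)"]) (simp add: sum_UNIV_3)
qed

lemma base_u: "R (S 1 2 3 5) (vec3 1 (t * w) (- (s * (w * w))))"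
  unfolding R_def using icosahedral_reflection u by metis

lemma rels: "t * w * (s * (w * w)) = 1" "s * (w * w) * (t * w) = 1" "t * w * (t * w) = t * t * (w * w)"
  "s * (w * w) * (s * (w * w)) = s * s * w" "k' * k = 1"
proof -
  have "t * w * (s * (w * w)) = (t * s) * (w * (w * w))" by (simp only: ac_simps)
  then show "t * w * (s * (w * w)) = 1" by (simp add: ts www)
  then show "s * (w * w) * (t * w) = 1" by (simp only: mult.commute)
  have "s * (w * w) * (s * (w * w)) = s * s * (w * (w * (w * w)))" by (simp only: ac_simps)
  then show "s * (w * w) * (s * (w * w)) = s * s * w" by (simp add: www)
qed (simp_all only: ac_simps kk' mult.commute[of k' k])

lemmas conj_simps = same_def S_eval

text \<open>The axes of \<open>D1\<close>, \<open>T1\<close> and the icosahedral lift are the seeds.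
  Every further fact \<open>r\<close> conjugates an earlier one by a known lift, and the facts
  \<open>l\<close> rescale to the representatives in \<open>tab\<close>.\<close>

lemma involution_lines: "list_all2 (\<lambda>(a, b, c, d) (x, y, z). R (S a b c d) (vec3 x y z)) quads line_list"
proof -
  have r0: "R (S 1 2 3 4) (vec3 1 0 0)"
    by (rule base_d1)
  have r1: "R (S 1 2 5 6) (vec3 0 1 (- 1))"
    by (rule base_t)
  have r2: "R (S 1 2 3 5) (vec3 1 (t * w) (- (s * (w * w))))"
    by (rule base_u)
  have r3: "R (S 1 4 2 3) (vec3 0 0 1)"
    by (rule step_T2[OF r0]) (simp_all add: conj_simps)
  have r4: "R (S 3 4 5 6) (vec3 0 1 1)"
    by (rule step_D2[OF r1]) (simp_all add: conj_simps)
  have r5: "R (S 2 3 5 6) (vec3 1 (- 1) 0)"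
    by (rule step_T2[OF r1]) (simp_all add: conj_simps)
  have r6: "R (S 1 2 4 5) (vec3 1 (- (t * w)) (s * (w * w)))"
    by (rule step_D1[OF r2]) (simp_all add: conj_simps)
  have r7: "R (S 1 5 3 4) (vec3 1 (- (t * w)) (- (s * (w * w))))"
    by (rule step_D2[OF r2]) (simp_all add: conj_simps)
  have r8: "R (S 1 2 3 6) (vec3 1 (- (s * (w * w))) (t * w))"
    by (rule step_T1[OF r2]) (simp_all add: conj_simps)
  have r9: "R (S 1 6 2 3) (vec3 (s * (w * w)) (- (t * w)) (- 1))"
    by (rule step_T2[OF r2]) (simp_all add: conj_simps)
  have r10: "R (S 1 3 2 4) (vec3 0 1 0)"
    by (rule step_T1[OF r3]) (simp_all add: conj_simps)
  have r11: "R (S 1 4 5 6) (vec3 1 1 0)"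
    by (rule step_T2[OF r4]) (simp_all add: conj_simps)
  have r12: "R (S 1 3 5 6) (vec3 1 0 (- 1))"
    by (rule step_T1[OF r5]) (simp_all add: conj_simps)
  have r13: "R (S 2 5 3 4) (vec3 1 (t * w) (s * (w * w)))"
    by (rule step_D2[OF r6]) (simp_all add: conj_simps)
  have r14: "R (S 1 2 4 6) (vec3 1 (s * (w * w)) (- (t * w)))"
    by (rule step_T1[OF r6]) (simp_all add: conj_simps)
  have r15: "R (S 2 3 4 6) (vec3 (s * (w * w)) (- (t * w)) 1)"
    by (rule step_T2[OF r6]) (simp_all add: conj_simps)
  have r16: "R (S 2 6 3 4) (vec3 1 (- (s * (w * w))) (- (t * w)))"
    by (rule step_T1[OF r7]) (simp_all add: conj_simps)
  have r17: "R (S 1 4 3 6) (vec3 (s * (w * w)) (t * w) (- 1))"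
    by (rule step_T2[OF r7]) (simp_all add: conj_simps)
  have r18: "R (S 1 6 3 4) (vec3 1 (s * (w * w)) (t * w))"
    by (rule step_D2[OF r8]) (simp_all add: conj_simps)
  have r19: "R (S 1 5 2 3) (vec3 (t * w) (- (s * (w * w))) 1)"
    by (rule step_T2[OF r8]) (simp_all add: conj_simps)
  have r20: "R (S 1 4 2 6) (vec3 (s * (w * w)) (t * w) 1)"
    by (rule step_D1[OF r9]) (simp_all add: conj_simps)
  have r21: "R (S 1 3 2 5) (vec3 (s * (w * w)) (- 1) (- (t * w)))"
    by (rule step_T1[OF r9]) (simp_all add: conj_simps)
  have r22: "R (S 2 4 5 6) (vec3 1 0 1)"
    by (rule step_T1[OF r11]) (simp_all add: conj_simps)
  have r23: "R (S 2 3 4 5) (vec3 (t * w) (- (s * (w * w))) (- 1))"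
    by (rule step_T2[OF r14]) (simp_all add: conj_simps)
  have r24: "R (S 1 3 4 5) (vec3 (s * (w * w)) 1 (- (t * w)))"
    by (rule step_T1[OF r15]) (simp_all add: conj_simps)
  have r25: "R (S 1 4 2 5) (vec3 (t * w) (s * (w * w)) (- 1))"
    by (rule step_T2[OF r16]) (simp_all add: conj_simps)
  have r26: "R (S 2 4 3 5) (vec3 (s * (w * w)) (- 1) (t * w))"
    by (rule step_T1[OF r17]) (simp_all add: conj_simps)
  have r27: "R (S 1 4 3 5) (vec3 (t * w) (s * (w * w)) 1)"
    by (rule step_T2[OF r18]) (simp_all add: conj_simps)
  have r28: "R (S 1 3 2 6) (vec3 (t * w) 1 (- (s * (w * w))))"
    by (rule step_T1[OF r19]) (simp_all add: conj_simps)
  have r29: "R (S 1 5 2 4) (vec3 (s * (w * w)) 1 (t * w))"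
    by (rule step_T1[OF r20]) (simp_all add: conj_simps)
  have r30: "R (S 1 3 4 6) (vec3 (t * w) (- 1) (- (s * (w * w))))"
    by (rule step_T1[OF r23]) (simp_all add: conj_simps)
  have r31: "R (S 1 6 2 4) (vec3 (t * w) (- 1) (s * (w * w)))"
    by (rule step_T1[OF r25]) (simp_all add: conj_simps)
  have r32: "R (S 2 4 3 6) (vec3 (t * w) 1 (s * (w * w)))"
    by (rule step_T1[OF r27]) (simp_all add: conj_simps)
  \<comment> \<open>The 33 axes found so far are closed under the monomial steps; the last twelve,
    those with \<open>k\<close>, are entered through the icosahedral lift.\<close>
  have r33: "R (S 1 6 2 5) (vec3 k 1 1)"
    by (rule step_U[OF r28]) (simp_all add: conj_simps)
  have r34: "R (S 1 5 2 6) (vec3 k (- 1) (- 1))"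
    by (rule step_D1[OF r33]) (simp_all add: conj_simps)
  have r35: "R (S 3 6 4 5) (vec3 k (- 1) 1)"
    by (rule step_D2[OF r33]) (simp_all add: conj_simps)
  have r36: "R (S 2 6 3 5) (vec3 1 1 k)"
    by (rule step_T2[OF r33]) (simp_all add: conj_simps)
  have r37: "R (S 3 5 4 6) (vec3 k 1 (- 1))"
    by (rule step_D2[OF r34]) (simp_all add: conj_simps)
  have r38: "R (S 2 5 3 6) (vec3 1 1 (- k))"
    by (rule step_T2[OF r34]) (simp_all add: conj_simps)
  have r39: "R (S 1 5 4 6) (vec3 1 (- 1) k)"
    by (rule step_T2[OF r35]) (simp_all add: conj_simps)
  have r40: "R (S 1 6 4 5) (vec3 1 (- 1) (- k))"
    by (rule step_D1[OF r36]) (simp_all add: conj_simps)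
  have r41: "R (S 1 5 3 6) (vec3 1 k 1)"
    by (rule step_T1[OF r36]) (simp_all add: conj_simps)
  have r42: "R (S 1 6 3 5) (vec3 1 (- k) 1)"
    by (rule step_T1[OF r38]) (simp_all add: conj_simps)
  have r43: "R (S 2 6 4 5) (vec3 1 k (- 1))"
    by (rule step_T1[OF r39]) (simp_all add: conj_simps)
  have r44: "R (S 2 5 4 6) (vec3 1 (- k) (- 1))"
    by (rule step_T1[OF r40]) (simp_all add: conj_simps)
  have l0: "R (S 1 2 3 4) (vec3 (1) (0) (0))"
    by (rule R_scale[OF r0, of "1"]) (simp_all add: nonzero rels)
  have l1: "R (S 1 4 2 3) (vec3 (0) (0) (1))"
    by (rule R_scale[OF r3, of "1"]) (simp_all add: nonzero rels)
  have l2: "R (S 2 4 5 6) (vec3 (1) (0) (1))"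
    by (rule R_scale[OF r22, of "1"]) (simp_all add: nonzero rels)
  have l3: "R (S 1 3 5 6) (vec3 (- 1) (0) (1))"
    by (rule R_scale[OF r12, of "- (1)"]) (simp_all add: nonzero rels)
  have l4: "R (S 1 3 2 4) (vec3 (0) (1) (0))"
    by (rule R_scale[OF r10, of "1"]) (simp_all add: nonzero rels)
  have l5: "R (S 1 4 5 6) (vec3 (1) (1) (0))"
    by (rule R_scale[OF r11, of "1"]) (simp_all add: nonzero rels)
  have l6: "R (S 2 3 5 6) (vec3 (- 1) (1) (0))"
    by (rule R_scale[OF r5, of "- (1)"]) (simp_all add: nonzero rels)
  have l7: "R (S 3 4 5 6) (vec3 (0) (1) (1))"
    by (rule R_scale[OF r4, of "1"]) (simp_all add: nonzero rels)
  have l8: "R (S 1 6 2 5) (vec3 (k) (1) (1))"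
    by (rule R_scale[OF r33, of "1"]) (simp_all add: nonzero rels)
  have l9: "R (S 1 5 2 6) (vec3 (- k) (1) (1))"
    by (rule R_scale[OF r34, of "- (1)"]) (simp_all add: nonzero rels)
  have l10: "R (S 1 2 5 6) (vec3 (0) (1) (- 1))"
    by (rule R_scale[OF r1, of "1"]) (simp_all add: nonzero rels)
  have l11: "R (S 3 5 4 6) (vec3 (k) (1) (- 1))"
    by (rule R_scale[OF r37, of "1"]) (simp_all add: nonzero rels)
  have l12: "R (S 3 6 4 5) (vec3 (- k) (1) (- 1))"
    by (rule R_scale[OF r35, of "- (1)"]) (simp_all add: nonzero rels)
  have l13: "R (S 2 6 3 5) (vec3 (1) (1) (k))"
    by (rule R_scale[OF r36, of "1"]) (simp_all add: nonzero rels)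
  have l14: "R (S 1 6 4 5) (vec3 (- 1) (1) (k))"
    by (rule R_scale[OF r40, of "- (1)"]) (simp_all add: nonzero rels)
  have l15: "R (S 2 5 3 6) (vec3 (1) (1) (- k))"
    by (rule R_scale[OF r38, of "1"]) (simp_all add: nonzero rels)
  have l16: "R (S 1 5 4 6) (vec3 (- 1) (1) (- k))"
    by (rule R_scale[OF r39, of "- (1)"]) (simp_all add: nonzero rels)
  have l17: "R (S 1 5 3 6) (vec3 (k') (1) (k'))"
    by (rule R_scale[OF r41, of "k'"]) (simp_all add: nonzero rels)
  have l18: "R (S 2 5 4 6) (vec3 (- k') (1) (k'))"
    by (rule R_scale[OF r44, of "- (k')"]) (simp_all add: nonzero rels)
  have l19: "R (S 2 6 4 5) (vec3 (k') (1) (- k'))"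
    by (rule R_scale[OF r43, of "k'"]) (simp_all add: nonzero rels)
  have l20: "R (S 1 6 3 5) (vec3 (- k') (1) (- k'))"
    by (rule R_scale[OF r42, of "- (k')"]) (simp_all add: nonzero rels)
  have l21: "R (S 2 5 3 4) (vec3 (s * (w * w)) (1) (s * s * w))"
    by (rule R_scale[OF r13, of "s * (w * w)"]) (simp_all add: nonzero rels)
  have l22: "R (S 1 5 3 4) (vec3 (- (s * (w * w))) (1) (s * s * w))"
    by (rule R_scale[OF r7, of "- (s * (w * w))"]) (simp_all add: nonzero rels)
  have l23: "R (S 1 2 3 5) (vec3 (s * (w * w)) (1) (- (s * s * w)))"
    by (rule R_scale[OF r2, of "s * (w * w)"]) (simp_all add: nonzero rels)
  have l24: "R (S 1 2 4 5) (vec3 (- (s * (w * w))) (1) (- (s * s * w)))"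
    by (rule R_scale[OF r6, of "- (s * (w * w))"]) (simp_all add: nonzero rels)
  have l25: "R (S 1 6 3 4) (vec3 (t * w) (1) (t * t * (w * w)))"
    by (rule R_scale[OF r18, of "t * w"]) (simp_all add: nonzero rels)
  have l26: "R (S 2 6 3 4) (vec3 (- (t * w)) (1) (t * t * (w * w)))"
    by (rule R_scale[OF r16, of "- (t * w)"]) (simp_all add: nonzero rels)
  have l27: "R (S 1 2 4 6) (vec3 (t * w) (1) (- (t * t * (w * w))))"
    by (rule R_scale[OF r14, of "t * w"]) (simp_all add: nonzero rels)
  have l28: "R (S 1 2 3 6) (vec3 (- (t * w)) (1) (- (t * t * (w * w))))"
    by (rule R_scale[OF r8, of "- (t * w)"]) (simp_all add: nonzero rels)
  have l29: "R (S 1 4 3 5) (vec3 (t * t * (w * w)) (1) (t * w))"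
    by (rule R_scale[OF r27, of "t * w"]) (simp_all add: nonzero rels)
  have l30: "R (S 2 3 4 5) (vec3 (- (t * t * (w * w))) (1) (t * w))"
    by (rule R_scale[OF r23, of "- (t * w)"]) (simp_all add: nonzero rels)
  have l31: "R (S 1 5 2 4) (vec3 (s * (w * w)) (1) (t * w))"
    by (rule R_scale[OF r29, of "1"]) (simp_all add: nonzero rels)
  have l32: "R (S 1 3 2 5) (vec3 (- (s * (w * w))) (1) (t * w))"
    by (rule R_scale[OF r21, of "- (1)"]) (simp_all add: nonzero rels)
  have l33: "R (S 1 4 2 5) (vec3 (t * t * (w * w)) (1) (- (t * w)))"
    by (rule R_scale[OF r25, of "t * w"]) (simp_all add: nonzero rels)
  have l34: "R (S 1 5 2 3) (vec3 (- (t * t * (w * w))) (1) (- (t * w)))"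
    by (rule R_scale[OF r19, of "- (t * w)"]) (simp_all add: nonzero rels)
  have l35: "R (S 1 3 4 5) (vec3 (s * (w * w)) (1) (- (t * w)))"
    by (rule R_scale[OF r24, of "1"]) (simp_all add: nonzero rels)
  have l36: "R (S 2 4 3 5) (vec3 (- (s * (w * w))) (1) (- (t * w)))"
    by (rule R_scale[OF r26, of "- (1)"]) (simp_all add: nonzero rels)
  have l37: "R (S 2 4 3 6) (vec3 (t * w) (1) (s * (w * w)))"
    by (rule R_scale[OF r32, of "1"]) (simp_all add: nonzero rels)
  have l38: "R (S 1 3 4 6) (vec3 (- (t * w)) (1) (s * (w * w)))"
    by (rule R_scale[OF r30, of "- (1)"]) (simp_all add: nonzero rels)
  have l39: "R (S 1 4 2 6) (vec3 (s * s * w) (1) (s * (w * w)))"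
    by (rule R_scale[OF r20, of "s * (w * w)"]) (simp_all add: nonzero rels)
  have l40: "R (S 1 6 2 3) (vec3 (- (s * s * w)) (1) (s * (w * w)))"
    by (rule R_scale[OF r9, of "- (s * (w * w))"]) (simp_all add: nonzero rels)
  have l41: "R (S 1 3 2 6) (vec3 (t * w) (1) (- (s * (w * w))))"
    by (rule R_scale[OF r28, of "1"]) (simp_all add: nonzero rels)
  have l42: "R (S 1 6 2 4) (vec3 (- (t * w)) (1) (- (s * (w * w))))"
    by (rule R_scale[OF r31, of "- (1)"]) (simp_all add: nonzero rels)
  have l43: "R (S 1 4 3 6) (vec3 (s * s * w) (1) (- (s * (w * w))))"
    by (rule R_scale[OF r17, of "s * (w * w)"]) (simp_all add: nonzero rels)
  have l44: "R (S 2 3 4 6) (vec3 (- (s * s * w)) (1) (- (s * (w * w))))"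
    by (rule R_scale[OF r15, of "- (s * (w * w))"]) (simp_all add: nonzero rels)
  show ?thesis
    unfolding quads_def line_list_def tab_def
    by (simp only: list.map concat.simps append.simps prod.case list_all2_Cons list_all2_Nil2 simp_thms)
      (intro conjI; (rule refl TrueI)?; fact)
qed

end

section \<open>From cosets in PGL3 and projective lines to matrices and covectors\<close>

section \<open>Projective lines and cosets of matrices\<close>

definition m3 :: "complex mat \<Rightarrow> complex mat3" where
  "m3 M i j = M $$ (idx i, idx j)"

lemma idx_eq_iff [simp]: "idx i = idx j \<longleftrightarrow> i = j"
  using of_nat_idx by metis

lemma m3_mult: "A \<in> carrier_mat 3 3 \<Longrightarrow> B \<in> carrier_mat 3 3 \<Longrightarrow> m3 (A * B) = mmul (m3 A) (m3 B)"
  by (intro ext) (simp add: m3_def mmul_def scalar_prod_def sum_less_3)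

lemma m3_smult: "A \<in> carrier_mat 3 3 \<Longrightarrow> m3 (c \<cdot>\<^sub>m A) = smul c (m3 A)"
  by (intro ext) (simp add: m3_def smul_def)

lemma m3_one: "m3 (1\<^sub>m 3) = one3"
  by (intro ext) (simp add: m3_def one3_def)

lemma m3_inject:
  assumes "A \<in> carrier_mat 3 3" "B \<in> carrier_mat 3 3" "m3 A = m3 B"
  shows "A = B"
proof (rule eq_matI)
  fix i j assume "i < dim_row B" "j < dim_col B"
  then have "A $$ (i, j) = m3 A (of_nat i) (of_nat j)" "B $$ (i, j) = m3 B (of_nat i) (of_nat j)"
    using assms(2) by (simp_all add: m3_def idx_of_nat)
  then show "A $$ (i, j) = B $$ (i, j)" using assms(3) by simp
qed (use assms in auto)

lemma mat_mult_m3: "M \<in> carrier_mat 3 3 \<Longrightarrow> M *\<^sub>v of3 u = of3 (mvmul (m3 M) u)"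
  by (intro eq_vecI) (simp_all add: scalar_prod_def of3_def sum_less_3 mvmul_def m3_def idx_of_nat)

lemma smult_of3: "c \<cdot>\<^sub>v of3 u = of3 (\<lambda>i. c * u i)"
  by (intro eq_vecI) (simp_all add: of3_def)

lemma scalar_prod_of3: "of3 a \<bullet> of3 v = (\<Sum>i\<in>UNIV. a i * v i)"
  by (simp add: scalar_prod_def of3_def sum_less_3)

lemma mvmul_scale: "mvmul A (\<lambda>i. c * u i) = (\<lambda>i. c * mvmul A u i)"
  by (intro ext) (simp add: mvmul_def sum_UNIV_3 algebra_simps)

lemma mvmul_smul: "mvmul (smul c A) u = (\<lambda>i. c * mvmul A u i)"
  by (intro ext) (simp add: mvmul_def smul_def sum_UNIV_3 algebra_simps)

lemma mvmul_eq_0: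
  fixes A :: "complex mat3"
  assumes "mdet A \<noteq> 0" "mvmul A u = (\<lambda>_. 0)"
  shows "u = (\<lambda>_. 0)"
proof -
  let ?B = "smul (1 / mdet A) (adj3 A)"
  have "mmul A ?B = one3"
    using assms(1) by (intro ext) (simp add: smul_simps, simp add: smul_def mmul_adj3 one3_def)
  then have "mmul ?B A = one3" by (rule left_inverse_right_inverse)
  then have "u = mvmul ?B (mvmul A u)" by (metis mvmul_mmul mvmul_one3)
  then show ?thesis unfolding assms(2) by (simp add: mvmul_def fun_eq_iff)
qed

lemma carrier_GL3:
  assumes "M \<in> carrier GL3"
  shows "M \<in> carrier_mat 3 3" "mdet (m3 M) \<noteq> 0"
proof -
  obtain N where N: "M \<in> carrier_mat 3 3" "N \<in> carrier_mat 3 3" "N * M = 1\<^sub>m 3"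
    using assms by (auto simp: GL3_def units_of_def Units_def ring_mat_def)
  then have "mmul (m3 N) (m3 M) = one3" using m3_mult m3_one by metis
  then have "mdet (m3 N) * mdet (m3 M) = 1" by (metis mdet_mmul mdet_one3)
  then show "M \<in> carrier_mat 3 3" "mdet (m3 M) \<noteq> 0" using N by auto
qed

lemma coset_scalars3:
  assumes "M \<in> carrier_mat 3 3"
  shows "scalars3 #>\<^bsub>GL3\<^esub> M = {c \<cdot>\<^sub>m M | c. c \<noteq> 0}"
proof -
  have "c \<cdot>\<^sub>m 1\<^sub>m 3 * M = c \<cdot>\<^sub>m M" for c
    using mult_smult_assoc_mat[OF one_carrier_mat assms] assms by simp
  then show ?thesis
    by (auto simp: r_coset_def scalars3_def GL3_def units_of_def ring_mat_def)
qed

lemma smult_smult_mat: "a \<cdot>\<^sub>m (b \<cdot>\<^sub>m A) = (a * b) \<cdot>\<^sub>m (A :: complex mat)"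
  by (rule eq_matI) simp_all

text \<open>One matrix is chosen in each coset; the coset then consists of its nonzero
  multiples.\<close>

lemma proj_rep_of_mon:
  assumes "\<phi> \<in> Group.mon (alt_group 6) PGL3"
  obtains \<rho> where "proj_rep \<rho>"
    "\<forall>\<sigma>\<in>A6. \<exists>M\<in>carrier_mat 3 3. m3 M = \<rho> \<sigma> \<and> \<phi> \<sigma> = {c \<cdot>\<^sub>m M | c. c \<noteq> 0}"
proof -
  have inj: "inj_on \<phi> A6" and closed: "\<And>\<sigma>. \<sigma> \<in> A6 \<Longrightarrow> \<phi> \<sigma> \<in> carrier PGL3"
    using assms by (auto simp: Group.mon_def hom_def)
  have mult: "\<phi> (\<sigma> \<circ> \<tau>) = \<phi> \<sigma> <#>\<^bsub>GL3\<^esub> \<phi> \<tau>" if "\<sigma> \<in> A6" "\<tau> \<in> A6" for \<sigma> \<tau>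
    using assms that by (auto simp: Group.mon_def hom_def alt_group_mult PGL3_def)
  have ex: "\<exists>M. M \<in> carrier GL3 \<and> \<phi> \<sigma> = {c \<cdot>\<^sub>m M | c. c \<noteq> 0}" if \<sigma>: "\<sigma> \<in> A6" for \<sigma>
  proof -
    obtain M where "M \<in> carrier GL3" "\<phi> \<sigma> = scalars3 #>\<^bsub>GL3\<^esub> M"
      using closed[OF \<sigma>] unfolding PGL3_def carrier_FactGroup by blast
    then show ?thesis using coset_scalars3[OF carrier_GL3(1)] by auto
  qed
  define M where "M \<sigma> = (SOME N. N \<in> carrier GL3 \<and> \<phi> \<sigma> = {c \<cdot>\<^sub>m N | c. c \<noteq> 0})" for \<sigma>
  have M: "M \<sigma> \<in> carrier GL3" and \<phi>: "\<phi> \<sigma> = {c \<cdot>\<^sub>m M \<sigma> | c. c \<noteq> 0}" if "\<sigma> \<in> A6" for \<sigma>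
    using someI_ex[OF ex[OF that]] unfolding M_def by (rule conjunct1, rule conjunct2)
  note C = carrier_GL3(1)[OF M]
  have in_\<phi>: "M \<sigma> \<in> \<phi> \<sigma>" if "\<sigma> \<in> A6" for \<sigma>
    unfolding \<phi>[OF that] using C[OF that] by (auto intro!: exI[of _ 1])
  have GL3_mult: "x \<otimes>\<^bsub>GL3\<^esub> y = x * y" for x y
    by (simp add: GL3_def units_of_def ring_mat_def)
  have "proj_rep (\<lambda>\<sigma>. m3 (M \<sigma>))"
  proof
    show "\<exists>c. c \<noteq> 0 \<and> mmul (m3 (M \<sigma>)) (m3 (M \<tau>)) = smul c (m3 (M (\<sigma> \<circ> \<tau>)))"
      if st: "\<sigma> \<in> A6" "\<tau> \<in> A6" for \<sigma> \<tau>
    proof -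
      have "M \<sigma> * M \<tau> \<in> \<phi> (\<sigma> \<circ> \<tau>)"
        unfolding mult[OF st] set_mult_def GL3_mult using in_\<phi>[OF st(1)] in_\<phi>[OF st(2)] by blast
      then obtain c where "c \<noteq> 0" "M \<sigma> * M \<tau> = c \<cdot>\<^sub>m M (\<sigma> \<circ> \<tau>)"
        unfolding \<phi>[OF A6_comp[OF st]] by blast
      then show ?thesis
        using m3_mult[OF C[OF st(1)] C[OF st(2)]] m3_smult[OF C[OF A6_comp[OF st]], of c]
        by (intro exI[of _ c]) simp
    qed
    show "mdet (m3 (M \<sigma>)) \<noteq> 0" if "\<sigma> \<in> A6" for \<sigma>
      by (rule carrier_GL3(2)[OF M[OF that]])
    \<comment> \<open>The square of a scalar matrix stays in its coset, so \<open>\<phi>\<close>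
      agrees at \<sigma> and its square; injectivity makes \<sigma> idempotent, hence trivial as a
      permutation.\<close>
    show "\<sigma> = id" if \<sigma>: "\<sigma> \<in> A6" and scalar: "m3 (M \<sigma>) = smul c one3" for \<sigma> c
    proof -
      have "m3 (M \<sigma>) = m3 (c \<cdot>\<^sub>m 1\<^sub>m 3)" by (simp add: scalar m3_smult m3_one)
      then have Mc: "M \<sigma> = c \<cdot>\<^sub>m 1\<^sub>m 3" using m3_inject[OF C[OF \<sigma>]] by simp
      have c: "c \<noteq> 0"
        using carrier_GL3(2)[OF M[OF \<sigma>]] unfolding scalar by (auto simp: smul_def mdet_def det3_def)
      have "M \<sigma> * M \<sigma> = c \<cdot>\<^sub>m M \<sigma>" unfolding Mc
        using mult_smult_assoc_mat[of "1\<^sub>m 3" 3 3 "c \<cdot>\<^sub>m 1\<^sub>m 3 :: complex mat" 3 c] by simp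
      moreover have "M \<sigma> * M \<sigma> \<in> \<phi> (\<sigma> \<circ> \<sigma>)"
        unfolding mult[OF \<sigma> \<sigma>] set_mult_def GL3_mult using in_\<phi>[OF \<sigma>] by blast
      ultimately obtain d where d: "d \<noteq> 0" "c \<cdot>\<^sub>m M \<sigma> = d \<cdot>\<^sub>m M (\<sigma> \<circ> \<sigma>)"
        unfolding \<phi>[OF A6_comp[OF \<sigma> \<sigma>]] by auto
      have "M (\<sigma> \<circ> \<sigma>) = (c / d) \<cdot>\<^sub>m M \<sigma>"
      proof -
        have "(1 / d) \<cdot>\<^sub>m (c \<cdot>\<^sub>m M \<sigma>) = (1 / d) \<cdot>\<^sub>m (d \<cdot>\<^sub>m M (\<sigma> \<circ> \<sigma>))" by (simp only: d(2))
        moreover have "1 \<cdot>\<^sub>m M (\<sigma> \<circ> \<sigma>) = M (\<sigma> \<circ> \<sigma>)" by (rule eq_matI) simp_all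
        ultimately show ?thesis using d(1) by (simp add: smult_smult_mat)
      qed
      then have "\<phi> (\<sigma> \<circ> \<sigma>) = {e \<cdot>\<^sub>m ((c / d) \<cdot>\<^sub>m M \<sigma>) | e. e \<noteq> 0}"
        unfolding \<phi>[OF A6_comp[OF \<sigma> \<sigma>]] by simp
      also have "\<dots> = \<phi> \<sigma>"
      proof -
        have "(\<exists>e. X = e \<cdot>\<^sub>m ((c / d) \<cdot>\<^sub>m M \<sigma>) \<and> e \<noteq> 0) \<longleftrightarrow> (\<exists>e. X = e \<cdot>\<^sub>m M \<sigma> \<and> e \<noteq> 0)" for X
        proof
          assume "\<exists>e. X = e \<cdot>\<^sub>m ((c / d) \<cdot>\<^sub>m M \<sigma>) \<and> e \<noteq> 0"
          then obtain e where "X = (e * (c / d)) \<cdot>\<^sub>m M \<sigma>" "e * (c / d) \<noteq> 0"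
            using c d(1) by (auto simp: smult_smult_mat)
          then show "\<exists>e. X = e \<cdot>\<^sub>m M \<sigma> \<and> e \<noteq> 0" by blast
        next
          assume "\<exists>e. X = e \<cdot>\<^sub>m M \<sigma> \<and> e \<noteq> 0"
          then obtain e where "X = (e * (d / c)) \<cdot>\<^sub>m ((c / d) \<cdot>\<^sub>m M \<sigma>)" "e * (d / c) \<noteq> 0"
            using c d(1) by (auto simp: smult_smult_mat)
          then show "\<exists>e. X = e \<cdot>\<^sub>m ((c / d) \<cdot>\<^sub>m M \<sigma>) \<and> e \<noteq> 0" by blast
        qed
        then show ?thesis unfolding \<phi>[OF \<sigma>] by blast
      qed
      finally have "\<sigma> \<circ> \<sigma> = \<sigma>" using inj A6_comp[OF \<sigma> \<sigma>] \<sigma> by (simp add: inj_on_eq_iff)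
      then have "\<sigma> (\<sigma> x) = \<sigma> x" for x by (metis comp_apply)
      then have "\<sigma> x = x" for x by (rule injD[OF permutes_inj[OF A6_permutes[OF \<sigma>]]])
      then show ?thesis by (intro ext) simp
    qed
  qed
  then show thesis using that[of "\<lambda>\<sigma>. m3 (M \<sigma>)"] C \<phi> by blast
qed

definition pl :: "(3 \<Rightarrow> complex) \<Rightarrow> complex vec set set" where
  "pl a = proj_line (of3 a)"

abbreviation dot :: "(3 \<Rightarrow> complex) \<Rightarrow> (3 \<Rightarrow> complex) \<Rightarrow> complex" where
  "dot a v \<equiv> \<Sum>i\<in>UNIV. a i * v i"

lemma proj_lines_pl: "proj_lines = pl ` {a. a \<noteq> (\<lambda>_. 0)}"
proof -
  have "carrier_vec 3 - {0\<^sub>v 3} = of3 ` {a. a \<noteq> (\<lambda>_. 0 :: complex)}"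
    unfolding of3_0[symmetric] by (auto simp: of3_eq_iff elim!: carrier_vec_3E)
  then show ?thesis by (auto simp: proj_lines_def pl_def)
qed

lemma proj_plane_of3: "proj_plane = (\<lambda>u. proj_point (of3 u)) ` {u. u \<noteq> (\<lambda>_. 0)}"
proof -
  have "carrier_vec 3 - {0\<^sub>v 3} = of3 ` {a. a \<noteq> (\<lambda>_. 0 :: complex)}"
    unfolding of3_0[symmetric] by (auto simp: of3_eq_iff elim!: carrier_vec_3E)
  then show ?thesis by (auto simp: proj_plane_def)
qed

lemma proj_point_of3: "proj_point (of3 u) = {of3 (\<lambda>i. c * u i) | c. True}"
  by (auto simp: proj_point_def smult_of3)

lemma proj_point_eqD: "proj_point (of3 w) = proj_point (of3 u) \<Longrightarrow> \<exists>c. w = (\<lambda>i. c * u i)"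
proof -
  assume "proj_point (of3 w) = proj_point (of3 u)"
  moreover have "of3 w \<in> proj_point (of3 w)"
    unfolding proj_point_of3 by (auto intro!: exI[of _ 1])
  ultimately show ?thesis unfolding proj_point_of3 by (auto simp: of3_eq_iff)
qed

lemma proj_point_scale:
  assumes "c \<noteq> 0"
  shows "proj_point (of3 (\<lambda>i. c * u i)) = proj_point (of3 u)"
proof -
  have "(\<exists>d. x = of3 (\<lambda>i. d * (c * u i))) \<longleftrightarrow> (\<exists>d. x = of3 (\<lambda>i. d * u i))" for x
  proof
    assume "\<exists>d. x = of3 (\<lambda>i. d * (c * u i))"
    then obtain d where "x = of3 (\<lambda>i. (d * c) * u i)" by (auto simp: mult.assoc)
    then show "\<exists>d. x = of3 (\<lambda>i. d * u i)" by blast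
  next
    assume "\<exists>d. x = of3 (\<lambda>i. d * u i)"
    then obtain d where "x = of3 (\<lambda>i. (d / c) * (c * u i))" using assms by auto
    then show "\<exists>d. x = of3 (\<lambda>i. d * (c * u i))" by blast
  qed
  then show ?thesis unfolding proj_point_of3 by auto
qed

lemma dot_scale: "dot a (\<lambda>i. c * u i) = c * dot a u" "dot (\<lambda>i. c * a i) u = c * dot a u"
  by (simp_all add: sum_distrib_left ac_simps)

lemma pl_eq: "pl y = {proj_point (of3 u) | u. u \<noteq> (\<lambda>_. 0) \<and> dot y u = 0}"
proof -
  have "(\<forall>v\<in>proj_point (of3 u). of3 y \<bullet> v = 0) \<longleftrightarrow> dot y u = 0" for u
    unfolding proj_point_of3 by (auto simp: scalar_prod_of3 dot_scale dest: spec[of _ 1])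
  then show ?thesis unfolding pl_def proj_line_def proj_plane_of3 by auto
qed

lemma pl_scale: "c \<noteq> 0 \<Longrightarrow> pl (\<lambda>i. c * y i) = pl y"
  unfolding pl_eq by (simp add: dot_scale)

text \<open>The vectors \<open>y k e j - y j e k\<close> span the kernel of \<open>y\<close> when \<open>y k \<noteq> 0\<close>.\<close>

lemma dot_kernel_vector:
  "dot a (\<lambda>i. (if i = j then y k else 0) - (if i = k then y j else 0)) = a j * y k - a k * y j"
  by (simp add: right_diff_distrib sum_subtractf if_distrib[of "(*) _"] cong: if_cong)

lemma proportional_if_kernel_subset:
  assumes "y \<noteq> (\<lambda>_. 0)" "\<And>u. dot y u = 0 \<Longrightarrow> dot a u = 0"
  obtains c where "a = (\<lambda>i. c * y i)"
proof -
  obtain k where k: "y k \<noteq> 0" using assms(1) by auto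
  have "a j = (a k / y k) * y j" for j
    using assms(2)[of "\<lambda>i. (if i = j then y k else 0) - (if i = k then y j else 0)"] k
    unfolding dot_kernel_vector by (simp add: field_simps)
  then show thesis using that by blast
qed

lemma pl_eqD:
  assumes "pl y = pl a" "y \<noteq> (\<lambda>_. 0)"
  obtains c where "a = (\<lambda>i. c * y i)"
proof (rule proportional_if_kernel_subset[OF assms(2)])
  fix u assume u: "dot y u = 0"
  show "dot a u = 0"
  proof (cases "u = (\<lambda>_. 0)")
    case False
    then have "proj_point (of3 u) \<in> pl a" using u assms(1) by (auto simp: pl_eq)
    then obtain u' where u': "proj_point (of3 u) = proj_point (of3 u')" "dot a u' = 0"
      by (auto simp: pl_eq)
    then obtain c where "u = (\<lambda>i. c * u' i)" using proj_point_eqD by blast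
    then show ?thesis using u'(2) by (simp add: dot_scale)
  qed simp
qed (rule that)

lemma mvmul_reflection: "mvmul (reflection a v) u i = u i - 2 * dot a u * v i"
proof -
  have "mvmul (reflection a v) u i = mvmul one3 u i - 2 * dot a u * v i"
    by (simp add: mvmul_def reflection_def sum_UNIV_3 algebra_simps del: mvmul_one3)
  then show ?thesis by simp
qed

text \<open>A vector of the kernel of \<open>y\<close> outside the mirror would have to be proportional to \<open>v\<close>,
  and so would its sum with any other vector of this two-dimensional kernel.\<close>

lemma reflection_axis_unique:
  assumes av: "dot a v = 1" and y: "y \<noteq> (\<lambda>_. 0)"
    and fixed: "\<And>u. dot y u = 0 \<Longrightarrow> \<exists>c. mvmul (reflection a v) u = (\<lambda>i. c * u i)"
  obtains c where "a = (\<lambda>i. c * y i)"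
proof (rule proportional_if_kernel_subset[OF y])
  have multiple: "\<exists>c. u = (\<lambda>i. c * v i)" if u: "dot y u = 0" "dot a u \<noteq> 0" for u
  proof -
    obtain c where c: "mvmul (reflection a v) u i = c * u i" for i using fixed[OF u(1)] by metis
    then have e: "(1 - c) * u i = 2 * dot a u * v i" for i
      using c[of i] unfolding mvmul_reflection by (simp add: left_diff_distrib diff_eq_eq add.commute)
    have "c \<noteq> 1"
    proof
      assume "c = 1"
      then have "v i = 0" for i using e[of i] u(2) by simp
      then show False using av by simp
    qed
    then have "u = (\<lambda>i. (2 * dot a u / (1 - c)) * v i)"
      using e by (simp add: fun_eq_iff nonzero_eq_divide_eq mult.commute)
    then show ?thesis by blast
  qed
  fix u assume u: "dot y u = 0"
  show "dot a u = 0"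
  proof (rule ccontr)
    assume au: "dot a u \<noteq> 0"
    obtain c where c: "u = (\<lambda>i. c * v i)" using multiple[OF u au] by blast
    have all: "\<exists>d. x = (\<lambda>i. d * v i)" if x: "dot y x = 0" for x
    proof (cases "dot a x = 0")
      case True
      have add: "dot b (\<lambda>i. u i + x i) = dot b u + dot b x" for b
        by (simp add: distrib_left sum.distrib)
      obtain d where d: "(\<lambda>i. u i + x i) = (\<lambda>i. d * v i)"
        using multiple[of "\<lambda>i. u i + x i"] u x au True unfolding add by auto
      have "x i = (d - c) * v i" for i
        using fun_cong[OF d, of i] fun_cong[OF c, of i] by (simp add: left_diff_distrib eq_diff_eq add.commute)
      then show ?thesis by blast
    qed (use multiple x in blast)
    obtain k where k: "y k \<noteq> 0" using y by auto
    have "\<forall>k :: 3. \<exists>j l. j \<noteq> k \<and> l \<noteq> k \<and> j \<noteq> l"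
      by (intro allI, rule_tac x = "k + 1" in exI, rule_tac x = "k + 2" in exI) simp
    then obtain j l where jl: "j \<noteq> k" "l \<noteq> k" "j \<noteq> l" by blast
    let ?u = "\<lambda>j i. (if i = j then y k else 0) - (if i = k then y j else 0)"
    have ker: "dot y (?u j) = 0" for j unfolding dot_kernel_vector by (simp add: mult.commute)
    obtain d where d: "?u j = (\<lambda>i. d * v i)" using all[OF ker[of j]] by (elim exE)
    obtain e where e: "?u l = (\<lambda>i. e * v i)" using all[OF ker[of l]] by (elim exE)
    have "y k = d * v j" "e * v j = 0" "y k = e * v l"
      using fun_cong[OF d, of j] fun_cong[OF e, of j] fun_cong[OF e, of l] jl by simp_all
    then show False using k by auto
  qed
qed (rule that)

text \<open>A projective point is fixed when its representatives are eigenvectors; the eigenvalue is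
  nonzero since the matrix is invertible, and the zero vector satisfies the condition
  trivially.\<close>

lemma fixes_pointwise_iff:
  assumes M: "M \<in> carrier_mat 3 3" and det: "mdet (m3 M) \<noteq> 0"
  shows "fixes_pointwise {c \<cdot>\<^sub>m M | c. c \<noteq> 0} (pl y) \<longleftrightarrow>
    (\<forall>u. dot y u = 0 \<longrightarrow> (\<exists>c. mvmul (m3 M) u = (\<lambda>i. c * u i)))"
proof -
  have act: "pgl_act {c \<cdot>\<^sub>m M | c. c \<noteq> 0} (proj_point (of3 u)) = proj_point (of3 (mvmul (m3 M) u))" for u
  proof -
    have scaled: "(c \<cdot>\<^sub>m M) *\<^sub>v of3 (\<lambda>i. d * u i) = of3 (\<lambda>i. (c * d) * mvmul (m3 M) u i)" for c d
      using M by (simp add: mat_mult_m3 m3_smult mvmul_smul mvmul_scale mult.assoc mult.left_commute)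
    have "x \<in> pgl_act {c \<cdot>\<^sub>m M | c. c \<noteq> 0} (proj_point (of3 u))
        \<longleftrightarrow> (\<exists>c d. c \<noteq> 0 \<and> x = (c \<cdot>\<^sub>m M) *\<^sub>v of3 (\<lambda>i. d * u i))" for x
      unfolding pgl_act_def proj_point_of3 by blast
    moreover have "(\<exists>c d. c \<noteq> 0 \<and> x = of3 (\<lambda>i. (c * d) * mvmul (m3 M) u i))
        \<longleftrightarrow> x \<in> proj_point (of3 (mvmul (m3 M) u))" for x
    proof
      assume "x \<in> proj_point (of3 (mvmul (m3 M) u))"
      then obtain d where "x = of3 (\<lambda>i. (1 * d) * mvmul (m3 M) u i)" unfolding proj_point_of3 by auto
      then show "\<exists>c d. c \<noteq> 0 \<and> x = of3 (\<lambda>i. (c * d) * mvmul (m3 M) u i)"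
        using one_neq_zero by blast
    qed (unfold proj_point_of3, blast)
    ultimately show ?thesis unfolding scaled by blast
  qed
  have point: "proj_point (of3 (mvmul (m3 M) u)) = proj_point (of3 u) \<longleftrightarrow> (\<exists>c. mvmul (m3 M) u = (\<lambda>i. c * u i))"
    if "u \<noteq> (\<lambda>_. 0)" for u
  proof
    assume "\<exists>c. mvmul (m3 M) u = (\<lambda>i. c * u i)"
    then obtain c where c: "mvmul (m3 M) u = (\<lambda>i. c * u i)" by blast
    then have "c \<noteq> 0" using mvmul_eq_0[OF det] that by auto
    then show "proj_point (of3 (mvmul (m3 M) u)) = proj_point (of3 u)"
      unfolding c by (rule proj_point_scale)
  qed (rule proj_point_eqD)
  have "fixes_pointwise {c \<cdot>\<^sub>m M | c. c \<noteq> 0} (pl y) \<longleftrightarrow>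
      (\<forall>u. u \<noteq> (\<lambda>_. 0) \<longrightarrow> dot y u = 0 \<longrightarrow> proj_point (of3 (mvmul (m3 M) u)) = proj_point (of3 u))"
    unfolding fixes_pointwise_def pl_eq by (force simp: act)
  also have "\<dots> \<longleftrightarrow> (\<forall>u. dot y u = 0 \<longrightarrow> (\<exists>c. mvmul (m3 M) u = (\<lambda>i. c * u i)))"
  proof (intro iffI allI impI)
    fix u
    assume *: "\<forall>u. u \<noteq> (\<lambda>_. 0) \<longrightarrow> dot y u = 0 \<longrightarrow> proj_point (of3 (mvmul (m3 M) u)) = proj_point (of3 u)"
      "dot y u = 0"
    show "\<exists>c. mvmul (m3 M) u = (\<lambda>i. c * u i)"
    proof (cases "u = (\<lambda>_. 0)")
      case True
      then show ?thesis by (simp add: mvmul_def fun_eq_iff)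
    next
      case False
      then show ?thesis using * unfolding point[OF False, symmetric] by blast
    qed
  next
    fix u
    assume "\<forall>u. dot y u = 0 \<longrightarrow> (\<exists>c. mvmul (m3 M) u = (\<lambda>i. c * u i))" "u \<noteq> (\<lambda>_. 0)" "dot y u = 0"
    then show "proj_point (of3 (mvmul (m3 M) u)) = proj_point (of3 u)"
      unfolding point[OF \<open>u \<noteq> (\<lambda>_. 0)\<close>] by blast
  qed
  finally show ?thesis .
qed

text \<open>A multiple of a reflection is scalar on its mirror, and by
  \<open>reflection_axis_unique\<close> on no other plane.\<close>

lemma reflection_fixes_iff:
  assumes "dot a v = 1" "e \<noteq> 0" "y \<noteq> (\<lambda>_. 0)"
  shows "(\<forall>u. dot y u = 0 \<longrightarrow> (\<exists>c. mvmul (smul e (reflection a v)) u = (\<lambda>i. c * u i))) \<longleftrightarrow> pl y = pl a"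
proof
  assume fixed: "\<forall>u. dot y u = 0 \<longrightarrow> (\<exists>c. mvmul (smul e (reflection a v)) u = (\<lambda>i. c * u i))"
  obtain c where c: "a = (\<lambda>i. c * y i)"
  proof (rule reflection_axis_unique[OF assms(1,3)])
    fix u assume "dot y u = 0"
    then obtain c where "(\<lambda>i. e * mvmul (reflection a v) u i) = (\<lambda>i. c * u i)"
      using fixed unfolding mvmul_smul by blast
    then have "e * mvmul (reflection a v) u i = c * u i" for i by metis
    then have "mvmul (reflection a v) u i = (c / e) * u i" for i
      using assms(2) by (simp add: nonzero_eq_divide_eq mult.commute)
    then show "\<exists>c. mvmul (reflection a v) u = (\<lambda>i. c * u i)" by blast
  qed (rule that)
  have "c \<noteq> 0" using assms(1) c by auto
  then show "pl y = pl a" unfolding c by (simp add: pl_scale)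
next
  assume "pl y = pl a"
  have "a \<noteq> (\<lambda>_. 0)" using assms(1) by auto
  then obtain c where c: "y = (\<lambda>i. c * a i)" by (rule pl_eqD[OF \<open>pl y = pl a\<close>[symmetric]])
  then have "c \<noteq> 0" using assms(3) by auto
  have "mvmul (smul e (reflection a v)) u = (\<lambda>i. e * u i)" if "dot y u = 0" for u
  proof -
    have "dot a u = 0" using that \<open>c \<noteq> 0\<close> unfolding c dot_scale by simp
    then show ?thesis by (simp add: mvmul_smul mvmul_reflection)
  qed
  then show "\<forall>u. dot y u = 0 \<longrightarrow> (\<exists>c. mvmul (smul e (reflection a v)) u = (\<lambda>i. c * u i))" by blast
qed

section \<open>Coordinates for the arrangement and conclusion\<close>

section \<open>The Wiman arrangement in coordinates\<close>

text \<open>A line is fixed pointwise iff all vectors of the corresponding plane are eigenvectors.\<close>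

definition axes :: "((nat \<Rightarrow> nat) \<Rightarrow> complex mat3) \<Rightarrow> complex vec set set set" where
  "axes \<rho> = {pl y | y \<sigma>. y \<noteq> (\<lambda>_. 0) \<and> \<sigma> \<in> A6 \<and> \<sigma> \<circ> \<sigma> = id \<and> \<sigma> \<noteq> id \<and>
     (\<forall>u. dot y u = 0 \<longrightarrow> (\<exists>c. mvmul (\<rho> \<sigma>) u = (\<lambda>i. c * u i)))}"

lemma axesI:
  assumes "y \<noteq> (\<lambda>_. 0)" "\<sigma> \<in> A6" "\<sigma> \<circ> \<sigma> = id" "\<sigma> \<noteq> id"
    and "\<forall>u. dot y u = 0 \<longrightarrow> (\<exists>c. mvmul (\<rho> \<sigma>) u = (\<lambda>i. c * u i))"
  shows "pl y \<in> axes \<rho>"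
  unfolding axes_def using assms by (intro CollectI exI[of _ y] exI[of _ \<sigma>] conjI refl)

lemma axesE:
  assumes "l \<in> axes \<rho>"
  obtains y \<sigma> where "l = pl y" "y \<noteq> (\<lambda>_. 0)" "\<sigma> \<in> A6" "\<sigma> \<circ> \<sigma> = id" "\<sigma> \<noteq> id"
    "\<forall>u. dot y u = 0 \<longrightarrow> (\<exists>c. mvmul (\<rho> \<sigma>) u = (\<lambda>i. c * u i))"
  using assms unfolding axes_def by (elim CollectE exE conjE)

lemma ord_eq_2_iff:
  assumes "\<sigma> \<in> A6"
  shows "group.ord (alt_group 6) \<sigma> = 2 \<longleftrightarrow> \<sigma> \<circ> \<sigma> = id \<and> \<sigma> \<noteq> id"
proof -
  interpret group "alt_group 6" by (rule alt_group_is_group)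
  have "ord \<sigma> = 2 \<longleftrightarrow> ord \<sigma> dvd 2 \<and> ord \<sigma> \<noteq> 1" using two_is_prime_nat by (auto simp: prime_nat_iff)
  also have "ord \<sigma> dvd 2 \<longleftrightarrow> \<sigma> \<circ> \<sigma> = id"
    using pow_eq_id[OF assms, of 2] assms by (simp add: numeral_2_eq_2 alt_group_mult alt_group_one)
  also have "ord \<sigma> = 1 \<longleftrightarrow> \<sigma> = id" using ord_eq_1[OF assms] by (simp add: alt_group_one)
  finally show ?thesis .
qed

lemma wiman_arrangement_axes:
  assumes "wiman_arrangement W"
  obtains \<rho> where "proj_rep \<rho>" "W = axes \<rho>"
proof -
  obtain \<phi> where \<phi>: "\<phi> \<in> Group.mon (alt_group 6) PGL3"
    and W: "W = {l \<in> proj_lines. \<exists>\<sigma>\<in>A6. group.ord (alt_group 6) \<sigma> = 2 \<and> fixes_pointwise (\<phi> \<sigma>) l}"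
    using assms unfolding wiman_arrangement_def by blast
  obtain \<rho> where \<rho>: "proj_rep \<rho>"
    and M: "\<forall>\<sigma>\<in>A6. \<exists>M\<in>carrier_mat 3 3. m3 M = \<rho> \<sigma> \<and> \<phi> \<sigma> = {c \<cdot>\<^sub>m M | c. c \<noteq> 0}"
    by (rule proj_rep_of_mon[OF \<phi>])
  interpret proj_rep \<rho> by (rule \<rho>)
  have fixed: "fixes_pointwise (\<phi> \<sigma>) (pl y) \<longleftrightarrow> (\<forall>u. dot y u = 0 \<longrightarrow> (\<exists>c. mvmul (\<rho> \<sigma>) u = (\<lambda>i. c * u i)))"
    if \<sigma>: "\<sigma> \<in> A6" for \<sigma> y
  proof -
    obtain N where N: "N \<in> carrier_mat 3 3" "m3 N = \<rho> \<sigma>" "\<phi> \<sigma> = {c \<cdot>\<^sub>m N | c. c \<noteq> 0}"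
      using bspec[OF M \<sigma>] by (elim bexE conjE)
    show ?thesis unfolding N(3) N(2)[symmetric]
      by (rule fixes_pointwise_iff[OF N(1)]) (simp add: N(2) rho_det[OF \<sigma>])
  qed
  have "W = axes \<rho>"
  proof (intro equalityI subsetI)
    fix l assume "l \<in> W"
    then obtain y \<sigma> where "y \<noteq> (\<lambda>_. 0)" "l = pl y" "\<sigma> \<in> A6" "group.ord (alt_group 6) \<sigma> = 2"
      "fixes_pointwise (\<phi> \<sigma>) (pl y)"
      unfolding W proj_lines_pl by auto
    then show "l \<in> axes \<rho>" using fixed ord_eq_2_iff by (auto intro!: axesI)
  next
    fix l assume "l \<in> axes \<rho>"
    then obtain y \<sigma> where *: "l = pl y" "y \<noteq> (\<lambda>_. 0)" "\<sigma> \<in> A6" "\<sigma> \<circ> \<sigma> = id" "\<sigma> \<noteq> id"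
      "\<forall>u. dot y u = 0 \<longrightarrow> (\<exists>c. mvmul (\<rho> \<sigma>) u = (\<lambda>i. c * u i))"
      by (rule axesE)
    have "fixes_pointwise (\<phi> \<sigma>) (pl y)" "group.ord (alt_group 6) \<sigma> = 2"
      unfolding fixed[OF *(3)] ord_eq_2_iff[OF *(3)] using * by simp_all
    then show "l \<in> W" unfolding W proj_lines_pl using *(1-3) by blast
  qed
  then show thesis by (rule that[OF \<rho>])
qed

lemma A6_conj:
  assumes "\<pi> permutes {1..6}" "\<sigma> \<in> A6"
  shows "\<pi> \<circ> \<sigma> \<circ> inv_into UNIV \<pi> \<in> A6"
proof -
  have p: "permutation \<pi>" "permutation (inv_into UNIV \<pi>)" "permutation \<sigma>"
    using assms permutes_inv permutation_permutes A6_permutes finite_atLeastAtMost by blast+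
  have "\<pi> \<circ> \<sigma> \<circ> inv_into UNIV \<pi> permutes {1..6}"
    by (intro permutes_compose permutes_inv assms A6_permutes)
  moreover have "evenperm (\<pi> \<circ> \<sigma> \<circ> inv_into UNIV \<pi>)"
    using assms(2) p by (simp add: evenperm_comp evenperm_inv permutation_compose alt_group_carrier)
  ultimately show ?thesis by (simp add: alt_group_carrier)
qed

text \<open>Conjugation by any permutation of the six points, odd ones included, is an automorphism
  of A6, so it only permutes the involutions. This lets the deleted line be the axis of (1 2)(3
  4).\<close>

lemma (in proj_rep) relabel:
  assumes \<pi>: "\<pi> permutes {1..6}"
  shows "proj_rep (\<lambda>\<sigma>. \<rho> (\<pi> \<circ> \<sigma> \<circ> inv_into UNIV \<pi>))" "axes (\<lambda>\<sigma>. \<rho> (\<pi> \<circ> \<sigma> \<circ> inv_into UNIV \<pi>)) = axes \<rho>"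
proof -
  note inverses = permutes_inverses[OF \<pi>]
  have conj: "\<pi> \<circ> (\<sigma> \<circ> \<tau>) \<circ> inv_into UNIV \<pi> = (\<pi> \<circ> \<sigma> \<circ> inv_into UNIV \<pi>) \<circ> (\<pi> \<circ> \<tau> \<circ> inv_into UNIV \<pi>)" for \<sigma> \<tau>
    by (rule ext) (simp add: inverses)
  have conj': "inv_into UNIV \<pi> \<circ> (\<sigma> \<circ> \<tau>) \<circ> \<pi> = (inv_into UNIV \<pi> \<circ> \<sigma> \<circ> \<pi>) \<circ> (inv_into UNIV \<pi> \<circ> \<tau> \<circ> \<pi>)" for \<sigma> \<tau>
    by (rule ext) (simp add: inverses)
  have inverse: "\<pi> \<circ> (inv_into UNIV \<pi> \<circ> \<sigma> \<circ> \<pi>) \<circ> inv_into UNIV \<pi> = \<sigma>" "inv_into UNIV \<pi> \<circ> (\<pi> \<circ> \<sigma> \<circ> inv_into UNIV \<pi>) \<circ> \<pi> = \<sigma>" for \<sigma>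
    by (rule ext, simp add: inverses)+
  have ids: "\<pi> \<circ> id \<circ> inv_into UNIV \<pi> = id" "inv_into UNIV \<pi> \<circ> id \<circ> \<pi> = id" by (rule ext, simp add: inverses)+
  have conj_id: "\<pi> \<circ> \<sigma> \<circ> inv_into UNIV \<pi> = id \<longleftrightarrow> \<sigma> = id" for \<sigma> using inverse ids by metis
  have A6': "inv_into UNIV \<pi> \<circ> \<sigma> \<circ> \<pi> \<in> A6" if "\<sigma> \<in> A6" for \<sigma>
    using A6_conj[OF permutes_inv[OF \<pi>] that] by (simp add: permutes_inv_inv[OF \<pi>])
  show "proj_rep (\<lambda>\<sigma>. \<rho> (\<pi> \<circ> \<sigma> \<circ> inv_into UNIV \<pi>))"
  proof
    show "\<exists>c. c \<noteq> 0 \<and> mmul (\<rho> (\<pi> \<circ> \<sigma> \<circ> inv_into UNIV \<pi>)) (\<rho> (\<pi> \<circ> \<tau> \<circ> inv_into UNIV \<pi>)) = smul c (\<rho> (\<pi> \<circ> (\<sigma> \<circ> \<tau>) \<circ> inv_into UNIV \<pi>))"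
      if "\<sigma> \<in> A6" "\<tau> \<in> A6" for \<sigma> \<tau>
      unfolding conj by (rule rho_mult[OF A6_conj[OF \<pi> that(1)] A6_conj[OF \<pi> that(2)]])
    show "mdet (\<rho> (\<pi> \<circ> \<sigma> \<circ> inv_into UNIV \<pi>)) \<noteq> 0" if "\<sigma> \<in> A6" for \<sigma>
      by (rule rho_det[OF A6_conj[OF \<pi> that]])
    show "\<sigma> = id" if "\<sigma> \<in> A6" "\<rho> (\<pi> \<circ> \<sigma> \<circ> inv_into UNIV \<pi>) = smul c one3" for \<sigma> c
      using rho_faithful[OF A6_conj[OF \<pi> that(1)] that(2)] unfolding conj_id .
  qed
  show "axes (\<lambda>\<sigma>. \<rho> (\<pi> \<circ> \<sigma> \<circ> inv_into UNIV \<pi>)) = axes \<rho>"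
  proof (intro equalityI subsetI)
    fix l assume "l \<in> axes (\<lambda>\<sigma>. \<rho> (\<pi> \<circ> \<sigma> \<circ> inv_into UNIV \<pi>))"
    then obtain y \<sigma> where *: "l = pl y" "y \<noteq> (\<lambda>_. 0)" "\<sigma> \<in> A6" "\<sigma> \<circ> \<sigma> = id" "\<sigma> \<noteq> id"
      "\<forall>u. dot y u = 0 \<longrightarrow> (\<exists>c. mvmul (\<rho> (\<pi> \<circ> \<sigma> \<circ> inv_into UNIV \<pi>)) u = (\<lambda>i. c * u i))"
      by (rule axesE)
    have "(\<pi> \<circ> \<sigma> \<circ> inv_into UNIV \<pi>) \<circ> (\<pi> \<circ> \<sigma> \<circ> inv_into UNIV \<pi>) = id" unfolding conj[symmetric] *(4) by (rule ids)
    moreover have "\<pi> \<circ> \<sigma> \<circ> inv_into UNIV \<pi> \<noteq> id" unfolding conj_id by (rule *(5))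
    ultimately show "l \<in> axes \<rho>"
      unfolding *(1) by (rule axesI[where \<rho> = \<rho>, OF *(2) A6_conj[OF \<pi> *(3)] _ _ *(6)])
  next
    fix l assume "l \<in> axes \<rho>"
    then obtain y \<sigma> where *: "l = pl y" "y \<noteq> (\<lambda>_. 0)" "\<sigma> \<in> A6" "\<sigma> \<circ> \<sigma> = id" "\<sigma> \<noteq> id"
      "\<forall>u. dot y u = 0 \<longrightarrow> (\<exists>c. mvmul (\<rho> \<sigma>) u = (\<lambda>i. c * u i))"
      by (rule axesE)
    have "(inv_into UNIV \<pi> \<circ> \<sigma> \<circ> \<pi>) \<circ> (inv_into UNIV \<pi> \<circ> \<sigma> \<circ> \<pi>) = id" unfolding conj'[symmetric] *(4) by (rule ids)
    moreover have "inv_into UNIV \<pi> \<circ> \<sigma> \<circ> \<pi> \<noteq> id" using *(5) inverse ids by metis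
    ultimately show "l \<in> axes (\<lambda>\<sigma>. \<rho> (\<pi> \<circ> \<sigma> \<circ> inv_into UNIV \<pi>))"
      unfolding *(1) by (rule axesI[where \<rho> = "\<lambda>\<sigma>. \<rho> (\<pi> \<circ> \<sigma> \<circ> inv_into UNIV \<pi>)", OF *(2) A6'[OF *(3)]])
        (unfold inverse, rule *(6))
  qed
qed

lemma ex_relabelling:
  assumes "{a, b, c, d} \<subseteq> {1..6::nat}" "distinct [a, b, c, d]"
  obtains \<pi> where "\<pi> permutes {1..6}" "\<pi> 1 = a" "\<pi> 2 = b" "\<pi> 3 = c" "\<pi> 4 = d"
proof -
  have "card ({1..6} - {a, b, c, d}) = card {5, 6::nat}"
    using assms by (simp add: card_Diff_subset)
  then obtain g :: "nat \<Rightarrow> nat" where g: "bij_betw g {5, 6} ({1..6} - {a, b, c, d})"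
    by (metis finite_same_card_bij finite.emptyI finite.insertI finite_Diff finite_atLeastAtMost)
  define \<pi> where "\<pi> x = (if x = 1 then a else if x = 2 then b else if x = 3 then c else if x = 4 then d
      else if x \<in> {5, 6} then g x else x)" for x
  have "bij_betw \<pi> {1, 2, 3, 4} {a, b, c, d}"
    using assms(2) by (auto simp: bij_betw_def inj_on_def \<pi>_def)
  moreover have "bij_betw \<pi> {5, 6} ({1..6} - {a, b, c, d})"
    using g by (rule bij_betw_cong[THEN iffD1, rotated]) (auto simp: \<pi>_def)
  ultimately have "bij_betw \<pi> ({1, 2, 3, 4} \<union> {5, 6}) ({a, b, c, d} \<union> ({1..6} - {a, b, c, d}))"
    by (rule bij_betw_combine) blast
  moreover have "{1, 2, 3, 4} \<union> {5, 6} = {1..6::nat}" by auto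
  moreover have "{a, b, c, d} \<union> ({1..6} - {a, b, c, d}) = {1..6}" using assms(1) by blast
  ultimately have "bij_betw \<pi> {1..6} {1..6}" by simp
  then have "\<pi> permutes {1..6}" by (rule bij_imp_permutes) (auto simp: \<pi>_def)
  then show thesis by (rule that) (simp_all add: \<pi>_def)
qed

lemma (in golden) line_list_nonzero: "(x, y, z) \<in> set line_list \<Longrightarrow> vec3 x y z \<noteq> (\<lambda>_. 0)"
proof -
  have "\<forall>p\<in>set tab. fst (fst p) \<noteq> 0 \<or> snd (fst p) \<noteq> 0" by (simp add: tab_def)
  then show "(x, y, z) \<in> set line_list \<Longrightarrow> vec3 x y z \<noteq> (\<lambda>_. 0)"
    by (force simp: line_list_def vec3_nonzero)
qed

lemma tr3_inverse:
  assumes "mmul H G = one3"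
  shows "mvmul (tr3 G) (mvmul (tr3 H) a) = a"
  by (simp add: mvmul_mmul[symmetric] tr3_mmul[symmetric] assms)

text \<open>After relabelling, the given line belongs to (1 2)(3 4), whose axis in adapted
  coordinates is x = 0. Covectors return to the original coordinates by the transpose of
  \<open>H\<close>.\<close>

theorem wiman_coordinates:
  assumes W: "wiman_arrangement W" and l: "l \<in> W"
  obtains t w G H where "golden t w" "mmul H G = one3" "mmul G H = one3"
    "W = (\<lambda>(x, y, z). pl (mvmul (tr3 H) (vec3 x y z))) ` set (golden.line_list t w)"
    "l = pl (mvmul (tr3 H) (vec3 1 0 0))"
proof -
  obtain \<rho>0 where \<rho>0: "proj_rep \<rho>0" "W = axes \<rho>0" by (rule wiman_arrangement_axes[OF W])
  obtain y \<sigma> where y: "l = pl y" "y \<noteq> (\<lambda>_. 0)" "\<sigma> \<in> A6" "\<sigma> \<circ> \<sigma> = id" "\<sigma> \<noteq> id"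
    "\<forall>u. dot y u = 0 \<longrightarrow> (\<exists>c. mvmul (\<rho>0 \<sigma>) u = (\<lambda>i. c * u i))"
    using l unfolding \<rho>0(2) by (rule axesE)
  obtain a b c d where abcd: "\<sigma> = S a b c d" "{a, b, c, d} \<subseteq> {1..6}" "distinct [a, b, c, d]"
    by (rule involution_cases[OF y(3-5)])
  obtain \<pi> where \<pi>: "\<pi> permutes {1..6}" "\<pi> 1 = a" "\<pi> 2 = b" "\<pi> 3 = c" "\<pi> 4 = d"
    by (rule ex_relabelling[OF abcd(2,3)])
  define \<rho>1 where "\<rho>1 \<sigma> = \<rho>0 (\<pi> \<circ> \<sigma> \<circ> inv_into UNIV \<pi>)" for \<sigma>
  have "proj_rep \<rho>1" and axes1: "W = axes \<rho>1"
    unfolding \<rho>1_def \<rho>0(2) using proj_rep.relabel[OF \<rho>0(1) \<pi>(1)] by simp_all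
  interpret one: proj_rep \<rho>1 by fact
  have "\<pi> \<circ> S 1 2 3 4 \<circ> inv_into UNIV \<pi> = \<sigma>"
    unfolding abcd(1) \<pi>(2-5)[symmetric] using permutes_inv_o[OF \<pi>(1)] by (rule S_conj)
  then have y1: "\<forall>u. dot y u = 0 \<longrightarrow> (\<exists>c. mvmul (\<rho>1 (S 1 2 3 4)) u = (\<lambda>i. c * u i))"
    using y(6) unfolding \<rho>1_def by (simp only:)
  obtain G H A B T T' where HG: "mmul H G = one3" "mmul G H = one3"
    and N: "one.nrm (S 1 2 3 4) A" "one.nrm (S 1 3 2 4) B" "one.nrm (S 1 2 5 6) T" "one.nrm (S 1 3 5 6) T'"
    and D: "mmul H (mmul A G) = D1" "mmul H (mmul B G) = D2" "mmul H (mmul T G) = T1" "mmul H (mmul T' G) = T2"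
    by (rule one.adapted_coordinates)
  define \<rho>2 where "\<rho>2 = (\<lambda>\<sigma>. mmul H (mmul (\<rho>1 \<sigma>) G))"
  have "proj_rep \<rho>2" unfolding \<rho>2_def by (rule one.proj_rep_conj[OF HG])
  then interpret two: proj_rep \<rho>2 .
  note nrm2 = one.nrm_conj_rep[OF HG, folded \<rho>2_def]
  interpret two: a6_coords \<rho>2
    by unfold_locales (use nrm2[OF N(1)] nrm2[OF N(2)] nrm2[OF N(3)] nrm2[OF N(4)] in \<open>simp_all only: D\<close>)
  obtain t w where tw: "golden t w" "two.nrm (S 1 2 3 5) (smul (- 1) (golden.icosahedral t w))"
    by (rule two.icosahedral_lift)
  interpret golden t w by (rule tw(1))
  interpret two: a6_golden \<rho>2 t w by unfold_locales (rule tw(2))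
  \<comment> \<open>Undoing the conjugation exhibits each matrix as a multiple of the reflection
    with the transformed covector; such a matrix fixes exactly one line pointwise.\<close>
  have axis: "(\<forall>u. dot y u = 0 \<longrightarrow> (\<exists>c. mvmul (\<rho>1 \<sigma>) u = (\<lambda>i. c * u i))) \<longleftrightarrow> pl y = pl (mvmul (tr3 H) x)"
    if R: "two.R \<sigma> x" and y: "y \<noteq> (\<lambda>_. 0)" for \<sigma> x y
  proof -
    obtain v where v: "dot x v = 1" "two.nrm \<sigma> (smul (- 1) (reflection x v))"
      using R unfolding two.R_def by (elim exE conjE)
    then obtain c where c: "c \<noteq> 0" "smul (- 1) (reflection x v) = smul c (\<rho>2 \<sigma>)"
      unfolding two.nrm_def two.pr_def by blast
    have "\<rho>1 \<sigma> = mmul (mmul G H) (mmul (\<rho>1 \<sigma>) (mmul G H))" by (simp add: HG)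
    also have "\<dots> = mmul G (mmul (\<rho>2 \<sigma>) H)" unfolding \<rho>2_def by (simp only: mmul_assoc)
    also have "\<rho>2 \<sigma> = smul (- 1 / c) (reflection x v)"
    proof -
      have "smul (1 / c) (smul (- 1) (reflection x v)) = smul (1 / c) (smul c (\<rho>2 \<sigma>))" by (simp only: c(2))
      then show ?thesis using c(1) by (simp add: smul_simps)
    qed
    also have "mmul G (mmul \<dots> H) = smul (- 1 / c) (reflection (mvmul (tr3 H) x) (mvmul G v))"
      by (simp only: smul_simps reflection_conjugate[OF HG(2)])
    finally have \<rho>1: "\<rho>1 \<sigma> = \<dots>" .
    have "dot (mvmul (tr3 H) x) (mvmul G v) = 1" using v(1) by (simp add: dual_conjugate[OF HG(1)])
    then show ?thesis unfolding \<rho>1 by (rule reflection_fixes_iff) (use c(1) y in simp_all)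
  qed
  have len: "length quads = length line_list" and
    lines: "\<And>i. i < length quads \<Longrightarrow> (\<lambda>(a, b, c, d) (x, y, z). two.R (S a b c d) (vec3 x y z)) (quads ! i) (line_list ! i)"
    using two.involution_lines by (simp_all add: list_all2_conv_all_nth)
  have nonzero: "mvmul (tr3 H) v \<noteq> (\<lambda>_. 0)" if "v \<noteq> (\<lambda>_. 0)" for v
  proof
    assume "mvmul (tr3 H) v = (\<lambda>_. 0)"
    then have "v = mvmul (tr3 G) (\<lambda>_. 0)" using tr3_inverse[OF HG(1), of v] by simp
    then have "v = (\<lambda>_. 0)" by (simp add: mvmul_def fun_eq_iff)
    then show False using that by simp
  qed
  have "W = (\<lambda>(x, y, z). pl (mvmul (tr3 H) (vec3 x y z))) ` set line_list"
  proof (intro equalityI subsetI)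
    fix l assume "l \<in> W"
    then obtain y \<sigma> where *: "l = pl y" "y \<noteq> (\<lambda>_. 0)" "\<sigma> \<in> A6" "\<sigma> \<circ> \<sigma> = id" "\<sigma> \<noteq> id"
      "\<forall>u. dot y u = 0 \<longrightarrow> (\<exists>c. mvmul (\<rho>1 \<sigma>) u = (\<lambda>i. c * u i))"
      unfolding axes1 by (rule axesE)
    obtain a b c d where q: "\<sigma> = S a b c d" "(a, b, c, d) \<in> set quads"
      by (rule involution_quads[OF *(3-5)])
    obtain i where i: "i < length quads" "quads ! i = (a, b, c, d)"
      using q(2) by (metis in_set_conv_nth)
    obtain x1 x2 x3 where x: "line_list ! i = (x1, x2, x3)" by (rule prod_cases3)
    have "two.R \<sigma> (vec3 x1 x2 x3)" using lines[OF i(1)] unfolding i(2) x q(1) by simp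
    then have "l = pl (mvmul (tr3 H) (vec3 x1 x2 x3))" using axis *(1,2,6) by simp
    moreover have "(x1, x2, x3) \<in> set line_list" using nth_mem[of i line_list] i(1) len x by simp
    ultimately show "l \<in> (\<lambda>(x, y, z). pl (mvmul (tr3 H) (vec3 x y z))) ` set line_list"
      by (intro image_eqI[of _ _ "(x1, x2, x3)"]) simp_all
  next
    fix l assume "l \<in> (\<lambda>(x, y, z). pl (mvmul (tr3 H) (vec3 x y z))) ` set line_list"
    then obtain x1 x2 x3 where l: "l = pl (mvmul (tr3 H) (vec3 x1 x2 x3))" and x: "(x1, x2, x3) \<in> set line_list"
      by auto
    obtain i where i: "i < length line_list" "line_list ! i = (x1, x2, x3)"
      using x by (metis in_set_conv_nth)
    obtain a b c d where q: "quads ! i = (a, b, c, d)" by (rule prod_cases4)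
    have "two.R (S a b c d) (vec3 x1 x2 x3)" using lines[of i] i q len by simp
    note R = axis[OF this nonzero[OF line_list_nonzero[OF x]]]
    have mem: "(a, b, c, d) \<in> set quads" using nth_mem[of i quads] i(1) len q by simp
    show "l \<in> W" unfolding axes1 l
      by (rule axesI[where \<rho> = \<rho>1, OF nonzero[OF line_list_nonzero[OF x]] quads_valid[OF mem]])
        (unfold R, rule refl)
  qed
  moreover have "l = pl (mvmul (tr3 H) (vec3 1 0 0))"
    using axis[OF two.base_d1 y(2)] y1 y(1) by simp
  ultimately show thesis by (rule that[OF tw(1) HG])
qed

lemma three_syzygies_cst_mult:
  assumes "c \<noteq> 0"
  shows "three_syzygies (cst c * f) ds \<longleftrightarrow> three_syzygies f ds"
proof -
  have "der \<theta> (cst c * f) = 0 \<longleftrightarrow> der \<theta> f = 0" for \<theta>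
    using assms by (simp add: der_cst_mult)
  then show ?thesis unfolding three_syzygies_def by simp
qed

lemma prod_cst: "(\<Prod>i\<in>A. cst (c i)) = cst (\<Prod>i\<in>A. c i)"
  by (induction A rule: infinite_finite_induct) (simp_all add: cst_mult)

lemma linear_form_of3: "linear_form (of3 z) = lf z"
proof -
  have "linear_form (of3 z) = (\<Sum>i\<in>{0..<3}. Poly_Mapping.single (Poly_Mapping.single (of_nat i) 1) (of3 z $ i))"
    by (simp add: linear_form_def atLeast0LessThan)
  also have "\<dots> = (\<Sum>k\<in>UNIV. Poly_Mapping.single (Poly_Mapping.single k 1) (z k))"
    by (simp add: sum_less_3 of3_def)
  finally show ?thesis by (simp add: lf_def var_def mult_single)
qed

text \<open>Contrapositively, forms that do not divide each other give distinct lines in the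
  original coordinates.\<close>

lemma pl_transform_eqD:
  assumes "mmul H G = one3" "pl (mvmul (tr3 H) x) = pl (mvmul (tr3 H) x')" "mvmul (tr3 H) x \<noteq> (\<lambda>_. 0)"
  shows "lf x dvd lf x'"
proof -
  obtain c where c: "mvmul (tr3 H) x' = (\<lambda>i. c * mvmul (tr3 H) x i)"
    by (rule pl_eqD[OF assms(2,3)])
  have "x' = mvmul (tr3 G) (mvmul (tr3 H) x')" by (simp only: tr3_inverse[OF assms(1)])
  also have "\<dots> = (\<lambda>i. c * x i)" unfolding c mvmul_scale tr3_inverse[OF assms(1)] ..
  finally show ?thesis by (simp add: lf_scale)
qed

lemma set_concat_pairs:
  "set (concat (map (\<lambda>((b, c), es). map (\<lambda>e. (e, b, c)) es) xs))
    = (\<lambda>(p, e). (e, fst (fst (xs ! p)), snd (fst (xs ! p)))) ` (SIGMA p:{..<length xs}. set (snd (xs ! p)))"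
proof -
  have "set (concat (map (\<lambda>((b, c), es). map (\<lambda>e. (e, b, c)) es) xs))
      = (\<Union>x\<in>set xs. (\<lambda>e. (e, fst (fst x), snd (fst x))) ` set (snd x))"
    by (simp add: case_prod_beta)
  also have "set xs = (!) xs ` {..<length xs}" by (auto simp: set_conv_nth)
  finally show ?thesis by force
qed

context golden
begin

definition covector :: "nat \<times> complex \<Rightarrow> 3 \<Rightarrow> complex" where
  "covector = (\<lambda>(p, e). vec3 e (fst (fst (tab ! p))) (snd (fst (tab ! p))))"

lemma form_covector: "lines.form i = lf (covector i)"
  by (simp add: lines.form_def covector_def case_prod_beta)

lemma image_line_list:
  "(\<lambda>(x, y, z). h (vec3 x y z)) ` set line_list = insert (h (vec3 1 0 0)) ((\<lambda>i. h (covector i)) ` lines.L)"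
proof -
  have "set line_list
      = insert (1, 0, 0) ((\<lambda>(p, e). (e, fst (fst (tab ! p)), snd (fst (tab ! p)))) ` lines.L)"
    unfolding line_list_def list.set set_concat_pairs lines.L_def by (simp only: length_tab)
  then show ?thesis by (simp only: image_insert image_image covector_def case_prod_beta fst_conv snd_conv)
qed

end

theorem proposition5p3:
  fixes W :: "complex vec set set set" and l :: "complex vec set set"
  assumes "wiman_arrangement W"
    and "l \<in> W"
  shows "plus_one_generated_arrangement (W - {l}) (19, 25, 28)"
proof -
  obtain t w G H where tw: "golden t w" and HG: "mmul H G = one3" "mmul G H = one3"
    and W: "W = (\<lambda>(x, y, z). pl (mvmul (tr3 H) (vec3 x y z))) ` set (golden.line_list t w)"
    and l: "l = pl (mvmul (tr3 H) (vec3 1 0 0))"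
    by (rule wiman_coordinates[OF assms])
  interpret golden t w by (rule tw)
  define g where "g i = pl (mvmul (tr3 H) (covector i))" for i
  have W: "W = insert l (g ` lines.L)"
    unfolding W l g_def by (rule image_line_list)
  have nonzero: "mvmul (tr3 H) v \<noteq> (\<lambda>_. 0)" if "lf v \<noteq> 0" for v
  proof
    assume "mvmul (tr3 H) v = (\<lambda>_. 0)"
    then have "v = mvmul (tr3 G) (\<lambda>_. 0)" using tr3_inverse[OF HG(1), of v] by simp
    then have "v = (\<lambda>_. 0)" by (simp add: mvmul_def fun_eq_iff)
    then show False using that by simp
  qed
  have cov_nonzero: "mvmul (tr3 H) (covector i) \<noteq> (\<lambda>_. 0)" if "i \<in> lines.L" for i
    using lines.form_prime[OF that] by (intro nonzero) (auto simp: form_covector)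
  have g_eqD: "i = j" if "i \<in> lines.L" "j \<in> lines.L" "g i = g j" for i j
    using pl_transform_eqD[OF HG(1) that(3)[unfolded g_def] cov_nonzero[OF that(1)]]
      lines.form_ndvd[OF that(1,2)] unfolding form_covector by blast
  have inj: "inj_on g lines.L" by (rule inj_onI) (rule g_eqD)
  have "l \<notin> g ` lines.L"
  proof
    assume "l \<in> g ` lines.L"
    then obtain i where i: "i \<in> lines.L" "pl (mvmul (tr3 H) (covector i)) = pl (mvmul (tr3 H) (vec3 1 0 0))"
      unfolding l g_def by auto
    show False
      using pl_transform_eqD[OF HG(1) i(2) cov_nonzero[OF i(1)]] lines.form_ndvd_X0[OF i(1)]
      unfolding form_covector var_eq_lf by blast
  qed
  then have W': "W - {l} = g ` lines.L" unfolding W by blast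
  have card: "card (W - {l}) = 44"
    unfolding W' card_image[OF inj] using card_lines(1) by (simp only: lines.n_def)
  have "line_arrangement (W - {l})"
    unfolding line_arrangement_def W'
    using lines.fin_L assms(1) by (auto simp: proj_lines_pl g_def intro!: cov_nonzero)
  moreover have "plus_one_generated 44 f (19, 25, 28)" if f: "defining_polynomial (W - {l}) f" for f
  proof -
    obtain a where a: "\<And>l'. l' \<in> W - {l} \<Longrightarrow> a l' \<in> carrier_vec 3 - {0\<^sub>v 3} \<and> proj_line (a l') = l'"
      and f_prod: "f = (\<Prod>l\<in>W - {l}. linear_form (a l))"
      using f unfolding defining_polynomial_def by blast
    define b where "b i = to3 (a (g i))" for i
    have b: "of3 (b i) = a (g i)" "b i \<noteq> (\<lambda>_. 0)" "pl (b i) = g i" if i: "i \<in> lines.L" for i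
    proof -
      have gi: "a (g i) \<in> carrier_vec 3" "a (g i) \<noteq> 0\<^sub>v 3" "proj_line (a (g i)) = g i"
        using a[of "g i"] i unfolding W' by auto
      show 1: "of3 (b i) = a (g i)" unfolding b_def by (rule of3_to3[OF gi(1)])
      show "b i \<noteq> (\<lambda>_. 0)" using gi(2) unfolding 1[symmetric] of3_0[symmetric] by auto
      show "pl (b i) = g i" unfolding pl_def 1 by (rule gi(3))
    qed
    have f_lf: "f = (\<Prod>i\<in>lines.L. lf (b i))"
      unfolding f_prod W' prod.reindex[OF inj]
      by (rule prod.cong) (simp_all flip: b(1) add: linear_form_of3)
    have ndvd: "\<not> lf (b i) dvd lf (b j)" if "i \<in> lines.L" "j \<in> lines.L" "i \<noteq> j" for i j
    proof
      assume "lf (b i) dvd lf (b j)"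
      then obtain c where c: "b j = (\<lambda>k. c * b i k)" by (rule lf_dvd_lfD)
      then have "c \<noteq> 0" using b(2)[OF that(2)] by auto
      then have "pl (b j) = pl (b i)" unfolding c by (rule pl_scale)
      then show False using g_eqD[OF that(1,2)] b(3)[OF that(1)] b(3)[OF that(2)] that(3) by simp
    qed
    have "homogeneous (\<Sum>i\<in>lines.L. 1) f"
      unfolding f_lf by (intro homogeneous_prod homogeneous_lf)
    moreover have "squarefree f"
      unfolding f_lf by (rule squarefree_prod_primes) (use lines.fin_L b(2) ndvd in \<open>auto intro: prime_elem_lf\<close>)
    ultimately have red: "reduced_plane_curve 44 f"
      using card_lines(1) by (simp add: reduced_plane_curve_def lines.n_def)
    \<comment> \<open>The defining polynomial may use any representatives of the lines. In adapted
      coordinates each is a nonzero constant times the standard form, and the total constant does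
      not change the syzygies.\<close>
    have scaled: "\<exists>c. c \<noteq> 0 \<and> lsub G (lf (b i)) = cst c * lines.form i" if i: "i \<in> lines.L" for i
    proof -
      have "pl (mvmul (tr3 H) (covector i)) = pl (b i)" using b(3)[OF i] by (simp add: g_def)
      then obtain c where c: "b i = (\<lambda>k. c * mvmul (tr3 H) (covector i) k)"
        by (rule pl_eqD[OF _ cov_nonzero[OF i]])
      then have "c \<noteq> 0" using b(2)[OF i] by auto
      moreover have "lsub G (lf (b i)) = cst c * lines.form i"
        by (simp only: c lf_scale lsub_hom lsub_lf tr3_inverse[OF HG(1)] form_covector)
      ultimately show ?thesis by blast
    qed
    have "\<forall>i\<in>lines.L. \<exists>c. c \<noteq> 0 \<and> lsub G (lf (b i)) = cst c * lines.form i"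
      by (rule ballI) (rule scaled)
    from bchoice[OF this] obtain c where c: "\<forall>i\<in>lines.L. c i \<noteq> 0 \<and> lsub G (lf (b i)) = cst (c i) * lines.form i"
      by (elim exE)
    have "lsub G f = (\<Prod>i\<in>lines.L. cst (c i) * lines.form i)"
      unfolding f_lf lsub_hom(9) using c by (intro prod.cong) auto
    also have "\<dots> = cst (\<Prod>i\<in>lines.L. c i) * lines.f"
      by (simp add: prod.distrib prod_cst lines.f_def)
    finally have lsub: "lsub G f = \<dots>" .
    have "(\<Prod>i\<in>lines.L. c i) \<noteq> 0" using c lines.fin_L by simp
    then have "three_syzygies (lsub G f) (vec3 19 25 28)"
      unfolding lsub using deletion_wiman by (simp add: three_syzygies_cst_mult)
    then have "three_syzygies f (vec3 19 25 28)"
      by (rule three_syzygies_lsub[OF HG(2,1)])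
    from syzygy_curve_of_three_syzygies[OF red this]
    show ?thesis by (simp add: plus_one_generated_def)
  qed
  ultimately show ?thesis
    unfolding plus_one_generated_arrangement_def card by blast
qed

end
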